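(* Let $\varepsilon\in(0,1)$. Let $G$ be a graph on vertex set $[n]$ with average degree $\bar d$ and maximum degree $\Delta \le \frac{\varepsilon^2 n}{3(\bar d+1)^3}$, presented as an insertion-only edge-arrival stream. Then, with probability at least $2/3$, the output $\widehat\lambda$ of the algorithm CWEI (described in the context) satisfies $(1-\varepsilon)\lambda\le\widehat\lambda\le(1+\varepsilon)\lambda$, where $\lambda$ is the Caro–Wei bound of $G$, and CWEI uses $\mathcal{O}(\bar d\,\varepsilon^{-2}\log n)$ bits of working space.
   Context: Graphs are simple and undirected with vertex set $[n]=\{1,\dots,n\}$, $n$ known in advance; $d(v)$ is the degree of $v$, $\bar d$ the average degree, $\Delta$ the maximum degree. The Caro–Wei bound is $\lambda=\lambda(G)=\sum_{v\in V(G)}\frac{1}{d(v)+1}$. An insertion-only edge-arrival stream presents the edges of $G$ one at a time in arbitrary order, with no deletions. A family $\mathcal H$ of functions $h:[n]\to[n^3]$ is $\varepsilon$-min-wise if for every $A\subset[n]$ and $x\in[n]\setminus A$, $\Pr_{h\in\mathcal H}[\forall a\in A:\ h(x)<h(a)]=\frac{1\pm\varepsilon}{|A|+1}$ (i.e., lies in $[\frac{1-\varepsilon}{|A|+1},\frac{1+\varepsilon}{|A|+1}]$); such a family is realized by an $\mathcal O(\log\varepsilon^{-1})$-wise independent family (valid when $\varepsilon=\omega(n^{-2})$), storable in $\mathcal O(\log\varepsilon^{-1}\log n)$ bits. Algorithm CWEI (input $\bar d,\varepsilon$): set $p=4(\bar d+1)/(\varepsilon^2 n)$; let $S$ be a set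 of $pn$ vertices sampled uniformly at random from $[n]$; pick $h$ uniformly at random from an $\varepsilon$-min-wise family $[n]\to[n^3]$. For each streamed edge $(u,v)$: if $u\in S$ and $h(u)\ge h(v)$, remove $u$ from $S$; if $v\in S$ and $h(v)\ge h(u)$, remove $v$ from $S$. At the end output $\widehat\lambda=|S|/p$.
   Formalization: The min-wise family is also assumed K(1+ln(1/ε))-wise independent for a large absolute K and storable in O((1+ln(1/ε)) log n) bits; p is capped at 1 and pn rounded up; the space bound has max(1,d̄) for d̄, as it fails for the empty graph. *)

theory Defs
  imports "HOL-Probability.Probability"
begin

section \<open>Graphs on the vertex set [n]\<close>

definition simple_graph :: "nat \<Rightarrow> nat set set \<Rightarrow> bool" where
  "simple_graph n E \<longleftrightarrow> (\<forall>e\<in>E. e \<subseteq> {1..n} \<and> card e = 2)"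

definition degree :: "nat set set \<Rightarrow> nat \<Rightarrow> nat" where
  "degree E v = card {e \<in> E. v \<in> e}"

definition avg_degree :: "nat \<Rightarrow> nat set set \<Rightarrow> real" where
  "avg_degree n E = (\<Sum>v\<in>{1..n}. real (degree E v)) / real n"

definition max_degree :: "nat \<Rightarrow> nat set set \<Rightarrow> nat" where
  "max_degree n E = Max (degree E ` {1..n})"

definition caro_wei :: "nat \<Rightarrow> nat set set \<Rightarrow> real" where
  "caro_wei n E = (\<Sum>v\<in>{1..n}. 1 / (real (degree E v) + 1))"

section \<open>Edge-arrival streaming algorithms\<close>

text \<open>A streamed edge is an ordered pair; either orientation of an edge may be presented.\<close>

definition edge_stream_of :: "(nat \<times> nat) list \<Rightarrow> nat set set \<Rightarrow> bool" where
  "edge_stream_of es E \<longleftrightarrow>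
     distinct (map (\<lambda>(u, v). {u, v}) es) \<and> set (map (\<lambda>(u, v). {u, v}) es) = E"

record ('s, 'e, 'o) stream_alg =
  start :: "'s pmf"
  update :: "'e \<Rightarrow> 's \<Rightarrow> 's"
  result :: "'s \<Rightarrow> 'o"

definition output_dist :: "('s, 'e, 'o) stream_alg \<Rightarrow> 'e list \<Rightarrow> 'o pmf" where
  "output_dist A es = map_pmf (\<lambda>s. result A (fold (update A) es s)) (start A)"

definition reachable_states :: "('s, 'e, 'o) stream_alg \<Rightarrow> 'e set \<Rightarrow> 's set" where
  "reachable_states A X = {fold (update A) es s | es s. set es \<subseteq> X \<and> s \<in> set_pmf (start A)}"

text \<open>Working space at most \<open>b\<close> bits: the memory contents that can occur, over all coin tosses
  and all streams of items from \<open>X\<close>, are held as pairwise distinct bit strings of length at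
  most \<open>b\<close>. The encoding depends neither on the stream nor on the coin tosses.\<close>

definition uses_bits :: "('s, 'e, 'o) stream_alg \<Rightarrow> 'e set \<Rightarrow> real \<Rightarrow> bool" where
  "uses_bits A X b \<longleftrightarrow>
     (\<exists>enc :: 's \<Rightarrow> bool list. inj_on enc (reachable_states A X) \<and>
        (\<forall>s\<in>reachable_states A X. real (length (enc s)) \<le> b))"

definition all_edges :: "nat \<Rightarrow> (nat \<times> nat) set" where
  "all_edges n = {(u, v). u \<in> {1..n} \<and> v \<in> {1..n} \<and> u \<noteq> v}"

section \<open>Hash families from [n] to [n^3]\<close>

definition hash_family :: "nat \<Rightarrow> (nat \<Rightarrow> nat) set \<Rightarrow> bool" where
  "hash_family n H \<longleftrightarrow> H \<noteq> {} \<and> H \<subseteq> {1..n} \<rightarrow>\<^sub>E {1..n^3}"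

definition min_wise :: "real \<Rightarrow> nat \<Rightarrow> (nat \<Rightarrow> nat) set \<Rightarrow> bool" where
  "min_wise \<epsilon> n H \<longleftrightarrow>
     (\<forall>A x. A \<subseteq> {1..n} \<and> x \<in> {1..n} - A \<longrightarrow>
        measure_pmf.prob (pmf_of_set H) {h. \<forall>a\<in>A. h x < h a}
          \<in> {(1 - \<epsilon>) / (real (card A) + 1) .. (1 + \<epsilon>) / (real (card A) + 1)})"

definition k_wise_independent :: "nat \<Rightarrow> nat \<Rightarrow> (nat \<Rightarrow> nat) set \<Rightarrow> bool" where
  "k_wise_independent k n H \<longleftrightarrow>
     (\<forall>i\<in>{1..n}. map_pmf (\<lambda>h. h i) (pmf_of_set H) = pmf_of_set {1..n^3}) \<and>
     (\<forall>J. J \<subseteq> {1..n} \<and> card J \<le> k \<longrightarrow>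
        prob_space.indep_vars (measure_pmf (pmf_of_set H))
          (\<lambda>_. count_space UNIV) (\<lambda>i h. h i) J)"

section \<open>The algorithm CWEI\<close>

text \<open>The sampling rate is capped at 1, where all of [n] is sampled: a set of more than n vertices
  cannot be drawn from [n].\<close>

definition cwei_rate :: "nat \<Rightarrow> real \<Rightarrow> real \<Rightarrow> real" where
  "cwei_rate n dbar \<epsilon> = min 1 (4 * (dbar + 1) / (\<epsilon>\<^sup>2 * real n))"

definition cwei_sample_size :: "nat \<Rightarrow> real \<Rightarrow> real \<Rightarrow> nat" where
  "cwei_sample_size n dbar \<epsilon> = nat \<lceil>cwei_rate n dbar \<epsilon> * real n\<rceil>"

definition cwei_step ::
    "nat \<times> nat \<Rightarrow> nat set \<times> (nat \<Rightarrow> nat) \<Rightarrow> nat set \<times> (nat \<Rightarrow> nat)" where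
  "cwei_step = (\<lambda>(u, v) (S, h).
     let S1 = (if u \<in> S \<and> h u \<ge> h v then S - {u} else S);
         S2 = (if v \<in> S1 \<and> h v \<ge> h u then S1 - {v} else S1)
     in (S2, h))"

definition cwei :: "nat \<Rightarrow> real \<Rightarrow> real \<Rightarrow> (nat \<Rightarrow> nat) set \<Rightarrow>
    (nat set \<times> (nat \<Rightarrow> nat), nat \<times> nat, real) stream_alg" where
  "cwei n dbar \<epsilon> H =
    \<lparr> start = pair_pmf (pmf_of_set {S. S \<subseteq> {1..n} \<and> card S = cwei_sample_size n dbar \<epsilon>})
                       (pmf_of_set H),
      update = cwei_step,
      result = (\<lambda>(S, h). real (card S) / cwei_rate n dbar \<epsilon>) \<rparr>"

end

theory Submission
  imports Defs
begin

text \<open>Write \<open>d\<close> for the average degree, \<open>p\<close> for the sampling rate and \<open>X\<^sub>v\<close> for the event that \<open>v\<close>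
  has a smaller hash value than all its neighbours. The output is the number of sampled \<open>v\<close> with
  \<open>X\<^sub>v\<close>, divided by \<open>p\<close>, so by Markov's inequality it suffices to bound its mean square error by
  \<open>(\<epsilon> \<lambda>)\<^sup>2 / 3\<close>.

  The \<open>\<epsilon>\<close>-min-wise property alone is too weak: it allows a bias of \<open>\<epsilon> \<lambda>\<close> and says nothing about
  pairs. Independence of order \<open>K (1 + ln (1/\<epsilon>))\<close> instead gives both \<open>P(X\<^sub>v)\<close> and an upper bound on
  \<open>P(X\<^sub>u \<inter> X\<^sub>v)\<close> up to a relative error far below \<open>\<epsilon>\<^sup>2\<close>. Fix the hash values of \<open>u\<close> and \<open>v\<close> and let \<open>\<mu>\<close> be
  the expected number of neighbours falling below them. If \<open>\<mu>\<close> is small, inclusion-exclusion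
  truncated at depth \<open>r\<close> errs by at most \<open>\<mu>\<^sup>r\<^sup>+\<^sup>1/(r+1)!\<close>. If \<open>\<mu>\<close> is large, split the neighbours into
  \<open>l\<close> groups of equal size and apply Chebyshev to each: the product of the \<open>l\<close> normalised squared
  deviations is a polynomial of degree \<open>2 l\<close> with expectation about \<open>(l/\<mu>)\<^sup>l\<close>, which is both
  tiny and summable over the hash values.

  For fully random hashing the covariance of \<open>X\<^sub>u\<close> and \<open>X\<^sub>v\<close> is positive only if \<open>u\<close> and \<open>v\<close> have
  common neighbours, and the number of triples \<open>(u, w, v)\<close> with \<open>w\<close> adjacent to both is at most
  \<open>\<Delta> n d\<close>. The hypothesis on \<open>\<Delta>\<close> and \<open>\<lambda> \<ge> n / (d + 1)\<close> turn this into \<open>O((\<epsilon> \<lambda>)\<^sup>2)\<close>. Sampling without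
  replacement contributes at most \<open>(\<epsilon> \<lambda>)\<^sup>2 / 4\<close>.\<close>

section \<open>Averages over finite sets\<close>

text \<open>Uniform expectation as a finite sum, so that linearity comes without integrability
  conditions; \<open>expectation_pmf_of_set\<close> later ties it to \<open>pmf_of_set\<close>. On
  an empty set, division by zero makes it 0.\<close>

definition avg :: "'a set \<Rightarrow> ('a \<Rightarrow> real) \<Rightarrow> real" where
  "avg A f = (\<Sum>x\<in>A. f x) / real (card A)"

lemma avg_sum: "avg A (\<lambda>x. \<Sum>i\<in>I. f i x) = (\<Sum>i\<in>I. avg A (f i))"
  unfolding avg_def by (subst sum.swap) (simp add: sum_divide_distrib)

lemma avg_cmult: "avg A (\<lambda>x. c * f x) = c * avg A f"
  unfolding avg_def by (simp add: sum_distrib_left)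

lemma avg_add: "avg A (\<lambda>x. f x + g x) = avg A f + avg A g"
  unfolding avg_def by (simp add: sum.distrib add_divide_distrib)

lemma avg_const: "finite A \<Longrightarrow> A \<noteq> {} \<Longrightarrow> avg A (\<lambda>x. c) = c"
  unfolding avg_def by simp

lemma avg_mono: "(\<And>x. x \<in> A \<Longrightarrow> f x \<le> g x) \<Longrightarrow> avg A f \<le> avg A g"
  unfolding avg_def by (intro divide_right_mono sum_mono) auto

lemma avg_cong: "(\<And>x. x \<in> A \<Longrightarrow> f x = g x) \<Longrightarrow> avg A f = avg A g"
  unfolding avg_def by (auto intro: sum.cong)

lemma avg_nonneg: "(\<And>x. x \<in> A \<Longrightarrow> 0 \<le> f x) \<Longrightarrow> 0 \<le> avg A f"
  unfolding avg_def by (simp add: sum_nonneg)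

section \<open>Truncated inclusion-exclusion\<close>

text \<open>The inclusion-exclusion expansion of \<open>\<Prod>i\<in>U. 1 - p i\<close>, cut off at
  subsets of size \<open>r\<close>. For indicators \<open>p\<close> it is a Bonferroni sum, for
  probabilities the expectation of such a sum under independence.\<close>

definition trunc :: "nat \<Rightarrow> 'a set \<Rightarrow> ('a \<Rightarrow> real) \<Rightarrow> real" where
  "trunc r U p = (\<Sum>T\<in>{T. T \<subseteq> U \<and> card T \<le> r}. \<Prod>i\<in>T. - p i)"

lemma trunc_0:
  assumes "finite U"
  shows "trunc 0 U p = 1"
proof -
  have "{T. T \<subseteq> U \<and> card T \<le> 0} = {{}}"
    using assms by (auto dest: finite_subset)
  then show ?thesis by (simp add: trunc_def)
qed

lemma trunc_empty: "trunc r {} p = 1"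
proof -
  have "{T. T \<subseteq> {} \<and> card T \<le> r} = {{} :: 'a set}" by auto
  then show ?thesis unfolding trunc_def by (simp only:) simp
qed

lemma trunc_insert:
  assumes "finite U" "x \<notin> U"
  shows "trunc (Suc r) (insert x U) p = trunc (Suc r) U p - p x * trunc r U p"
proof -
  let ?A = "{T. T \<subseteq> U \<and> card T \<le> Suc r}" and ?B = "{T. T \<subseteq> U \<and> card T \<le> r}"
  have fin: "finite ?A" "finite ?B" using assms by auto
  have eq: "{T. T \<subseteq> insert x U \<and> card T \<le> Suc r} = ?A \<union> insert x ` ?B" (is "?L = ?R")
  proof (intro set_eqI iffI)
    fix T assume T: "T \<in> ?L"
    show "T \<in> ?R"
    proof (cases "x \<in> T")
      case True
      have "finite T" using T assms finite_subset[of T "insert x U"] by auto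
      then have "T - {x} \<in> ?B" using T True by (auto simp: card_Diff_singleton)
      moreover have "T = insert x (T - {x})" using True by auto
      ultimately show ?thesis by blast
    next
      case False
      then show ?thesis using T by auto
    qed
  next
    fix T assume "T \<in> ?R"
    then show "T \<in> ?L"
      by (auto simp: card_insert_if dest: finite_subset[OF _ assms(1)])
  qed
  have disj: "?A \<inter> insert x ` ?B = {}" using assms by auto
  have inj: "inj_on (insert x) ?B"
    using assms(2) by (auto simp: inj_on_def)
  have "(\<Sum>T\<in>insert x ` ?B. \<Prod>i\<in>T. - p i) = (\<Sum>T\<in>?B. \<Prod>i\<in>insert x T. - p i)"
    by (subst sum.reindex[OF inj]) simp
  also have "\<dots> = (\<Sum>T\<in>?B. - p x * (\<Prod>i\<in>T. - p i))"
  proof (rule sum.cong)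
    fix T assume "T \<in> ?B"
    then have "finite T" "x \<notin> T" using assms finite_subset by auto
    then show "(\<Prod>i\<in>insert x T. - p i) = - p x * (\<Prod>i\<in>T. - p i)" by simp
  qed simp
  also have "\<dots> = - p x * trunc r U p" by (simp add: trunc_def sum_distrib_left)
  finally have img: "(\<Sum>T\<in>insert x ` ?B. \<Prod>i\<in>T. - p i) = - p x * trunc r U p" .
  have "trunc (Suc r) (insert x U) p
      = (\<Sum>T\<in>?A. \<Prod>i\<in>T. - p i) + (\<Sum>T\<in>insert x ` ?B. \<Prod>i\<in>T. - p i)"
    unfolding trunc_def eq by (rule sum.union_disjoint) (use fin disj in auto)
  then show ?thesis unfolding img by (simp add: trunc_def)
qed

text \<open>First two terms of the binomial expansion. This closes the induction in
  \<open>Bonferroni\<close> and makes \<open>sum_powers_le\<close> telescope.\<close>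

lemma power_Suc_add_le:
  fixes x y :: real
  assumes "0 \<le> x" "0 \<le> y"
  shows "x ^ Suc m + real (Suc m) * y * x ^ m \<le> (x + y) ^ Suc m"
proof (induction m)
  case (Suc m)
  have "x ^ Suc (Suc m) + real (Suc (Suc m)) * y * x ^ Suc m
      \<le> (x + y) * (x ^ Suc m + real (Suc m) * y * x ^ m)"
    using assms by (simp add: algebra_simps)
  also have "\<dots> \<le> (x + y) * (x + y) ^ Suc m"
    using assms Suc by (intro mult_left_mono) auto
  finally show ?case by simp
qed simp

text \<open>With \<open>D r U\<close> the signed error, \<open>trunc_insert\<close> gives
  \<open>D (Suc r) (insert x U) = D (Suc r) U + p x * D r U\<close>. Both summands are nonnegative,
  and their upper bounds add up to two binomial terms. Real values of \<open>p\<close> are allowed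
  because indicators and probabilities both occur later.\<close>

lemma Bonferroni:
  fixes p :: "'a \<Rightarrow> real"
  assumes "finite U" "\<And>i. i \<in> U \<Longrightarrow> 0 \<le> p i \<and> p i \<le> 1"
  shows "0 \<le> (-1) ^ r * (trunc r U p - (\<Prod>i\<in>U. 1 - p i)) \<and>
    (-1) ^ r * (trunc r U p - (\<Prod>i\<in>U. 1 - p i)) \<le> (\<Sum>i\<in>U. p i) ^ Suc r / fact (Suc r)"
  using assms
proof (induction U arbitrary: r rule: finite_induct)
  case empty
  then show ?case by (simp add: trunc_empty)
next
  case (insert x U)
  define D where "D = (\<lambda>r V. (-1) ^ r * (trunc r V p - (\<Prod>i\<in>V. 1 - p i)))"
  have IH: "0 \<le> D r U" "D r U \<le> (\<Sum>i\<in>U. p i) ^ Suc r / fact (Suc r)" for r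
    using insert.IH[of r] insert.prems unfolding D_def by auto
  have px: "0 \<le> p x" "p x \<le> 1" using insert.prems by auto
  have mu: "0 \<le> (\<Sum>i\<in>U. p i)" using insert.prems by (intro sum_nonneg) auto
  have "0 \<le> D r (insert x U) \<and> D r (insert x U) \<le> (\<Sum>i\<in>insert x U. p i) ^ Suc r / fact (Suc r)"
  proof (cases r)
    case 0
    have pr: "0 \<le> (\<Prod>i\<in>U. 1 - p i)" "(\<Prod>i\<in>U. 1 - p i) \<le> 1"
      using insert.prems by (auto intro!: prod_nonneg prod_le_1)
    have D0: "D 0 U = 1 - (\<Prod>i\<in>U. 1 - p i)" using insert by (simp add: D_def trunc_0)
    have "D 0 (insert x U) = D 0 U + p x * (\<Prod>i\<in>U. 1 - p i)"
      using insert by (simp add: D_def trunc_0 algebra_simps)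
    moreover have "p x * (\<Prod>i\<in>U. 1 - p i) \<le> p x" "0 \<le> p x * (\<Prod>i\<in>U. 1 - p i)"
      using px pr by (auto simp: mult_left_le)
    ultimately show ?thesis using IH[of 0] insert.hyps 0 by simp
  next
    case (Suc m)
    have rec: "D (Suc m) (insert x U) = D (Suc m) U + p x * D m U"
      using insert.hyps by (simp add: D_def trunc_insert algebra_simps)
    let ?\<mu> = "\<Sum>i\<in>U. p i"
    have "D (Suc m) (insert x U) \<le> ?\<mu> ^ Suc (Suc m) / fact (Suc (Suc m)) + p x * (?\<mu> ^ Suc m / fact (Suc m))"
      unfolding rec by (intro add_mono mult_left_mono IH px)
    also have "\<dots> = (?\<mu> ^ Suc (Suc m) + real (Suc (Suc m)) * p x * ?\<mu> ^ Suc m) / fact (Suc (Suc m))"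
    proof -
      have *: "a + q * (b / F) = (N * F * a + N * q * b) / (N * F)" if "N > 0" "F > 0" for a b q F N :: real
        using that by (simp add: field_simps)
      show ?thesis
        using *[of "real (Suc (Suc m))" "fact (Suc m)" "?\<mu> ^ Suc (Suc m) / fact (Suc (Suc m))" "p x" "?\<mu> ^ Suc m"]
        by (simp only: fact_Suc[of "Suc m", where 'a = real]) simp
    qed
    also have "\<dots> \<le> (?\<mu> + p x) ^ Suc (Suc m) / fact (Suc (Suc m))"
      using mu px by (intro divide_right_mono power_Suc_add_le) auto
    finally show ?thesis using IH px insert.hyps rec Suc
      by (simp add: add.commute)
  qed
  then show ?case by (simp add: D_def)
qed

section \<open>Families of hash functions with limited independence\<close>

lemma avg_le_threshold:
  assumes "s \<le> N"
  shows "avg {1..N} (\<lambda>y. of_bool (y \<le> s)) = real s / real N"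
proof -
  have "{1..N} \<inter> {y. y \<le> s} = {1..s}" using assms by auto
  then show ?thesis by (simp add: avg_def flip: of_nat_sum)
qed

lemma avg_eq_point:
  assumes "s \<in> {1..N}"
  shows "avg {1..N} (\<lambda>y. of_bool (y = s)) = 1 / real N"
proof -
  have "{1..N} \<inter> {y. y = s} = {s}" using assms by auto
  then show ?thesis by (simp add: avg_def)
qed

text \<open>The condition \<open>avg_prod\<close> is k-wise independence of uniform values in the
  form used below: averages of products of at most \<open>k\<close> factors. For empty
  \<open>J\<close> it forces \<open>H\<close> to be finite and nonempty.\<close>

locale kwise_family =
  fixes V :: "'v set" and N k :: nat and H :: "('v \<Rightarrow> nat) set"
  assumes finite_V: "finite V" and N_pos: "0 < N"
    and H_range: "\<And>h i. h \<in> H \<Longrightarrow> i \<in> V \<Longrightarrow> h i \<in> {1..N}"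
    and avg_prod: "\<And>J g. J \<subseteq> V \<Longrightarrow> card J \<le> k \<Longrightarrow>
      avg H (\<lambda>h. \<Prod>i\<in>J. g i (h i)) = (\<Prod>i\<in>J. avg {1..N} (g i))"
begin

lemma finite_sub: "A \<subseteq> V \<Longrightarrow> finite A"
  using finite_V finite_subset by blast

text \<open>Fixing the hash values on \<open>J\<close> stands in for conditioning on them.\<close>

definition point :: "'v set \<Rightarrow> ('v \<Rightarrow> nat) \<Rightarrow> 'v set \<Rightarrow> ('v \<Rightarrow> nat) \<Rightarrow> real" where
  "point J \<sigma> U \<theta> = avg H (\<lambda>h. of_bool ((\<forall>i\<in>J. h i = \<sigma> i) \<and> (\<forall>i\<in>U. \<theta> i < h i)))"

lemma of_bool_ball: "finite J \<Longrightarrow> of_bool (\<forall>i\<in>J. P i) = (\<Prod>i\<in>J. of_bool (P i) :: real)"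
  by (induction J rule: finite_induct) auto

text \<open>Each term of the truncated expansion involves at most \<open>card J + r\<close> hash
  values, so its average is the same as for fully random values.\<close>

lemma avg_trunc:
  assumes "J \<subseteq> V" "U \<subseteq> V" "J \<inter> U = {}" "card J + r \<le> k"
    and "\<And>i. i \<in> J \<Longrightarrow> \<sigma> i \<in> {1..N}" and "\<And>i. i \<in> U \<Longrightarrow> \<theta> i \<le> N"
  shows "avg H (\<lambda>h. (\<Prod>i\<in>J. of_bool (h i = \<sigma> i)) * trunc r U (\<lambda>i. of_bool (h i \<le> \<theta> i)))
    = (1 / real N) ^ card J * trunc r U (\<lambda>i. real (\<theta> i) / real N)"
proof -
  let ?T = "{T. T \<subseteq> U \<and> card T \<le> r}"
  have "avg H (\<lambda>h. (\<Prod>i\<in>J. of_bool (h i = \<sigma> i)) * trunc r U (\<lambda>i. of_bool (h i \<le> \<theta> i)))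
      = (\<Sum>T\<in>?T. avg H (\<lambda>h. (\<Prod>i\<in>J. of_bool (h i = \<sigma> i)) * (\<Prod>i\<in>T. - of_bool (h i \<le> \<theta> i))))"
    unfolding trunc_def sum_distrib_left by (rule avg_sum)
  also have "\<dots> = (\<Sum>T\<in>?T. (1 / real N) ^ card J * (\<Prod>i\<in>T. - (real (\<theta> i) / real N)))"
  proof (rule sum.cong)
    fix T assume T: "T \<in> ?T"
    have fin: "finite J" "finite T" using T assms finite_sub by auto
    have disj: "J \<inter> T = {}" using T assms by auto
    \<comment> \<open>Merges the two products into one over \<open>J \<union> T\<close>, the shape
      required by \<open>avg_prod\<close>.\<close>
    define g :: "'v \<Rightarrow> nat \<Rightarrow> real"
      where "g = (\<lambda>i y. if i \<in> J then of_bool (y = \<sigma> i) else - of_bool (y \<le> \<theta> i))"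
    have gJ: "g i = (\<lambda>y. of_bool (y = \<sigma> i))" if "i \<in> J" for i using that by (auto simp: g_def)
    have gT: "g i = (\<lambda>y. (-1) * of_bool (y \<le> \<theta> i))" if "i \<in> T" for i
    proof -
      have "i \<notin> J" using that disj by auto
      then show ?thesis by (simp add: g_def)
    qed
    have "avg H (\<lambda>h. (\<Prod>i\<in>J. of_bool (h i = \<sigma> i)) * (\<Prod>i\<in>T. - of_bool (h i \<le> \<theta> i)))
        = avg H (\<lambda>h. \<Prod>i\<in>J \<union> T. g i (h i))"
      using fin disj by (simp add: prod.union_disjoint gJ gT)
    also have "\<dots> = (\<Prod>i\<in>J \<union> T. avg {1..N} (g i))"
      by (rule avg_prod) (use T assms in \<open>auto intro: le_trans[OF card_Un_le]\<close>)
    also have "\<dots> = (\<Prod>i\<in>J. avg {1..N} (g i)) * (\<Prod>i\<in>T. avg {1..N} (g i))"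
      using fin disj by (simp add: prod.union_disjoint)
    also have "(\<Prod>i\<in>J. avg {1..N} (g i)) = (\<Prod>i\<in>J. 1 / real N)"
      by (rule prod.cong) (use assms(5) avg_eq_point gJ in auto)
    also have "(\<Prod>i\<in>T. avg {1..N} (g i)) = (\<Prod>i\<in>T. - (real (\<theta> i) / real N))"
    proof (rule prod.cong)
      fix i assume "i \<in> T"
      then have "\<theta> i \<le> N" using T assms by auto
      then show "avg {1..N} (g i) = - (real (\<theta> i) / real N)"
        unfolding gT[OF \<open>i \<in> T\<close>] avg_cmult avg_le_threshold[OF \<open>\<theta> i \<le> N\<close>] by simp
    qed simp
    finally show "avg H (\<lambda>h. (\<Prod>i\<in>J. of_bool (h i = \<sigma> i)) * (\<Prod>i\<in>T. - of_bool (h i \<le> \<theta> i)))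
        = (1 / real N) ^ card J * (\<Prod>i\<in>T. - (real (\<theta> i) / real N))" by simp
  qed simp
  also have "\<dots> = (1 / real N) ^ card J * trunc r U (\<lambda>i. real (\<theta> i) / real N)"
    by (simp add: trunc_def sum_distrib_left)
  finally show ?thesis .
qed

lemma of_bool_avoid:
  fixes \<theta> h :: "'v \<Rightarrow> nat"
  assumes "finite U"
  shows "of_bool (\<forall>i\<in>U. \<theta> i < h i) = (\<Prod>i\<in>U. 1 - of_bool (h i \<le> \<theta> i) :: real)"
  unfolding of_bool_ball[OF assms] by (rule prod.cong) auto

text \<open>Two uses of \<open>Bonferroni\<close>. For indicators, the parity of \<open>r\<close>
  fixes the side on which the truncated sum lies, at no cost; its average is known from
  \<open>avg_trunc\<close>. For probabilities, it bounds the distance of that average from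
  \<open>P\<close>.\<close>

lemma
  assumes "J \<subseteq> V" "U \<subseteq> V" "J \<inter> U = {}" "card J + r \<le> k"
    and "\<And>i. i \<in> J \<Longrightarrow> \<sigma> i \<in> {1..N}" and "\<And>i. i \<in> U \<Longrightarrow> \<theta> i \<le> N"
  defines "\<mu> \<equiv> \<Sum>i\<in>U. real (\<theta> i) / real N" and "P \<equiv> \<Prod>i\<in>U. 1 - real (\<theta> i) / real N"
  shows point_le: "even r \<Longrightarrow> point J \<sigma> U \<theta> \<le> (1 / real N) ^ card J * (P + \<mu> ^ Suc r / fact (Suc r))"
    and point_ge: "odd r \<Longrightarrow> (1 / real N) ^ card J * (P - \<mu> ^ Suc r / fact (Suc r)) \<le> point J \<sigma> U \<theta>"
proof -
  have fin: "finite J" "finite U" using assms finite_sub by auto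
  let ?q = "\<lambda>h. (\<Prod>i\<in>J. of_bool (h i = \<sigma> i)) :: real"
  let ?t = "\<lambda>h. trunc r U (\<lambda>i. of_bool (h i \<le> \<theta> i))"
  have pt: "point J \<sigma> U \<theta> = avg H (\<lambda>h. ?q h * (\<Prod>i\<in>U. 1 - of_bool (h i \<le> \<theta> i)))"
    unfolding point_def of_bool_conj of_bool_avoid[OF fin(2)] of_bool_ball[OF fin(1)] ..
  have bon: "0 \<le> (-1) ^ r * (?t h - (\<Prod>i\<in>U. 1 - of_bool (h i \<le> \<theta> i)))" for h
    using Bonferroni[OF fin(2), of "\<lambda>i. of_bool (h i \<le> \<theta> i)" r] by auto
  have bon2: "(-1) ^ r * (trunc r U (\<lambda>i. real (\<theta> i) / real N) - P) \<le> \<mu> ^ Suc r / fact (Suc r)"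
    using Bonferroni[OF fin(2), of "\<lambda>i. real (\<theta> i) / real N" r] assms(6) N_pos
    unfolding \<mu>_def P_def by (auto simp: divide_le_eq)
  have tr: "avg H (\<lambda>h. ?q h * ?t h) = (1 / real N) ^ card J * trunc r U (\<lambda>i. real (\<theta> i) / real N)"
    by (rule avg_trunc) (use assms in auto)
  have q: "0 \<le> ?q h" for h by (intro prod_nonneg) auto
  {
    assume "even r"
    then have "point J \<sigma> U \<theta> \<le> avg H (\<lambda>h. ?q h * ?t h)"
      unfolding pt using bon by (intro avg_mono mult_left_mono q) simp
    also have "\<dots> \<le> (1 / real N) ^ card J * (P + \<mu> ^ Suc r / fact (Suc r))"
      unfolding tr using bon2 \<open>even r\<close> by (intro mult_left_mono) auto
    finally show "point J \<sigma> U \<theta> \<le> (1 / real N) ^ card J * (P + \<mu> ^ Suc r / fact (Suc r))" .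
  }
  {
    assume "odd r"
    have "(1 / real N) ^ card J * (P - \<mu> ^ Suc r / fact (Suc r)) \<le> avg H (\<lambda>h. ?q h * ?t h)"
      unfolding tr using bon2 \<open>odd r\<close> by (intro mult_left_mono) auto
    also have "\<dots> \<le> point J \<sigma> U \<theta>"
      unfolding pt using bon \<open>odd r\<close> by (intro avg_mono mult_left_mono q) simp
    finally show "(1 / real N) ^ card J * (P - \<mu> ^ Suc r / fact (Suc r)) \<le> point J \<sigma> U \<theta>" .
  }
qed

lemma avg_centered:
  assumes "s \<in> {1..N}"
  defines "x \<equiv> real s / real N"
  shows "avg {1..N} (\<lambda>y. of_bool (y \<le> s) - x) = 0"
    and "avg {1..N} (\<lambda>y. (of_bool (y \<le> s) - x)\<^sup>2) = x * (1 - x)"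
proof -
  have a: "avg {1..N} (\<lambda>y. of_bool (y \<le> s)) = x"
    unfolding x_def by (rule avg_le_threshold) (use assms in auto)
  have c: "avg {1..N} (\<lambda>y. z) = z" for z using N_pos by (intro avg_const) auto
  have "avg {1..N} (\<lambda>y. of_bool (y \<le> s) - x) = avg {1..N} (\<lambda>y. of_bool (y \<le> s)) + avg {1..N} (\<lambda>y. - x)"
    by (subst avg_add[symmetric]) simp
  then show "avg {1..N} (\<lambda>y. of_bool (y \<le> s) - x) = 0" unfolding a c by simp
  have "avg {1..N} (\<lambda>y. (of_bool (y \<le> s) - x)\<^sup>2)
      = avg {1..N} (\<lambda>y. (1 - 2 * x) * of_bool (y \<le> s) + x\<^sup>2)"
    by (rule avg_cong) (auto simp: power2_eq_square algebra_simps)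
  also have "\<dots> = (1 - 2 * x) * x + x\<^sup>2" by (simp only: avg_add avg_cmult a c)
  finally show "avg {1..N} (\<lambda>y. (of_bool (y \<le> s) - x)\<^sup>2) = x * (1 - x)"
    by (simp add: power2_eq_square algebra_simps)
qed

text \<open>The factors at \<open>i\<close> and \<open>j\<close> are absorbed into a larger product
  of the same shape, so that the step can be iterated. Distinct \<open>i\<close> and
  \<open>j\<close> give independent factors of mean 0; equal ones give a variance.\<close>

lemma avg_centered_pair:
  fixes f :: "'v \<Rightarrow> nat \<Rightarrow> real"
  assumes "J \<subseteq> V" "i \<in> V - J" "j \<in> V - J" "card J + 2 \<le> k" "s \<in> {1..N}"
  defines "x \<equiv> real s / real N"
  defines "c \<equiv> \<lambda>y. of_bool (y \<le> s) - x"
  obtains J' f' where "J' = insert i (insert j J)" "card J' \<le> card J + 2"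
    "\<And>h. (\<Prod>a\<in>J'. f' a (h a)) = (\<Prod>a\<in>J. f a (h a)) * (c (h i) * c (h j))"
    "avg H (\<lambda>h. \<Prod>a\<in>J'. f' a (h a)) = avg H (\<lambda>h. \<Prod>a\<in>J. f a (h a)) * (if i = j then x * (1 - x) else 0)"
proof -
  define J' where "J' = insert i (insert j J)"
  define f' where "f' = (\<lambda>a y. if a \<in> J then f a y else if i = j then (c y)\<^sup>2 else c y)"
  have fin: "finite J" using assms finite_sub by auto
  have card: "card J' \<le> card J + 2"
    unfolding J'_def by (simp add: card_insert_if fin)
  have f'J: "f' a = f a" if "a \<in> J" for a using that by (auto simp: f'_def)
  have f'i: "f' i = (if i = j then (\<lambda>y. (c y)\<^sup>2) else c)" and f'j: "f' j = (if i = j then (\<lambda>y. (c y)\<^sup>2) else c)"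
    using assms by (auto simp: f'_def)
  \<comment> \<open>\<open>F\<close> is kept general: it serves once for averages and once for
    evaluation at \<open>h\<close>.\<close>
  have prod: "(\<Prod>a\<in>J'. F a (f' a)) = (\<Prod>a\<in>J. F a (f a)) *
      (if i = j then F i (\<lambda>y. (c y)\<^sup>2) else F i c * F j c)" for F :: "'v \<Rightarrow> (nat \<Rightarrow> real) \<Rightarrow> real"
    using assms(2,3) fin unfolding J'_def by (cases "i = j") (simp_all add: f'i f'j f'J)
  have "avg H (\<lambda>h. \<Prod>a\<in>J'. f' a (h a)) = (\<Prod>a\<in>J'. avg {1..N} (f' a))"
    using assms card by (intro avg_prod) (auto simp: J'_def)
  also have "\<dots> = (\<Prod>a\<in>J. avg {1..N} (f a)) * (if i = j then x * (1 - x) else 0)"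
    using avg_centered[OF assms(5)] unfolding prod[of "\<lambda>a. avg {1..N}"] c_def x_def by simp
  also have "(\<Prod>a\<in>J. avg {1..N} (f a)) = avg H (\<lambda>h. \<Prod>a\<in>J. f a (h a))"
    using assms by (intro avg_prod[symmetric]) auto
  finally have avg: "avg H (\<lambda>h. \<Prod>a\<in>J'. f' a (h a))
    = avg H (\<lambda>h. \<Prod>a\<in>J. f a (h a)) * (if i = j then x * (1 - x) else 0)" .
  have pr: "(\<Prod>a\<in>J'. f' a (h a)) = (\<Prod>a\<in>J. f a (h a)) * (c (h i) * c (h j))" for h
    using prod[of "\<lambda>a g. g (h a)"] by (simp add: power2_eq_square)
  show thesis by (rule that[OF J'_def card pr avg])
qed

text \<open>The majorant \<open>F\<close> is the product, over \<open>l\<close> disjoint subsets of \<open>A\<close> of size \<open>g\<close>, of the squared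
  deviations of the number of hash values at most \<open>s\<close>, normalised to be 1 when there are none. Since
  \<open>F\<close> has degree \<open>2 l\<close>, its expectation factorises as under full independence.\<close>

lemma tail_majorant:
  assumes "A \<subseteq> V" "l * g \<le> card A" "1 \<le> g" "s \<in> {1..N}"
  defines "x \<equiv> real s / real N"
  shows "\<exists>F. (\<forall>h. 0 \<le> F h) \<and> (\<forall>h. (\<forall>a\<in>A. s < h a) \<longrightarrow> 1 \<le> F h) \<and>
    (\<forall>J f. J \<subseteq> V \<and> J \<inter> A = {} \<and> card J + 2 * l \<le> k \<longrightarrow>
      avg H (\<lambda>h. (\<Prod>i\<in>J. f i (h i)) * F h) = avg H (\<lambda>h. \<Prod>i\<in>J. f i (h i)) * ((1 - x) / (real g * x)) ^ l)"
  using assms(1,2)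
proof (induction l arbitrary: A)
  case 0
  show ?case by (rule exI[of _ "\<lambda>_. 1"]) simp
next
  case (Suc l)
  have "g \<le> card A" using Suc.prems by simp
  then obtain G where G: "G \<subseteq> A" "card G = g" by (meson obtain_subset_with_card_n)
  have finG: "finite G" using G Suc.prems finite_sub by blast
  have "l * g \<le> card (A - G)" using Suc.prems G finG by (simp add: card_Diff_subset)
  moreover have "A - G \<subseteq> V" using Suc.prems by auto
  ultimately obtain F where F: "\<forall>h. 0 \<le> F h"
    "\<forall>h. (\<forall>a\<in>A - G. s < h a) \<longrightarrow> 1 \<le> F h"
    "\<forall>J f. J \<subseteq> V \<and> J \<inter> (A - G) = {} \<and> card J + 2 * l \<le> k \<longrightarrow>
      avg H (\<lambda>h. (\<Prod>i\<in>J. f i (h i)) * F h) = avg H (\<lambda>h. \<Prod>i\<in>J. f i (h i)) * ((1 - x) / (real g * x)) ^ l"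
    using Suc.IH[of "A - G"] by blast
  have x: "0 < x" using assms by (simp add: x_def)
  define c where "c = (\<lambda>y. of_bool (y \<le> s) - x)"
  define Y where "Y = (\<lambda>h. ((\<Sum>i\<in>G. c (h i)) / (real g * x))\<^sup>2)"
  show ?case
  proof (intro exI[of _ "\<lambda>h. F h * Y h"] conjI allI impI)
    fix h show "0 \<le> F h * Y h" using F by (simp add: Y_def)
  next
    fix h :: "'v \<Rightarrow> nat" assume h: "\<forall>a\<in>A. s < h a"
    have "(\<Sum>i\<in>G. c (h i)) = (\<Sum>i\<in>G. - x)"
    proof (rule sum.cong)
      fix i assume "i \<in> G"
      then have "s < h i" using h G by blast
      then show "c (h i) = - x" by (simp add: c_def)
    qed simp
    then have "Y h = 1" using G x assms(3) by (simp add: Y_def)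
    then show "1 \<le> F h * Y h" using F(2) h by simp
  next
    fix J :: "'v set" and f :: "'v \<Rightarrow> nat \<Rightarrow> real"
    assume J: "J \<subseteq> V \<and> J \<inter> A = {} \<and> card J + 2 * Suc l \<le> k"
    let ?q = "\<lambda>h. \<Prod>i\<in>J. f i (h i)" and ?C = "((1 - x) / (real g * x)) ^ l"
    have pair: "avg H (\<lambda>h. ?q h * (c (h i) * c (h j)) * F h)
        = avg H ?q * (if i = j then x * (1 - x) else 0) * ?C" if "i \<in> G" "j \<in> G" for i j
    proof -
      have ij: "i \<in> V - J" "j \<in> V - J" using that G J Suc.prems by auto
      obtain J' f' where J': "J' = insert i (insert j J)" "card J' \<le> card J + 2"
        "\<And>h. (\<Prod>a\<in>J'. f' a (h a)) = ?q h * (c (h i) * c (h j))"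
        "avg H (\<lambda>h. \<Prod>a\<in>J'. f' a (h a)) = avg H ?q * (if i = j then x * (1 - x) else 0)"
        using avg_centered_pair[of J i j s f] ij J assms(4) unfolding c_def x_def by auto
      \<comment> \<open>\<open>i\<close> and \<open>j\<close> lie in \<open>G\<close>, so
        \<open>J'\<close> stays disjoint from \<open>A - G\<close>, and its size is at most
        \<open>card J + 2\<close>: the induction hypothesis splits off \<open>F\<close>.\<close>
      have "avg H (\<lambda>h. (\<Prod>a\<in>J'. f' a (h a)) * F h) = avg H (\<lambda>h. \<Prod>a\<in>J'. f' a (h a)) * ?C"
        by (rule F(3)[rule_format]) (use J'(1,2) ij J that G in auto)
      then show ?thesis unfolding J'(3) J'(4)[unfolded J'(3)] .
    qed
    have "avg H (\<lambda>h. ?q h * (F h * Y h))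
        = avg H (\<lambda>h. \<Sum>i\<in>G. \<Sum>j\<in>G. (1 / (real g * x)\<^sup>2) * (?q h * (c (h i) * c (h j)) * F h))"
    proof (rule avg_cong)
      fix h
      have Y: "Y h = (1 / (real g * x)\<^sup>2) * (\<Sum>i\<in>G. \<Sum>j\<in>G. c (h i) * c (h j))"
        unfolding Y_def power_divide power2_eq_square[of "sum _ _"] sum_product by simp
      show "?q h * (F h * Y h) = (\<Sum>i\<in>G. \<Sum>j\<in>G. (1 / (real g * x)\<^sup>2) * (?q h * (c (h i) * c (h j)) * F h))"
        unfolding Y sum_distrib_left by (intro sum.cong refl) (simp only: mult_ac)
    qed
    also have "\<dots> = (\<Sum>i\<in>G. \<Sum>j\<in>G. (1 / (real g * x)\<^sup>2) * (avg H ?q * (if i = j then x * (1 - x) else 0) * ?C))"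
      unfolding avg_sum avg_cmult by (intro sum.cong refl arg_cong2[where f = "(*)"] pair)
    \<comment> \<open>Off-diagonal terms vanish. The \<open>g\<close> diagonal ones contribute
      \<open>x * (1 - x)\<close> each, and dividing by \<open>(real g * x)\<^sup>2\<close> leaves
      the new factor \<open>(1 - x) / (real g * x)\<close>.\<close>
    also have "\<dots> = (\<Sum>i\<in>G. (1 / (real g * x)\<^sup>2) * (avg H ?q * (x * (1 - x)) * ?C))"
    proof (rule sum.cong)
      fix i assume "i \<in> G"
      have "(\<Sum>j\<in>G. (1 / (real g * x)\<^sup>2) * (avg H ?q * (if i = j then x * (1 - x) else 0) * ?C))
        = (\<Sum>j\<in>G. if i = j then (1 / (real g * x)\<^sup>2) * (avg H ?q * (x * (1 - x)) * ?C) else 0)"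
        by (rule sum.cong) auto
      then show "(\<Sum>j\<in>G. (1 / (real g * x)\<^sup>2) * (avg H ?q * (if i = j then x * (1 - x) else 0) * ?C))
        = (1 / (real g * x)\<^sup>2) * (avg H ?q * (x * (1 - x)) * ?C)"
        using \<open>i \<in> G\<close> finG by simp
    qed simp
    also have "\<dots> = avg H ?q * ((1 - x) / (real g * x)) ^ Suc l"
      using G x assms(3) by (simp add: power2_eq_square field_simps)
    finally show "avg H (\<lambda>h. ?q h * (F h * Y h)) = avg H ?q * ((1 - x) / (real g * x)) ^ Suc l" .
  qed
qed

text \<open>Averages the majorant of \<open>tail_majorant\<close> against the indicator of the fixed
  values. Groups of size \<open>card A div l\<close> cover at least half of \<open>A\<close> because
  \<open>l \<le> card A\<close>; this rounding is the factor 2.\<close>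

lemma point_tail:
  assumes "J \<subseteq> V" "A \<subseteq> V" "J \<inter> A = {}" "card J + 2 * l \<le> k" "1 \<le> l" "l \<le> card A"
    and "\<And>i. i \<in> J \<Longrightarrow> \<sigma> i \<in> {1..N}" "s \<in> {1..N}"
  shows "point J \<sigma> A (\<lambda>_. s) \<le> (1 / real N) ^ card J * (2 * real l * real N / (real (card A) * real s)) ^ l"
proof -
  define g where "g = card A div l"
  have g: "1 \<le> g" "l * g \<le> card A"
    using assms by (auto simp: g_def Suc_le_eq div_greater_zero_iff)
  have "card A < l * g + l"
    unfolding g_def using dividend_less_times_div[of l "card A"] assms(5) by (simp add: add.commute)
  also have "\<dots> \<le> 2 * (l * g)" using g(1) assms(5) by simp
  finally have "real (card A) \<le> real (2 * (l * g))" by linarith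
  then have g2: "real (card A) \<le> 2 * real l * real g" by simp
  define x where "x = real s / real N"
  have x: "0 < x" "x \<le> 1" using assms(8) N_pos by (auto simp: x_def)
  obtain F where F: "\<forall>h. 0 \<le> F h" "\<forall>h. (\<forall>a\<in>A. s < h a) \<longrightarrow> 1 \<le> F h"
    "\<forall>J f. J \<subseteq> V \<and> J \<inter> A = {} \<and> card J + 2 * l \<le> k \<longrightarrow>
      avg H (\<lambda>h. (\<Prod>i\<in>J. f i (h i)) * F h) = avg H (\<lambda>h. \<Prod>i\<in>J. f i (h i)) * ((1 - x) / (real g * x)) ^ l"
    using tail_majorant[OF assms(2) g(2,1) assms(8), folded x_def] by (elim exE conjE)
  have finJ: "finite J" using assms finite_sub by auto
  have "point J \<sigma> A (\<lambda>_. s) \<le> avg H (\<lambda>h. (\<Prod>i\<in>J. of_bool (h i = \<sigma> i)) * F h)"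
    unfolding point_def of_bool_conj of_bool_ball[OF finJ, symmetric]
    by (intro avg_mono mult_left_mono prod_nonneg) (use F in auto)
  also have "\<dots> = avg H (\<lambda>h. \<Prod>i\<in>J. of_bool (h i = \<sigma> i)) * ((1 - x) / (real g * x)) ^ l"
    by (rule F(3)[rule_format]) (use assms in auto)
  also have "avg H (\<lambda>h. \<Prod>i\<in>J. of_bool (h i = \<sigma> i)) = (\<Prod>i\<in>J. avg {1..N} (\<lambda>y. of_bool (y = \<sigma> i)))"
    using assms by (intro avg_prod) auto
  also have "\<dots> = (1 / real N) ^ card J"
    using avg_eq_point[OF assms(7)] by simp
  finally have le: "point J \<sigma> A (\<lambda>_. s) \<le> (1 / real N) ^ card J * ((1 - x) / (real g * x)) ^ l" .
  have "(1 - x) / (real g * x) \<le> 2 * real l * real N / (real (card A) * real s)"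
  proof -
    have "(1 - x) / (real g * x) \<le> 1 / (real g * x)" using x g by (intro divide_right_mono) auto
    also have "\<dots> \<le> 2 * real l / (real (card A) * x)"
      using g2 x g assms(5,6) by (simp add: field_simps)
    also have "\<dots> = 2 * real l * real N / (real (card A) * real s)" by (simp add: x_def)
    finally show ?thesis .
  qed
  then have "((1 - x) / (real g * x)) ^ l \<le> (2 * real l * real N / (real (card A) * real s)) ^ l"
    using x by (intro power_mono) auto
  then show ?thesis
    using le mult_left_mono[of _ _ "(1 / real N) ^ card J"] by (meson order_trans zero_le_divide_1_iff of_nat_0_le_iff zero_le_power)
qed

end

section \<open>Sums over hash values\<close>

text \<open>The increment of a power is at most the length times the derivative at the right end;
  the counterpart of \<open>power_Suc_add_le\<close>.\<close>

lemma power_Suc_add_ge: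
  fixes x y :: real
  assumes "0 \<le> x" "0 \<le> y"
  shows "(x + y) ^ Suc m \<le> x ^ Suc m + real (Suc m) * y * (x + y) ^ m"
proof (induction m)
  case (Suc m)
  have "(x + y) ^ Suc (Suc m) = x * (x + y) ^ Suc m + y * (x + y) ^ Suc m"
    by (simp add: algebra_simps)
  also have "\<dots> \<le> x * (x ^ Suc m + real (Suc m) * y * (x + y) ^ m) + y * (x + y) ^ Suc m"
    using Suc assms by (intro add_mono mult_left_mono) auto
  also have "\<dots> = x ^ Suc (Suc m) + real (Suc m) * y * (x * (x + y) ^ m) + y * (x + y) ^ Suc m"
    by (simp add: algebra_simps)
  also have "\<dots> \<le> x ^ Suc (Suc m) + real (Suc m) * y * (x + y) ^ Suc m + y * (x + y) ^ Suc m"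
    using assms by (intro add_mono mult_left_mono order_refl) (auto intro!: mult_right_mono)
  also have "\<dots> = x ^ Suc (Suc m) + real (Suc (Suc m)) * y * (x + y) ^ Suc m"
    by (simp add: algebra_simps)
  finally show ?case .
qed simp

lemma sum_powers_le: "real (Suc q) * (\<Sum>j<m. real j ^ q) \<le> real m ^ Suc q"
proof (induction m)
  case (Suc m)
  show ?case using power_Suc_add_le[of "real m" 1 q] Suc by (simp add: algebra_simps)
qed simp

lemma sum_powers_ge: "real m ^ Suc q \<le> real (Suc q) * (\<Sum>j<Suc m. real j ^ q)"
proof (induction m)
  case (Suc m)
  have "real (Suc m) ^ Suc q \<le> real m ^ Suc q + real (Suc q) * real (Suc m) ^ q"
    using power_Suc_add_ge[of "real m" 1 q] by (simp add: add.commute)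
  also have "\<dots> \<le> real (Suc q) * (\<Sum>j<Suc m. real j ^ q) + real (Suc q) * real (Suc m) ^ q"
    using Suc by simp
  finally show ?case by (simp only: sum.lessThan_Suc distrib_left)
qed simp

lemma sum_one_minus_reindex:
  assumes "s \<le> N" "0 < N"
  shows "(\<Sum>t\<in>{s<..N}. (1 - real t / real N) ^ q) = (\<Sum>j<N - s. real j ^ q) / real N ^ q"
proof -
  have "(\<Sum>t\<in>{s<..N}. (1 - real t / real N) ^ q) = (\<Sum>j<N - s. (real j / real N) ^ q)"
  proof (rule sum.reindex_bij_witness[of _ "\<lambda>j. N - j" "\<lambda>t. N - t"])
    fix t assume "t \<in> {s<..N}"
    then show "(real (N - t) / real N) ^ q = (1 - real t / real N) ^ q"
      using assms by (simp add: diff_divide_distrib)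
  qed (use assms in auto)
  then show ?thesis by (simp add: power_divide sum_divide_distrib)
qed

text \<open>Right-endpoint sums of the decreasing function \<open>(1 - x) ^ q\<close> stay below its
  integral.\<close>

lemma sum_one_minus_le:
  assumes "s \<le> N" "0 < N"
  shows "(\<Sum>t\<in>{s<..N}. (1 - real t / real N) ^ q) / real N \<le> (1 - real s / real N) ^ Suc q / real (Suc q)"
proof -
  have "(\<Sum>j<N - s. real j ^ q) \<le> real (N - s) ^ Suc q / real (Suc q)"
    using sum_powers_le[of q "N - s"] by (simp add: field_simps)
  then have "(\<Sum>j<N - s. real j ^ q) / real N ^ Suc q
      \<le> real (N - s) ^ Suc q / real (Suc q) / real N ^ Suc q"
    by (intro divide_right_mono) auto
  moreover have "1 - real s / real N = real (N - s) / real N"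
    using assms by (simp add: diff_divide_distrib)
  ultimately show ?thesis
    unfolding sum_one_minus_reindex[OF assms] by (simp add: power_divide mult.commute)
qed

lemma sum_one_minus_le_0:
  assumes "0 < N"
  shows "(\<Sum>t\<in>{1..N}. (1 - real t / real N) ^ q) / real N \<le> 1 / real (Suc q)"
proof -
  have "{1..N} = {0<..N}" by auto
  then show ?thesis using sum_one_minus_le[of 0 N q] assms by simp
qed

text \<open>The right-endpoint sum is at least the integral from \<open>1 / N\<close> to 1, and
  Bernoulli's inequality bounds what is missing. The loss reflects ties between hash values.\<close>

lemma sum_one_minus_ge:
  assumes "0 < N"
  shows "(1 - real (Suc q) / real N) / real (Suc q) \<le> (\<Sum>t\<in>{1..N}. (1 - real t / real N) ^ q) / real N"
proof -
  have "{1..N} = {0<..N}" by auto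
  then have eq: "(\<Sum>t\<in>{1..N}. (1 - real t / real N) ^ q) = (\<Sum>j<N. real j ^ q) / real N ^ q"
    using sum_one_minus_reindex[of 0 N q] assms by simp
  have "(1 - real (Suc q) / real N) \<le> (1 - 1 / real N) ^ Suc q"
    using Bernoulli_inequality[of "- 1 / real N" "Suc q"] assms by (simp add: field_simps)
  also have "\<dots> = real (N - 1) ^ Suc q / real N ^ Suc q"
    using assms by (simp add: of_nat_diff diff_divide_distrib flip: power_divide power_Suc)
  also have "\<dots> \<le> real (Suc q) * (\<Sum>j<N. real j ^ q) / real N ^ Suc q"
    using sum_powers_ge[of "N - 1" q] assms by (intro divide_right_mono) auto
  finally have "(1 - real (Suc q) / real N) / real (Suc q)
      \<le> real (Suc q) * (\<Sum>j<N. real j ^ q) / real N ^ Suc q / real (Suc q)"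
    by (intro divide_right_mono) auto
  also have "\<dots> = (\<Sum>j<N. real j ^ q) / real N ^ q / real N" by simp
  finally show ?thesis unfolding eq .
qed

text \<open>The inner sum is at most an integral, which raises the exponent of
  \<open>1 - s / N\<close> by \<open>q + 1\<close>; the outer sum is then of the same kind. It
  serves the part of a double sum where one hash value is strictly smaller.\<close>

lemma ideal_pair_half:
  assumes "0 < N"
  shows "(\<Sum>s\<in>{1..N}. \<Sum>t\<in>{s<..N}. (1 - real s / real N) ^ a * (1 - real t / real N) ^ q) / (real N)\<^sup>2
    \<le> 1 / (real (Suc q) * real (a + q + 2))"
proof -
  have "(\<Sum>s\<in>{1..N}. \<Sum>t\<in>{s<..N}. (1 - real s / real N) ^ a * (1 - real t / real N) ^ q) / (real N)\<^sup>2
      = (\<Sum>s\<in>{1..N}. (1 - real s / real N) ^ a * ((\<Sum>t\<in>{s<..N}. (1 - real t / real N) ^ q) / real N)) / real N"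
    by (simp add: power2_eq_square sum_divide_distrib sum_distrib_left)
  also have "\<dots> \<le> (\<Sum>s\<in>{1..N}. (1 - real s / real N) ^ a * ((1 - real s / real N) ^ Suc q / real (Suc q))) / real N"
    using assms by (intro divide_right_mono sum_mono mult_left_mono sum_one_minus_le) auto
  also have "\<dots> = (\<Sum>s\<in>{1..N}. (1 - real s / real N) ^ (a + Suc q)) / real N / real (Suc q)"
    by (simp only: power_add sum_divide_distrib times_divide_eq_right)
       (simp add: mult.commute)
  also have "\<dots> \<le> 1 / real (Suc (a + Suc q)) / real (Suc q)"
    by (intro divide_right_mono sum_one_minus_le_0 assms) auto
  finally show ?thesis by (simp add: mult.commute)
qed

text \<open>The exact excess over independence is a factor \<open>1 + c / (a + b + c + 2)\<close>. The slack between
  \<open>c / 12\<close> and \<open>c / 8\<close> absorbs ties between the two hash values; for \<open>c = 0\<close> the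
  sum is a product and ties are harmless.\<close>

lemma ideal_pair:
  assumes "27 \<le> N"
  shows "(\<Sum>s\<in>{1..N}. \<Sum>t\<in>{1..N}. (1 - real s / real N) ^ a * (1 - real t / real N) ^ b
      * (1 - real (max s t) / real N) ^ c) / (real N)\<^sup>2
    \<le> 1 / (real (a + c + 1) * real (b + c + 1)) + real c / 8"
proof (cases "c = 0")
  case True
  have "(\<Sum>s\<in>{1..N}. \<Sum>t\<in>{1..N}. (1 - real s / real N) ^ a * (1 - real t / real N) ^ b) / (real N)\<^sup>2
      = ((\<Sum>s\<in>{1..N}. (1 - real s / real N) ^ a) / real N) * ((\<Sum>t\<in>{1..N}. (1 - real t / real N) ^ b) / real N)"
    unfolding sum_product[symmetric] by (simp add: power2_eq_square)
  also have "\<dots> \<le> (1 / real (Suc a)) * (1 / real (Suc b))"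
    using assms by (intro mult_mono sum_one_minus_le_0 divide_nonneg_nonneg sum_nonneg) auto
  finally show ?thesis using True by simp
next
  case False
  let ?x = "\<lambda>s. 1 - real s / real N"
  have x: "0 \<le> ?x s" "?x s \<le> 1" if "s \<in> {1..N}" for s using that by auto
  \<comment> \<open>If \<open>s < t\<close>, the maximum is \<open>t\<close> and the exponent
    \<open>c\<close> joins \<open>b\<close>; if \<open>t < s\<close>, it joins \<open>a\<close>.
    Diagonal terms are bounded by 1.\<close>
  define g where "g = (\<lambda>s t. of_bool (s < t) * (?x s ^ a * ?x t ^ (b + c)))"
  define g' where "g' = (\<lambda>s t. of_bool (t < s) * (?x t ^ b * ?x s ^ (a + c)))"
  have pt: "?x s ^ a * ?x t ^ b * ?x (max s t) ^ c \<le> g s t + g' s t + of_bool (s = t)"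
    if "s \<in> {1..N}" "t \<in> {1..N}" for s t
  proof -
    consider "s < t" | "t < s" | "s = t" by linarith
    then show ?thesis
    proof cases
      case 3
      have "?x s ^ a * ?x s ^ b * ?x s ^ c \<le> 1"
        using x[OF that(1)] by (intro mult_le_one power_le_one) auto
      then show ?thesis using 3 by (simp add: g_def g'_def)
    qed (simp_all add: g_def g'_def power_add max_def mult_ac)
  qed
  have tail: "(\<Sum>t\<in>{1..N}. of_bool (s < t) * F t) = (\<Sum>t\<in>{s<..N}. F t)"
    if "s \<in> {1..N}" for s and F :: "nat \<Rightarrow> real"
    using that by (intro sum.mono_neutral_cong_right) auto
  have "(\<Sum>s\<in>{1..N}. \<Sum>t\<in>{1..N}. g s t) = (\<Sum>s\<in>{1..N}. \<Sum>t\<in>{s<..N}. ?x s ^ a * ?x t ^ (b + c))"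
    unfolding g_def by (intro sum.cong refl tail)
  then have G: "(\<Sum>s\<in>{1..N}. \<Sum>t\<in>{1..N}. g s t) / (real N)\<^sup>2 \<le> 1 / (real (Suc (b + c)) * real (a + (b + c) + 2))"
    using ideal_pair_half[of N a "b + c"] assms by simp
  have "(\<Sum>s\<in>{1..N}. \<Sum>t\<in>{1..N}. g' s t) = (\<Sum>t\<in>{1..N}. \<Sum>s\<in>{1..N}. g' s t)" by (rule sum.swap)
  also have "\<dots> = (\<Sum>t\<in>{1..N}. \<Sum>s\<in>{t<..N}. ?x t ^ b * ?x s ^ (a + c))"
    unfolding g'_def by (intro sum.cong refl tail)
  finally have G': "(\<Sum>s\<in>{1..N}. \<Sum>t\<in>{1..N}. g' s t) / (real N)\<^sup>2 \<le> 1 / (real (Suc (a + c)) * real (b + (a + c) + 2))"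
    using ideal_pair_half[of N b "a + c"] assms by simp
  have E: "(\<Sum>s\<in>{1..N}. \<Sum>t\<in>{1..N}. of_bool (s = t)) = real N"
    by (simp add: of_bool_def)
  have "(\<Sum>s\<in>{1..N}. \<Sum>t\<in>{1..N}. ?x s ^ a * ?x t ^ b * ?x (max s t) ^ c)
      \<le> (\<Sum>s\<in>{1..N}. \<Sum>t\<in>{1..N}. g s t + g' s t + of_bool (s = t))"
    by (intro sum_mono pt)
  also have "\<dots> = (\<Sum>s\<in>{1..N}. \<Sum>t\<in>{1..N}. g s t) + (\<Sum>s\<in>{1..N}. \<Sum>t\<in>{1..N}. g' s t) + real N"
    by (simp only: sum.distrib E)
  finally have "(\<Sum>s\<in>{1..N}. \<Sum>t\<in>{1..N}. ?x s ^ a * ?x t ^ b * ?x (max s t) ^ c) / (real N)\<^sup>2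
      \<le> ((\<Sum>s\<in>{1..N}. \<Sum>t\<in>{1..N}. g s t) + (\<Sum>s\<in>{1..N}. \<Sum>t\<in>{1..N}. g' s t) + real N) / (real N)\<^sup>2"
    by (intro divide_right_mono) auto
  also have "\<dots> \<le> 1 / (real (Suc (b + c)) * real (a + (b + c) + 2))
      + 1 / (real (Suc (a + c)) * real (b + (a + c) + 2)) + 1 / real N"
    using G G' assms by (simp add: add_divide_distrib power2_eq_square)
  also have "1 / real N \<le> 1 / 27" using assms by (intro divide_left_mono) auto
  also have "1 / (real (Suc (b + c)) * real (a + (b + c) + 2)) + 1 / (real (Suc (a + c)) * real (b + (a + c) + 2))
      = 1 / (real (a + c + 1) * real (b + c + 1)) * (1 + real c / real (a + b + c + 2))"
  proof -
    have *: "1 / (v * T) + 1 / (u * T) = 1 / (u * v) * (1 + w / T)"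
      if "u + v = T + w" "u > 0" "v > 0" "T > 0" for u v w T :: real
    proof -
      have "1 / (v * T) + 1 / (u * T) = (u + v) / (u * v * T)" using that by (simp add: field_simps)
      also have "\<dots> = 1 / (u * v) * (1 + w / T)" unfolding that(1) using that(2-4) by (simp add: field_simps)
      finally show ?thesis .
    qed
    show ?thesis
      using *[of "real (a + c + 1)" "real (b + c + 1)" "real (a + b + c + 2)" "real c"]
      by (simp add: algebra_simps)
  qed
  also have "\<dots> \<le> 1 / (real (a + c + 1) * real (b + c + 1)) + real c / 12"
  proof -
    \<comment> \<open>\<open>c \<ge> 1\<close> makes the first two denominators at least 2 and
      \<open>a + b + c + 2\<close> at least 3, whence 1/12.\<close>
    have "1 / (real (a + c + 1) * real (b + c + 1)) * (real c / real (a + b + c + 2)) \<le> (1 / (2 * 2)) * (real c / 3)"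
      using False by (intro mult_mono divide_left_mono) auto
    then show ?thesis by (simp add: distrib_left)
  qed
  also have "1 / (real (a + c + 1) * real (b + c + 1)) + real c / 12 + 1 / 27
      \<le> 1 / (real (a + c + 1) * real (b + c + 1)) + real c / 8"
    using False by simp
  finally show ?thesis by simp
qed

text \<open>\<open>m ^ m / fact m\<close> is one term of the series of \<open>exp m\<close>, and
  \<open>exp 1 \<le> 3\<close>.\<close>

lemma fact_ge_power: "(real m / 3) ^ m \<le> fact m"
proof -
  have "real m ^ m / fact m \<le> exp (real m)"
  proof -
    have s: "summable (\<lambda>n. inverse (fact n) * real m ^ n)" by (rule summable_exp)
    have "real m ^ m / fact m = (\<Sum>n\<in>{m}. inverse (fact n) * real m ^ n)" by (simp add: divide_inverse mult.commute)
    also have "\<dots> \<le> (\<Sum>n. inverse (fact n) * real m ^ n)"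
      by (rule sum_le_suminf[OF s]) auto
    finally show ?thesis by (simp add: exp_def scaleR_conv_of_real)
  qed
  also have "\<dots> = exp 1 ^ m" by (simp add: exp_of_nat_mult[symmetric])
  also have "\<dots> \<le> 3 ^ m" using exp_le by (intro power_mono) auto
  finally show ?thesis by (simp add: power_divide field_simps)
qed

text \<open>The constant 96 is 2 * 3 * 16: it makes \<open>3 * \<mu> / m\<close> at most 1/2. The
  bound \<open>16 * L\<close> leaves room for two vertices with \<open>8 * L\<close> each.\<close>

lemma power_over_fact_le:
  assumes "0 \<le> \<mu>" "\<mu> \<le> 16 * real L" "96 * L \<le> m" "1 \<le> L"
  shows "\<mu> ^ m / fact m \<le> (1 / 2) ^ L"
proof -
  have m: "0 < real m" "96 * real L \<le> real m" using assms by linarith+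
  have "\<mu> ^ m / fact m \<le> \<mu> ^ m / (real m / 3) ^ m"
    using assms m fact_ge_power[of m] by (intro divide_left_mono mult_pos_pos zero_less_power) auto
  also have "\<dots> = (3 * \<mu> / real m) ^ m" by (simp add: power_divide[symmetric] mult.commute)
  also have "\<dots> \<le> (1 / 2) ^ m"
    using assms m by (intro power_mono) (auto simp: field_simps)
  also have "\<dots> \<le> (1 / 2) ^ L" using assms by (intro power_decreasing) auto
  finally show ?thesis .
qed

lemma sum_inverse_squares_le: "1 \<le> k \<Longrightarrow> (\<Sum>s\<in>{k<..N}. 1 / (real s)\<^sup>2) \<le> 1 / real k"
proof -
  assume k: "1 \<le> k"
  have "k \<le> N \<Longrightarrow> (\<Sum>s\<in>{k<..N}. 1 / (real s)\<^sup>2) \<le> 1 / real k - 1 / real N"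
  proof (induction N)
    case (Suc N)
    show ?case
    proof (cases "k \<le> N")
      case True
      then have "{k<..Suc N} = insert (Suc N) {k<..N}" by auto
      moreover have "1 / (real (Suc N))\<^sup>2 \<le> 1 / real N - 1 / real (Suc N)"
      proof -
        have "1 / (real (Suc N))\<^sup>2 \<le> 1 / (real N * real (Suc N))"
          unfolding power2_eq_square using True k by (intro divide_left_mono mult_right_mono) auto
        also have "\<dots> = 1 / real N - 1 / real (Suc N)" using True k by (simp add: field_simps)
        finally show ?thesis .
      qed
      ultimately show ?thesis using Suc True by simp
    next
      case False
      then have "k = Suc N" using Suc by simp
      then show ?thesis by simp
    qed
  qed (use k in simp)
  then show ?thesis by (cases "k \<le> N") (auto intro: order_trans)
qed

text \<open>Truncated inclusion-exclusion is used on hash values \<open>s\<close> that are \<open>small\<close>, i.e. for which the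
  expected number of the \<open>d\<close> neighbours at or below \<open>s\<close> is at most \<open>8 L\<close>. On the others, \<open>tail_bound\<close>
  is the square root of what \<open>2 L\<close> groups give: with two vertices the minimum of the two estimates is
  at most the product of their square roots, so the sum over pairs of hash values factorises.\<close>

definition small :: "nat \<Rightarrow> nat \<Rightarrow> nat \<Rightarrow> nat \<Rightarrow> bool" where
  "small L N d s \<longleftrightarrow> real d * real s \<le> 8 * real L * real N"

definition tail_bound :: "nat \<Rightarrow> nat \<Rightarrow> nat \<Rightarrow> nat \<Rightarrow> real" where
  "tail_bound L N d s = (4 * real L * real N / (real d * real s)) ^ L"

text \<open>At most a fraction \<open>8 * L / d\<close> of the values is small; the added 1s let the
  same bound cover \<open>d \<le> 8 * L\<close>, where it is at least 1.\<close>

lemma sum_small_le: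
  assumes "0 < N"
  shows "(\<Sum>s\<in>{1..N}. of_bool (small L N d s)) / real N \<le> (8 * real L + 1) / (real d + 1)"
proof (cases "d \<le> 8 * L")
  case True
  have "(\<Sum>s\<in>{1..N}. of_bool (small L N d s)) \<le> (\<Sum>s\<in>{1..N}. 1 :: real)"
    by (intro sum_mono) auto
  then have "(\<Sum>s\<in>{1..N}. of_bool (small L N d s)) / real N \<le> (1 :: real)"
    using assms by (simp add: divide_le_eq)
  also have "1 \<le> (8 * real L + 1) / (real d + 1)" using True by (simp add: field_simps)
  finally show ?thesis .
next
  case False
  then have d: "0 < real d" by simp
  let ?x = "8 * real L * real N / real d"
  have "{1..N} \<inter> {s. small L N d s} \<subseteq> {1..nat \<lfloor>?x\<rfloor>}"
  proof
    fix s assume "s \<in> {1..N} \<inter> {s. small L N d s}"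
    then have "1 \<le> s" "real s \<le> ?x" using d by (auto simp: small_def field_simps)
    then show "s \<in> {1..nat \<lfloor>?x\<rfloor>}" by (simp add: le_nat_floor)
  qed
  then have "card ({1..N} \<inter> {s. small L N d s}) \<le> nat \<lfloor>?x\<rfloor>"
    by (metis card_atLeastAtMost card_mono diff_Suc_1 finite_atLeastAtMost)
  then have "real (card ({1..N} \<inter> {s. small L N d s})) \<le> real (nat \<lfloor>?x\<rfloor>)" by (rule of_nat_mono)
  also have "\<dots> \<le> ?x" by (intro of_nat_floor) simp
  finally have "(\<Sum>s\<in>{1..N}. of_bool (small L N d s)) / real N \<le> ?x / real N"
    by (intro divide_right_mono) auto
  also have "\<dots> = 8 * real L / real d" using assms by simp
  also have "\<dots> \<le> (8 * real L + 1) / (real d + 1)"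
    using False d by (simp add: field_simps)
  finally show ?thesis .
qed

text \<open>Outside \<open>small\<close> the base of the power is at most 1/2. Two of the
  \<open>L\<close> factors are kept as \<open>1 / s\<^sup>2\<close>, which is summable; the others
  give the exponential gain.\<close>

lemma sum_tail_le:
  assumes "0 < N" "d \<le> N" "2 \<le> L"
  shows "(\<Sum>s\<in>{1..N}. of_bool (\<not> small L N d s) * tail_bound L N d s) / real N
    \<le> 32 * real L * (1 / 2) ^ L / (real d + 1)"
proof (cases "d = 0")
  case True
  then show ?thesis by (simp add: small_def)
next
  case False
  then have d: "1 \<le> real d" by simp
  define x where "x = 8 * real L * real N / real d"
  have "1 * real d \<le> 8 * real L * real N"
    using assms(2,3) by (intro order_trans[OF _ mult_mono[of 1 "8 * real L" "real d" "real N"]]) auto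
  then have x: "1 \<le> x" using d by (simp add: x_def field_simps)
  \<comment> \<open>The small values are those up to \<open>m\<close>, and \<open>x \<ge> 1\<close>
    gives \<open>m \<ge> x / 2\<close> despite the rounding.\<close>
  define m where "m = nat \<lfloor>x\<rfloor>"
  have m: "1 \<le> m" "x / 2 \<le> real m"
  proof -
    have "1 \<le> \<lfloor>x\<rfloor>" using x by simp
    moreover from this have "real m = real_of_int \<lfloor>x\<rfloor>" by (simp add: m_def)
    ultimately show "1 \<le> m" "x / 2 \<le> real m" by linarith+
  qed
  define y where "y = (\<lambda>s. 4 * real L * real N / (real d * real s))"
  let ?K = "4 * (1 / 2) ^ L * (4 * real L * real N / real d)\<^sup>2"
  have term_le: "of_bool (\<not> small L N d s) * tail_bound L N d s \<le> of_bool (s \<in> {m<..N}) * (?K * (1 / (real s)\<^sup>2))"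
    if "s \<in> {1..N}" for s
  proof (cases "small L N d s")
    case False
    have s: "1 \<le> real s" using that by simp
    have xs: "x < real s" using False d by (simp add: small_def x_def field_simps)
    have "real m \<le> x" unfolding m_def using x by (intro of_nat_floor) auto
    then have "s \<in> {m<..N}" using that xs by auto
    have y: "0 \<le> y s" "y s \<le> 1 / 2"
      using False d s by (auto simp: y_def small_def field_simps)
    have "y s ^ L = y s ^ (L - 2) * (y s)\<^sup>2"
      using assms(3) by (simp only: power_add[symmetric] le_add_diff_inverse2)
    also have "\<dots> \<le> (1 / 2) ^ (L - 2) * (y s)\<^sup>2"
      using y by (intro mult_right_mono power_mono) auto
    also have "(1 / 2 :: real) ^ (L - 2) = 4 * (1 / 2) ^ L"
    proof -
      have "(1 / 2 :: real) ^ L = (1 / 2) ^ (L - 2) * (1 / 2) ^ 2"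
        using assms(3) by (simp only: power_add[symmetric] le_add_diff_inverse2)
      then show ?thesis by (simp add: power2_eq_square)
    qed
    finally have "tail_bound L N d s \<le> 4 * (1 / 2) ^ L * (y s)\<^sup>2"
      by (simp add: tail_bound_def y_def)
    also have "\<dots> = ?K * (1 / (real s)\<^sup>2)"
      by (simp add: y_def power_divide power_mult_distrib)
    finally show ?thesis using False \<open>s \<in> {m<..N}\<close> by simp
  qed auto
  have "(\<Sum>s\<in>{1..N}. of_bool (\<not> small L N d s) * tail_bound L N d s)
      \<le> (\<Sum>s\<in>{1..N}. of_bool (s \<in> {m<..N}) * (?K * (1 / (real s)\<^sup>2)))"
    by (intro sum_mono term_le)
  also have "\<dots> = (\<Sum>s\<in>{m<..N}. ?K * (1 / (real s)\<^sup>2))"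
    using m by (intro sum.mono_neutral_cong_right) auto
  also have "\<dots> = ?K * (\<Sum>s\<in>{m<..N}. 1 / (real s)\<^sup>2)" by (rule sum_distrib_left[symmetric])
  also have "\<dots> \<le> ?K * (2 / x)"
  proof (rule mult_left_mono)
    have "(\<Sum>s\<in>{m<..N}. 1 / (real s)\<^sup>2) \<le> 1 / real m" by (rule sum_inverse_squares_le) (rule m(1))
    also have "\<dots> \<le> 2 / x" using m x by (simp add: field_simps)
    finally show "(\<Sum>s\<in>{m<..N}. 1 / (real s)\<^sup>2) \<le> 2 / x" .
  qed simp
  also have "\<dots> = 16 * real L * (1 / 2) ^ L * real N / real d"
    using d assms by (simp add: x_def power2_eq_square field_simps)
  finally have "(\<Sum>s\<in>{1..N}. of_bool (\<not> small L N d s) * tail_bound L N d s) / real N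
      \<le> 16 * real L * (1 / 2) ^ L * real N / real d / real N"
    by (intro divide_right_mono) auto
  also have "\<dots> = (16 * real L * (1 / 2) ^ L) * (1 / real d)" using assms by simp
  also have "\<dots> \<le> (16 * real L * (1 / 2) ^ L) * (2 / (real d + 1))"
    using d by (intro mult_left_mono) (auto simp: field_simps)
  finally show ?thesis by simp
qed

text \<open>The left side is at most \<open>exp (- d * s / N)\<close>, an \<open>L\<close>-th power
  of \<open>exp (- u)\<close>, and \<open>exp (- u) \<le> 1 / u\<close>. Thus the ideal probability
  obeys a tail estimate like that of the true one.\<close>

lemma one_minus_power_le_tail:
  assumes "s \<in> {1..N}" "1 \<le> d" "1 \<le> L"
  shows "(1 - real s / real N) ^ d \<le> tail_bound L N d s"
proof -
  have N: "0 < real N" using assms by auto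
  define u where "u = real d * real s / (real N * real L)"
  have u: "0 < u" using assms N by (auto simp: u_def)
  have "(1 - real s / real N) ^ d \<le> exp (- (real s / real N)) ^ d"
    using assms exp_ge_add_one_self[of "- (real s / real N)"] by (intro power_mono) auto
  also have "\<dots> = exp (- u) ^ L"
    using assms N by (simp add: u_def flip: exp_of_nat_mult)
  also have "\<dots> \<le> (1 / u) ^ L"
  proof (rule power_mono)
    have "u \<le> exp u" using exp_ge_add_one_self[of u] by linarith
    then show "exp (- u) \<le> 1 / u" using u by (simp add: exp_minus field_simps)
  qed simp
  also have "\<dots> \<le> tail_bound L N d s"
    unfolding tail_bound_def u_def using assms N by (intro power_mono) (auto simp: field_simps)
  finally show ?thesis .
qed

lemma tail_bound_nonneg: "0 \<le> tail_bound L N d s"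
  by (simp add: tail_bound_def)

lemma tail_bound_le_1:
  assumes "\<not> small L N d s"
  shows "tail_bound L N d s \<le> 1"
proof -
  have "0 \<le> 8 * real L * real N" by simp
  then have "0 < real d * real s" using assms unfolding small_def by linarith
  moreover have "0 \<le> real L * real N" by simp
  ultimately show ?thesis
    unfolding tail_bound_def using assms by (intro power_le_one) (auto simp: small_def field_simps)
qed

section \<open>Probability of being a local minimum\<close>

text \<open>Relative error of the local-minimum probabilities. The square of \<open>L\<close> comes
  from pairs, where each vertex contributes a factor of order \<open>L\<close>; 1700 covers the
  constants collected in \<open>hash_error_bounds\<close>.\<close>

definition hash_error :: "nat \<Rightarrow> real" where
  "hash_error L = 1700 * (real L)\<^sup>2 * (1 / 2) ^ L"

context kwise_family
begin

definition min_prob :: "'v \<Rightarrow> 'v set \<Rightarrow> real" where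
  "min_prob v A = avg H (\<lambda>h. of_bool (\<forall>a\<in>A. h v < h a))"

definition min_prob2 :: "'v \<Rightarrow> 'v set \<Rightarrow> 'v \<Rightarrow> 'v set \<Rightarrow> real" where
  "min_prob2 u A v B = avg H (\<lambda>h. of_bool ((\<forall>a\<in>A. h u < h a) \<and> (\<forall>b\<in>B. h v < h b)))"

lemma point_nonneg: "0 \<le> point J \<sigma> U \<theta>"
  unfolding point_def by (intro avg_nonneg) auto

lemma point_mono:
  assumes "U' \<subseteq> U" "\<And>i. i \<in> U' \<Longrightarrow> \<theta>' i \<le> \<theta> i"
  shows "point J \<sigma> U \<theta> \<le> point J \<sigma> U' \<theta>'"
  unfolding point_def
proof (rule avg_mono)
  fix h :: "'v \<Rightarrow> nat"
  have "\<theta>' i < h i" if "\<forall>i\<in>U. \<theta> i < h i" "i \<in> U'" for i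
    using that assms by (meson le_less_trans subsetD)
  then show "of_bool ((\<forall>i\<in>J. h i = \<sigma> i) \<and> (\<forall>i\<in>U. \<theta> i < h i))
      \<le> (of_bool ((\<forall>i\<in>J. h i = \<sigma> i) \<and> (\<forall>i\<in>U'. \<theta>' i < h i)) :: real)"
    by (simp add: of_bool_def)
qed

lemma min_prob_eq_sum:
  assumes "v \<in> V"
  shows "min_prob v A = (\<Sum>s\<in>{1..N}. point {v} (\<lambda>_. s) A (\<lambda>_. s))"
  unfolding min_prob_def point_def avg_sum[symmetric]
proof (rule avg_cong)
  fix h assume "h \<in> H"
  then have hv: "h v \<in> {1..N}" using H_range assms by auto
  have "(\<Sum>s\<in>{1..N}. of_bool ((\<forall>i\<in>{v}. h i = s) \<and> (\<forall>i\<in>A. s < h i)))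
      = (\<Sum>s\<in>{1..N}. if s = h v then of_bool (\<forall>a\<in>A. h v < h a) else 0 :: real)"
    by (rule sum.cong) auto
  then show "of_bool (\<forall>a\<in>A. h v < h a)
      = (\<Sum>s\<in>{1..N}. of_bool ((\<forall>i\<in>{v}. h i = s) \<and> (\<forall>i\<in>A. s < h i)) :: real)"
    using hv by simp
qed

text \<open>\<open>point_tail\<close> with \<open>2 * L\<close> groups, which fit because a value
  outside \<open>small\<close> forces \<open>card A \<ge> 8 * L\<close>. The exponent
  \<open>2 * L\<close> yields the square of \<open>tail_bound\<close>.\<close>

lemma point_tail_small:
  assumes "1 \<le> L" "card J + 4 * L \<le> k" "J \<subseteq> V" "A \<subseteq> V" "J \<inter> A = {}"
    and "\<And>i. i \<in> J \<Longrightarrow> \<sigma> i \<in> {1..N}" "s \<in> {1..N}" "\<not> small L N (card A) s"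
  shows "point J \<sigma> A (\<lambda>_. s) \<le> (1 / real N) ^ card J * (tail_bound L N (card A) s)\<^sup>2"
proof -
  have "8 * real L * real N < real (card A) * real s" using assms by (simp add: small_def)
  also have "\<dots> \<le> real (card A) * real N" using assms by (intro mult_left_mono) auto
  finally have "8 * L \<le> card A" using N_pos by simp
  then have "point J \<sigma> A (\<lambda>_. s) \<le> (1 / real N) ^ card J * (2 * real (2 * L) * real N / (real (card A) * real s)) ^ (2 * L)"
    using assms by (intro point_tail) auto
  then show ?thesis by (simp add: tail_bound_def power_mult[symmetric] mult.commute)
qed

text \<open>Outside \<open>small\<close>, both quantities lie between 0 and
  \<open>tail_bound L N d s / N\<close>. On \<open>small\<close>, truncation at the even depth
  \<open>96 * L\<close> bounds from above and at the odd depth \<open>96 * L - 1\<close> from below;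
  \<open>100 * L\<close> leaves room for the fixed vertex.\<close>

lemma abs_point_diff_le:
  assumes L: "2 \<le> L" "100 * L \<le> k" and "A \<subseteq> V" "v \<in> V - A" "s \<in> {1..N}"
  defines "d \<equiv> card A"
  shows "\<bar>point {v} (\<lambda>_. s) A (\<lambda>_. s) - (1 - real s / real N) ^ d / real N\<bar>
    \<le> (of_bool (small L N d s) * (1 / 2) ^ L + of_bool (\<not> small L N d s) * tail_bound L N d s) / real N"
proof (cases "small L N d s")
  case True
  have mu: "(\<Sum>i\<in>A. real s / real N) = real d * real s / real N" by (simp add: d_def)
  have mu_bounds: "0 \<le> real d * real s / real N" "real d * real s / real N \<le> 16 * real L"
  proof -
    have "real d * real s \<le> 8 * real L * real N" using True by (simp add: small_def)
    also have "\<dots> \<le> 16 * real L * real N" by (intro mult_right_mono) auto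
    finally show "real d * real s / real N \<le> 16 * real L" using N_pos by (simp add: divide_le_eq)
  qed simp
  have P: "(\<Prod>i\<in>A. 1 - real s / real N) = (1 - real s / real N) ^ d" by (simp add: d_def)
  have e: "(real d * real s / real N) ^ Suc r / fact (Suc r) \<le> (1 / 2) ^ L" if "96 * L \<le> Suc r" for r
    using mu_bounds that L by (intro power_over_fact_le) auto
  have "point {v} (\<lambda>_. s) A (\<lambda>_. s)
      \<le> (1 / real N) ^ card {v} * ((1 - real s / real N) ^ d + (real d * real s / real N) ^ Suc (96 * L) / fact (Suc (96 * L)))"
    unfolding mu[symmetric] P[symmetric] using assms by (intro point_le) auto
  also have "\<dots> \<le> (1 / real N) ^ card {v} * ((1 - real s / real N) ^ d + (1 / 2) ^ L)"
    by (intro mult_left_mono add_left_mono e) auto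
  finally have u: "point {v} (\<lambda>_. s) A (\<lambda>_. s) \<le> ((1 - real s / real N) ^ d + (1 / 2) ^ L) / real N" by simp
  have "(1 / real N) ^ card {v} * ((1 - real s / real N) ^ d - (1 / 2) ^ L)
    \<le> (1 / real N) ^ card {v} * ((1 - real s / real N) ^ d - (real d * real s / real N) ^ Suc (96 * L - 1) / fact (Suc (96 * L - 1)))"
    using L by (intro mult_left_mono diff_left_mono e) auto
  also have "\<dots> \<le> point {v} (\<lambda>_. s) A (\<lambda>_. s)"
    unfolding mu[symmetric] P[symmetric] using assms by (intro point_ge) auto
  finally have "((1 - real s / real N) ^ d - (1 / 2) ^ L) / real N \<le> point {v} (\<lambda>_. s) A (\<lambda>_. s)" by simp
  then show ?thesis using u True by (simp add: add_divide_distrib diff_divide_distrib abs_le_iff)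
next
  case False
  then have d: "1 \<le> d" by (cases d) (auto simp: small_def)
  have "point {v} (\<lambda>_. s) A (\<lambda>_. s) \<le> (1 / real N) ^ card {v} * (tail_bound L N d s)\<^sup>2"
    unfolding d_def using assms False by (intro point_tail_small) auto
  also have "(tail_bound L N d s)\<^sup>2 \<le> tail_bound L N d s"
    using tail_bound_nonneg tail_bound_le_1[OF False] by (simp add: power2_eq_square mult_left_le)
  finally have "point {v} (\<lambda>_. s) A (\<lambda>_. s) \<le> tail_bound L N d s / real N"
    by (simp add: divide_right_mono)
  moreover have "0 \<le> point {v} (\<lambda>_. s) A (\<lambda>_. s)" by (rule point_nonneg)
  moreover have "0 \<le> (1 - real s / real N) ^ d / real N" using assms by (intro divide_nonneg_nonneg) auto
  moreover have "(1 - real s / real N) ^ d / real N \<le> tail_bound L N d s / real N"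
    using L d assms by (intro divide_right_mono one_minus_power_le_tail) auto
  ultimately show ?thesis using False by simp
qed

lemma hash_error_bounds:
  assumes "2 \<le> L"
  shows "(8 * real L + 1) * (1 / 2) ^ L + 32 * real L * (1 / 2) ^ L \<le> hash_error L"
    and "(8 * real L + 1)\<^sup>2 * (1 / 2) ^ L + 2 * (8 * real L + 1) * (32 * real L * (1 / 2) ^ L)
      + (32 * real L * (1 / 2) ^ L)\<^sup>2 \<le> hash_error L"
proof -
  define y where "y = (1 / 2 :: real) ^ L"
  have y: "0 \<le> y" "y \<le> 1" by (auto simp: y_def power_le_one)
  have L: "2 \<le> real L" using assms by simp
  have L2: "2 * real L \<le> (real L)\<^sup>2"
    unfolding power2_eq_square using L by (intro mult_right_mono) auto
  have "(40 * real L + 1) * y \<le> (1700 * (real L)\<^sup>2) * y"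
    by (rule mult_right_mono) (use L L2 y in linarith)+
  then show "(8 * real L + 1) * (1 / 2) ^ L + 32 * real L * (1 / 2) ^ L \<le> hash_error L"
    unfolding hash_error_def y_def by (simp add: algebra_simps)
  have "(32 * real L * y)\<^sup>2 \<le> 1024 * (real L)\<^sup>2 * y"
  proof -
    have "(32 * real L * y)\<^sup>2 = 1024 * (real L)\<^sup>2 * (y * y)" by (simp add: power2_eq_square)
    also have "\<dots> \<le> 1024 * (real L)\<^sup>2 * y" using y by (intro mult_left_mono) (auto simp: mult_left_le)
    finally show ?thesis .
  qed
  moreover have "((8 * real L + 1)\<^sup>2 + 2 * (8 * real L + 1) * (32 * real L) + 1024 * (real L)\<^sup>2) * y \<le> (1700 * (real L)\<^sup>2) * y"
  proof (rule mult_right_mono)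
    have "(8 * real L + 1)\<^sup>2 + 2 * (8 * real L + 1) * (32 * real L) + 1024 * (real L)\<^sup>2
        = 1600 * (real L)\<^sup>2 + 80 * real L + 1"
      by (simp add: power2_eq_square algebra_simps)
    then show "(8 * real L + 1)\<^sup>2 + 2 * (8 * real L + 1) * (32 * real L) + 1024 * (real L)\<^sup>2 \<le> 1700 * (real L)\<^sup>2"
      using L L2 by linarith
  qed (rule y)
  ultimately show "(8 * real L + 1)\<^sup>2 * (1 / 2) ^ L + 2 * (8 * real L + 1) * (32 * real L * (1 / 2) ^ L)
      + (32 * real L * (1 / 2) ^ L)\<^sup>2 \<le> hash_error L"
    unfolding hash_error_def y_def[symmetric] by (simp add: algebra_simps)
qed

text \<open>Summing \<open>abs_point_diff_le\<close> over the hash value of \<open>v\<close> keeps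
  the error relative, since \<open>sum_small_le\<close> and \<open>sum_tail_le\<close> both carry
  the factor \<open>1 / (d + 1)\<close>. The extra term in the lower bound is the loss by
  ties.\<close>

lemma min_prob_bounds:
  assumes L: "2 \<le> L" "100 * L \<le> k" and A: "A \<subseteq> V" "v \<in> V - A" "card A \<le> N"
  shows "min_prob v A \<le> (1 + hash_error L) / (real (card A) + 1)"
    and "(1 - hash_error L - (real (card A) + 1) / real N) / (real (card A) + 1) \<le> min_prob v A"
proof -
  define d where "d = card A"
  define I where "I = (\<Sum>s\<in>{1..N}. (1 - real s / real N) ^ d) / real N"
  have "\<bar>min_prob v A - I\<bar>
      = \<bar>\<Sum>s\<in>{1..N}. point {v} (\<lambda>_. s) A (\<lambda>_. s) - (1 - real s / real N) ^ d / real N\<bar>"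
    using A by (simp add: min_prob_eq_sum I_def sum_subtractf sum_divide_distrib)
  also have "\<dots> \<le> (\<Sum>s\<in>{1..N}. (of_bool (small L N d s) * (1 / 2) ^ L + of_bool (\<not> small L N d s) * tail_bound L N d s) / real N)"
    unfolding d_def using assms by (intro order_trans[OF sum_abs] sum_mono abs_point_diff_le) auto
  also have "\<dots> = (\<Sum>s\<in>{1..N}. of_bool (small L N d s)) / real N * (1 / 2) ^ L
      + (\<Sum>s\<in>{1..N}. of_bool (\<not> small L N d s) * tail_bound L N d s) / real N"
    by (simp only: sum.distrib sum_distrib_right sum_divide_distrib add_divide_distrib times_divide_eq_left)
  also have "\<dots> \<le> (8 * real L + 1) / (real d + 1) * (1 / 2) ^ L + 32 * real L * (1 / 2) ^ L / (real d + 1)"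
    using L A N_pos unfolding d_def by (intro add_mono mult_right_mono sum_small_le sum_tail_le) auto
  also have "\<dots> = ((8 * real L + 1) * (1 / 2) ^ L + 32 * real L * (1 / 2) ^ L) / (real d + 1)"
    by (simp only: add_divide_distrib[of "(8 * real L + 1) * (1 / 2) ^ L"] times_divide_eq_left)
  also have "\<dots> \<le> hash_error L / (real d + 1)"
    using hash_error_bounds(1)[OF L(1)] by (intro divide_right_mono) auto
  finally have dev: "\<bar>min_prob v A - I\<bar> \<le> hash_error L / (real d + 1)" .
  have I: "I \<le> 1 / (real d + 1)" "(1 - (real d + 1) / real N) / (real d + 1) \<le> I"
    using sum_one_minus_le_0[OF N_pos, of d] sum_one_minus_ge[OF N_pos, of d]
    unfolding I_def by (simp_all add: add.commute)
  show "min_prob v A \<le> (1 + hash_error L) / (real (card A) + 1)"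
    using dev I(1) unfolding add_divide_distrib d_def[symmetric] by linarith
  show "(1 - hash_error L - (real (card A) + 1) / real N) / (real (card A) + 1) \<le> min_prob v A"
    using dev I(2) unfolding diff_divide_distrib d_def[symmetric] by linarith
qed

text \<open>A common neighbour has to exceed both values, hence the maximum; the default 0 stands
  for an absent condition and is absorbed by the other entry.\<close>

lemma min_prob2_eq_sum:
  assumes "u \<in> V" "v \<in> V" "u \<noteq> v"
  shows "min_prob2 u A v B = (\<Sum>s\<in>{1..N}. \<Sum>t\<in>{1..N}.
    point {u, v} (\<lambda>i. if i = u then s else t) (A \<union> B) (\<lambda>i. max (if i \<in> A then s else 0) (if i \<in> B then t else 0)))"
  unfolding min_prob2_def point_def avg_sum[symmetric]
proof (rule avg_cong)
  fix h assume "h \<in> H"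
  then have hu: "h u \<in> {1..N}" and hv: "h v \<in> {1..N}" using H_range assms by auto
  have "(\<Sum>s\<in>{1..N}. \<Sum>t\<in>{1..N}. of_bool ((\<forall>i\<in>{u, v}. h i = (if i = u then s else t)) \<and>
        (\<forall>i\<in>A \<union> B. max (if i \<in> A then s else 0) (if i \<in> B then t else 0) < h i)))
      = (\<Sum>s\<in>{1..N}. \<Sum>t\<in>{1..N}. if t = h v then (if s = h u then of_bool ((\<forall>a\<in>A. h u < h a) \<and> (\<forall>b\<in>B. h v < h b)) else 0) else 0 :: real)"
  proof (intro sum.cong refl)
    fix s t :: nat assume "s \<in> {1..N}" "t \<in> {1..N}"
    then have "(\<forall>i\<in>A \<union> B. max (if i \<in> A then s else 0) (if i \<in> B then t else 0) < h i)
      \<longleftrightarrow> (\<forall>a\<in>A. s < h a) \<and> (\<forall>b\<in>B. t < h b)"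
    proof -
      have "max (if i \<in> A then s else 0) (if i \<in> B then t else 0) < h i
          \<longleftrightarrow> (i \<in> A \<longrightarrow> s < h i) \<and> (i \<in> B \<longrightarrow> t < h i)" if "i \<in> A \<union> B" for i
        using that by (cases "i \<in> A"; cases "i \<in> B") auto
      then show ?thesis by blast
    qed
    then show "of_bool ((\<forall>i\<in>{u, v}. h i = (if i = u then s else t)) \<and>
        (\<forall>i\<in>A \<union> B. max (if i \<in> A then s else 0) (if i \<in> B then t else 0) < h i))
      = (if t = h v then (if s = h u then of_bool ((\<forall>a\<in>A. h u < h a) \<and> (\<forall>b\<in>B. h v < h b)) else 0) else 0 :: real)"
      using assms(3) by auto
  qed
  also have "\<dots> = of_bool ((\<forall>a\<in>A. h u < h a) \<and> (\<forall>b\<in>B. h v < h b))"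
    using hu hv by simp
  finally show "of_bool ((\<forall>a\<in>A. h u < h a) \<and> (\<forall>b\<in>B. h v < h b))
    = (\<Sum>s\<in>{1..N}. \<Sum>t\<in>{1..N}. of_bool ((\<forall>i\<in>{u, v}. h i = (if i = u then s else t)) \<and>
        (\<forall>i\<in>A \<union> B. max (if i \<in> A then s else 0) (if i \<in> B then t else 0) < h i)) :: real)" ..
qed

text \<open>When one value is not small, the other neighbourhood is dropped and
  \<open>point_tail_small\<close> applies. When neither is, the smaller of the two squares is at
  most the product of the tail bounds, a form that factorises on summation.\<close>

lemma point_pair_le:
  assumes L: "2 \<le> L" "100 * L \<le> k"
    and AB: "A \<subseteq> V" "B \<subseteq> V" "u \<in> V - (A \<union> B)" "v \<in> V - (A \<union> B)" "u \<noteq> v"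
    and st: "s \<in> {1..N}" "t \<in> {1..N}"
  defines "\<theta> \<equiv> \<lambda>i. max (if i \<in> A then s else 0) (if i \<in> B then t else 0)"
  defines "\<alpha> \<equiv> \<lambda>s. of_bool (small L N (card A) s) :: real"
    and "\<beta> \<equiv> \<lambda>t. of_bool (small L N (card B) t) :: real"
    and "\<alpha>' \<equiv> \<lambda>s. of_bool (\<not> small L N (card A) s) * tail_bound L N (card A) s"
    and "\<beta>' \<equiv> \<lambda>t. of_bool (\<not> small L N (card B) t) * tail_bound L N (card B) t"
  shows "point {u, v} (\<lambda>i. if i = u then s else t) (A \<union> B) \<theta>
    \<le> (1 / real N)\<^sup>2 * ((\<Prod>i\<in>A \<union> B. 1 - real (\<theta> i) / real N)
        + (\<alpha> s * \<beta> t * (1 / 2) ^ L + \<alpha> s * \<beta>' t + \<alpha>' s * \<beta> t + \<alpha>' s * \<beta>' t))"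
proof -
  let ?\<sigma> = "\<lambda>i. if i = u then s else t"
  let ?P = "\<Prod>i\<in>A \<union> B. 1 - real (\<theta> i) / real N"
  have fin: "finite A" "finite B" using AB finite_sub by auto
  have card2: "card {u, v} = 2" using AB by simp
  have \<theta>: "\<theta> i \<le> N" for i using st by (auto simp: \<theta>_def)
  have P: "0 \<le> ?P" using \<theta> N_pos by (intro prod_nonneg) (auto simp: divide_le_eq)
  have TA: "point {u, v} ?\<sigma> (A \<union> B) \<theta> \<le> (1 / real N)\<^sup>2 * (tail_bound L N (card A) s)\<^sup>2"
    if "\<not> small L N (card A) s"
  proof -
    have "point {u, v} ?\<sigma> (A \<union> B) \<theta> \<le> point {u, v} ?\<sigma> A (\<lambda>_. s)"
      by (rule point_mono) (auto simp: \<theta>_def)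
    also have "\<dots> \<le> (1 / real N) ^ card {u, v} * (tail_bound L N (card A) s)\<^sup>2"
      using L AB st that card2 by (intro point_tail_small) auto
    finally show ?thesis unfolding card2 .
  qed
  have TB: "point {u, v} ?\<sigma> (A \<union> B) \<theta> \<le> (1 / real N)\<^sup>2 * (tail_bound L N (card B) t)\<^sup>2"
    if "\<not> small L N (card B) t"
  proof -
    have "point {u, v} ?\<sigma> (A \<union> B) \<theta> \<le> point {u, v} ?\<sigma> B (\<lambda>_. t)"
      by (rule point_mono) (auto simp: \<theta>_def)
    also have "\<dots> \<le> (1 / real N) ^ card {u, v} * (tail_bound L N (card B) t)\<^sup>2"
      using L AB st that card2 by (intro point_tail_small) auto
    finally show ?thesis unfolding card2 .
  qed
  have sq: "(tail_bound L N d x)\<^sup>2 \<le> tail_bound L N d x" if "\<not> small L N d x" for d x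
    using tail_bound_nonneg tail_bound_le_1[OF that] by (simp add: power2_eq_square mult_left_le)
  \<comment> \<open>The product term is nonnegative, so pure tail estimates may be weakened to the
    common form.\<close>
  have main: "point {u, v} ?\<sigma> (A \<union> B) \<theta> \<le> (1 / real N)\<^sup>2 * (?P + E)"
    if "point {u, v} ?\<sigma> (A \<union> B) \<theta> \<le> (1 / real N)\<^sup>2 * E" for E
    using that P by (meson order_trans mult_left_mono zero_le_power2 le_add_same_cancel2)
  consider "small L N (card A) s" "small L N (card B) t" | "small L N (card A) s" "\<not> small L N (card B) t"
    | "\<not> small L N (card A) s" "small L N (card B) t" | "\<not> small L N (card A) s" "\<not> small L N (card B) t" by blast
  then show ?thesis
  proof cases
    case 1
    let ?\<mu> = "\<Sum>i\<in>A \<union> B. real (\<theta> i) / real N"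
    \<comment> \<open>The maximum is at most the sum, so common neighbours are counted twice and the
      two smallness conditions add up to \<open>16 * L\<close>.\<close>
    have "(\<Sum>i\<in>A \<union> B. real (\<theta> i)) \<le> (\<Sum>i\<in>A \<union> B. (if i \<in> A then real s else 0) + (if i \<in> B then real t else 0))"
      by (intro sum_mono) (auto simp: \<theta>_def)
    also have "\<dots> = real (card A) * real s + real (card B) * real t"
      using fin by (simp add: sum.distrib sum.If_cases Int_absorb1 Int_absorb2 Un_Int_eq)
    also have "\<dots> \<le> 16 * real L * real N" using 1 by (simp add: small_def)
    finally have "?\<mu> \<le> 16 * real L" using N_pos by (simp add: divide_le_eq flip: sum_divide_distrib)
    then have e: "?\<mu> ^ Suc (96 * L) / fact (Suc (96 * L)) \<le> (1 / 2) ^ L"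
      using L by (intro power_over_fact_le) (auto intro!: sum_nonneg)
    have "point {u, v} ?\<sigma> (A \<union> B) \<theta>
      \<le> (1 / real N) ^ card {u, v} * (?P + ?\<mu> ^ Suc (96 * L) / fact (Suc (96 * L)))"
      using L AB st card2 \<theta> by (intro point_le) auto
    also have "\<dots> \<le> (1 / real N)\<^sup>2 * (?P + (1 / 2) ^ L)"
      unfolding card2 by (intro mult_left_mono add_left_mono e) auto
    finally show ?thesis using 1 by (simp add: \<alpha>_def \<beta>_def \<alpha>'_def \<beta>'_def)
  next
    case 2
    have "point {u, v} ?\<sigma> (A \<union> B) \<theta> \<le> (1 / real N)\<^sup>2 * tail_bound L N (card B) t"
      by (rule order_trans[OF TB]) (use 2 sq in \<open>auto intro!: mult_left_mono\<close>)
    then show ?thesis using main 2 by (simp add: \<alpha>_def \<beta>_def \<alpha>'_def \<beta>'_def)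
  next
    case 3
    have "point {u, v} ?\<sigma> (A \<union> B) \<theta> \<le> (1 / real N)\<^sup>2 * tail_bound L N (card A) s"
      by (rule order_trans[OF TA]) (use 3 sq in \<open>auto intro!: mult_left_mono\<close>)
    then show ?thesis using main 3 by (simp add: \<alpha>_def \<beta>_def \<alpha>'_def \<beta>'_def)
  next
    case 4
    have "point {u, v} ?\<sigma> (A \<union> B) \<theta> \<le> (1 / real N)\<^sup>2 * (tail_bound L N (card A) s * tail_bound L N (card B) t)"
    proof (cases "tail_bound L N (card A) s \<le> tail_bound L N (card B) t")
      case True
      then have "(tail_bound L N (card A) s)\<^sup>2 \<le> tail_bound L N (card A) s * tail_bound L N (card B) t"
        using tail_bound_nonneg by (simp add: power2_eq_square mult_left_mono)
      then show ?thesis by (intro order_trans[OF TA[OF 4(1)]] mult_left_mono) auto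
    next
      case False
      then have "(tail_bound L N (card B) t)\<^sup>2 \<le> tail_bound L N (card A) s * tail_bound L N (card B) t"
        using tail_bound_nonneg by (simp add: power2_eq_square mult_right_mono)
      then show ?thesis by (intro order_trans[OF TB[OF 4(2)]] mult_left_mono) auto
    qed
    then show ?thesis using main 4 by (simp add: \<alpha>_def \<beta>_def \<alpha>'_def \<beta>'_def)
  qed
qed

text \<open>Only common neighbours couple two nonadjacent vertices: the ideal part is the sum in
  \<open>ideal_pair\<close> with \<open>c\<close> common neighbours, and the four error terms
  factorise over \<open>s\<close> and \<open>t\<close>.\<close>

lemma min_prob2_le:
  assumes L: "2 \<le> L" "100 * L \<le> k"
    and AB: "A \<subseteq> V" "B \<subseteq> V" "u \<in> V - (A \<union> B)" "v \<in> V - (A \<union> B)" "u \<noteq> v"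
    and N: "card A \<le> N" "card B \<le> N" "27 \<le> N"
  shows "min_prob2 u A v B \<le> (1 + hash_error L) / ((real (card A) + 1) * (real (card B) + 1)) + real (card (A \<inter> B)) / 8"
proof -
  have fin: "finite A" "finite B" using AB finite_sub by auto
  define a b c where "a = card (A - B)" and "b = card (B - A)" and "c = card (A \<inter> B)"
  have cA: "card A = a + c" and cB: "card B = b + c"
    using fin card_Int_Diff[of A B] card_Int_Diff[of B A] by (simp_all add: a_def b_def c_def Int_commute)
  define \<theta> where "\<theta> = (\<lambda>s t i. max (if i \<in> A then s else 0) (if i \<in> B then t else (0::nat)))"
  define \<alpha> where "\<alpha> = (\<lambda>s. of_bool (small L N (card A) s) :: real)"
  define \<beta> where "\<beta> = (\<lambda>t. of_bool (small L N (card B) t) :: real)"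
  define \<alpha>' where "\<alpha>' = (\<lambda>s. of_bool (\<not> small L N (card A) s) * tail_bound L N (card A) s)"
  define \<beta>' where "\<beta>' = (\<lambda>t. of_bool (\<not> small L N (card B) t) * tail_bound L N (card B) t)"
  define E where "E = (\<lambda>s t. \<alpha> s * \<beta> t * (1 / 2) ^ L + \<alpha> s * \<beta>' t + \<alpha>' s * \<beta> t + \<alpha>' s * \<beta>' t)"
  define P where "P = (\<lambda>s t. \<Prod>i\<in>A \<union> B. 1 - real (\<theta> s t i) / real N)"
  have P: "P s t = (1 - real s / real N) ^ a * (1 - real t / real N) ^ b * (1 - real (max s t) / real N) ^ c" for s t
  proof -
    have "A \<union> B = ((A - B) \<union> (B - A)) \<union> (A \<inter> B)" by auto
    then have "P s t = (\<Prod>i\<in>(A - B) \<union> (B - A). 1 - real (\<theta> s t i) / real N) * (\<Prod>i\<in>A \<inter> B. 1 - real (\<theta> s t i) / real N)"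
      unfolding P_def using fin by (simp only:) (rule prod.union_disjoint; auto)
    also have "(\<Prod>i\<in>(A - B) \<union> (B - A). 1 - real (\<theta> s t i) / real N)
        = (\<Prod>i\<in>A - B. 1 - real (\<theta> s t i) / real N) * (\<Prod>i\<in>B - A. 1 - real (\<theta> s t i) / real N)"
      using fin by (intro prod.union_disjoint) auto
    also have "(\<Prod>i\<in>A - B. 1 - real (\<theta> s t i) / real N) = (\<Prod>i\<in>A - B. 1 - real s / real N)"
      by (intro prod.cong) (auto simp: \<theta>_def)
    also have "(\<Prod>i\<in>B - A. 1 - real (\<theta> s t i) / real N) = (\<Prod>i\<in>B - A. 1 - real t / real N)"
      by (intro prod.cong) (auto simp: \<theta>_def)
    also have "(\<Prod>i\<in>A \<inter> B. 1 - real (\<theta> s t i) / real N) = (\<Prod>i\<in>A \<inter> B. 1 - real (max s t) / real N)"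
      by (intro prod.cong) (auto simp: \<theta>_def)
    finally show ?thesis by (simp add: a_def b_def c_def)
  qed
  define w w' where "w = 1 / (real (card A) + 1)" and "w' = 1 / (real (card B) + 1)"
  define K T where "K = 8 * real L + 1" and "T = 32 * real L * (1 / 2) ^ L"
  have nn: "0 \<le> w" "0 \<le> w'" "0 \<le> K" "0 \<le> T" by (auto simp: w_def w'_def K_def T_def)
  have sA: "(\<Sum>s\<in>{1..N}. \<alpha> s) / real N \<le> K * w" and sB: "(\<Sum>t\<in>{1..N}. \<beta> t) / real N \<le> K * w'"
    using sum_small_le[OF N_pos, of L] unfolding \<alpha>_def \<beta>_def K_def w_def w'_def by auto
  have tA: "(\<Sum>s\<in>{1..N}. \<alpha>' s) / real N \<le> T * w" and tB: "(\<Sum>t\<in>{1..N}. \<beta>' t) / real N \<le> T * w'"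
    using sum_tail_le[OF N_pos, of _ L] L N unfolding \<alpha>'_def \<beta>'_def T_def w_def w'_def by auto
  have nnS: "0 \<le> (\<Sum>s\<in>{1..N}. \<alpha> s) / real N" "0 \<le> (\<Sum>t\<in>{1..N}. \<beta> t) / real N"
    "0 \<le> (\<Sum>s\<in>{1..N}. \<alpha>' s) / real N" "0 \<le> (\<Sum>t\<in>{1..N}. \<beta>' t) / real N"
    by (auto intro!: divide_nonneg_nonneg sum_nonneg simp: \<alpha>_def \<beta>_def \<alpha>'_def \<beta>'_def tail_bound_nonneg)
  have prodsum: "(\<Sum>s\<in>{1..N}. \<Sum>t\<in>{1..N}. f s * g t) / (real N)\<^sup>2
      = ((\<Sum>s\<in>{1..N}. f s) / real N) * ((\<Sum>t\<in>{1..N}. g t) / real N)" for f g :: "nat \<Rightarrow> real"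
    unfolding sum_product[symmetric] by (simp add: power2_eq_square)
  have "min_prob2 u A v B \<le> (\<Sum>s\<in>{1..N}. \<Sum>t\<in>{1..N}. (1 / real N)\<^sup>2 * (P s t + E s t))"
    using AB unfolding min_prob2_eq_sum[OF DiffD1[OF AB(3)] DiffD1[OF AB(4)] AB(5)] P_def E_def \<theta>_def \<alpha>_def \<beta>_def \<alpha>'_def \<beta>'_def
    by (intro sum_mono point_pair_le L) auto
  also have "\<dots> = (\<Sum>s\<in>{1..N}. \<Sum>t\<in>{1..N}. P s t) / (real N)\<^sup>2 + (\<Sum>s\<in>{1..N}. \<Sum>t\<in>{1..N}. E s t) / (real N)\<^sup>2"
    by (simp add: sum.distrib sum_divide_distrib power_divide add_divide_distrib)
  also have "(\<Sum>s\<in>{1..N}. \<Sum>t\<in>{1..N}. P s t) / (real N)\<^sup>2 \<le> w * w' + real c / 8"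
    using ideal_pair[OF N(3), of a b c] unfolding P w_def w'_def cA cB by (simp add: add_ac)
  also have "(\<Sum>s\<in>{1..N}. \<Sum>t\<in>{1..N}. E s t) / (real N)\<^sup>2
     = ((\<Sum>s\<in>{1..N}. \<alpha> s) / real N) * ((\<Sum>t\<in>{1..N}. \<beta> t) / real N) * (1 / 2) ^ L
     + ((\<Sum>s\<in>{1..N}. \<alpha> s) / real N) * ((\<Sum>t\<in>{1..N}. \<beta>' t) / real N)
     + ((\<Sum>s\<in>{1..N}. \<alpha>' s) / real N) * ((\<Sum>t\<in>{1..N}. \<beta> t) / real N)
     + ((\<Sum>s\<in>{1..N}. \<alpha>' s) / real N) * ((\<Sum>t\<in>{1..N}. \<beta>' t) / real N)"
  proof -
    have "(\<Sum>s\<in>{1..N}. \<Sum>t\<in>{1..N}. \<alpha> s * \<beta> t * (1 / 2) ^ L) / (real N)\<^sup>2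
        = ((\<Sum>s\<in>{1..N}. \<alpha> s) / real N) * ((\<Sum>t\<in>{1..N}. \<beta> t) / real N) * (1 / 2) ^ L"
      unfolding prodsum[symmetric] sum_distrib_right[symmetric] by (rule times_divide_eq_left[symmetric])
    then show ?thesis unfolding E_def sum.distrib add_divide_distrib prodsum by simp
  qed
  also have "\<dots> \<le> (K * w) * (K * w') * (1 / 2) ^ L + (K * w) * (T * w') + (T * w) * (K * w') + (T * w) * (T * w')"
    by (intro add_mono mult_mono sA sB tA tB nnS mult_nonneg_nonneg nn order_refl zero_le_power) auto
  also have "\<dots> = (K\<^sup>2 * (1 / 2) ^ L + 2 * K * T + T\<^sup>2) * (w * w')"
    by (simp add: power2_eq_square algebra_simps)
  also have "\<dots> \<le> hash_error L * (w * w')"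
    using hash_error_bounds(2)[OF L(1)] nn unfolding K_def T_def by (intro mult_right_mono) auto
  finally have "min_prob2 u A v B \<le> w * w' + real c / 8 + hash_error L * (w * w')" by simp
  also have "\<dots> = (1 + hash_error L) * (w * w') + real c / 8" by (simp add: algebra_simps)
  finally show ?thesis by (simp add: w_def w'_def c_def)
qed

end

section \<open>Sampling and the second moment\<close>

lemma expectation_pmf_of_set:
  assumes "finite A" "A \<noteq> {}"
  shows "measure_pmf.expectation (pmf_of_set A) f = avg A f"
  using assms by (simp add: integral_pmf_of_set avg_def)

lemma kwise_family_k_wise_independent:
  assumes H: "hash_family n H" and ind: "k_wise_independent k n H" and n: "1 \<le> n"
  shows "kwise_family {1..n} (n ^ 3) k H"
proof
  have ne: "H \<noteq> {}" and sub: "H \<subseteq> {1..n} \<rightarrow>\<^sub>E {1..n ^ 3}"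
    using H by (auto simp: hash_family_def)
  have fin: "finite H" using sub by (rule finite_subset) (intro finite_PiE; simp)
  show "finite {1..n}" "0 < n ^ 3" using n by auto
  show "h i \<in> {1..n ^ 3}" if "h \<in> H" "i \<in> {1..n}" for h i
    using that sub by (auto simp: PiE_def Pi_def)
  fix J and g :: "nat \<Rightarrow> nat \<Rightarrow> real"
  assume J: "J \<subseteq> {1..n}" "card J \<le> k"
  let ?M = "measure_pmf (pmf_of_set H)"
  have int: "integrable ?M f" for f :: "_ \<Rightarrow> real"
    using fin ne by (intro integrable_measure_pmf_finite) simp
  have "prob_space.indep_vars ?M (\<lambda>_. count_space UNIV) (\<lambda>i h. h i) J"
    using ind J unfolding k_wise_independent_def by simp
  then have iv: "prob_space.indep_vars ?M (\<lambda>_. borel) (\<lambda>i h. g i (h i)) J"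
    by (rule prob_space.indep_vars_compose2[OF measure_pmf.prob_space_axioms]) simp
  have "avg H (\<lambda>h. \<Prod>i\<in>J. g i (h i)) = measure_pmf.expectation (pmf_of_set H) (\<lambda>h. \<Prod>i\<in>J. g i (h i))"
    using fin ne by (simp add: expectation_pmf_of_set)
  also have "\<dots> = (\<Prod>i\<in>J. measure_pmf.expectation (pmf_of_set H) (\<lambda>h. g i (h i)))"
    using J finite_subset[OF J(1)] by (intro prob_space.indep_vars_lebesgue_integral[OF measure_pmf.prob_space_axioms] iv int) auto
  also have "\<dots> = (\<Prod>i\<in>J. avg {1..n ^ 3} (g i))"
  proof (rule prod.cong)
    fix i assume "i \<in> J"
    then have "map_pmf (\<lambda>h. h i) (pmf_of_set H) = pmf_of_set {1..n ^ 3}"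
      using ind J unfolding k_wise_independent_def by blast
    moreover have "measure_pmf.expectation (map_pmf (\<lambda>h. h i) (pmf_of_set H)) (g i)
        = measure_pmf.expectation (pmf_of_set H) (\<lambda>h. g i (h i))"
      by (rule integral_map_pmf)
    ultimately have "measure_pmf.expectation (pmf_of_set {1..n ^ 3}) (g i)
        = measure_pmf.expectation (pmf_of_set H) (\<lambda>h. g i (h i))" by simp
    then show "measure_pmf.expectation (pmf_of_set H) (\<lambda>h. g i (h i)) = avg {1..n ^ 3} (g i)"
      using n by (simp add: expectation_pmf_of_set)
  qed simp
  finally show "avg H (\<lambda>h. \<Prod>i\<in>J. g i (h i)) = (\<Prod>i\<in>J. avg {1..n ^ 3} (g i))" .
qed

section \<open>Uniform samples of fixed size and the moments of the surviving sample\<close>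

definition samples :: "'v set \<Rightarrow> nat \<Rightarrow> 'v set set" where
  "samples V m = {S. S \<subseteq> V \<and> card S = m}"

lemma finite_samples: "finite V \<Longrightarrow> finite (samples V m)"
  by (simp add: samples_def)

lemma samples_nonempty: "finite V \<Longrightarrow> m \<le> card V \<Longrightarrow> samples V m \<noteq> {}"
  using obtain_subset_with_card_n[of m V] by (auto simp: samples_def)

lemma card_samples: "finite V \<Longrightarrow> card (samples V m) = card V choose m"
  by (simp add: samples_def n_subsets)

lemma card_samples_superset:
  assumes "finite V" "T \<subseteq> V" "card T \<le> m"
  shows "card {S \<in> samples V m. T \<subseteq> S} = (card V - card T) choose (m - card T)"
proof -
  have finT: "finite T" using assms finite_subset by blast
  have "bij_betw (\<lambda>S. S - T) {S \<in> samples V m. T \<subseteq> S} (samples (V - T) (m - card T))"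
  proof (rule bij_betw_byWitness[where f' = "\<lambda>S. S \<union> T"])
    show "\<forall>S\<in>{S \<in> samples V m. T \<subseteq> S}. (S - T) \<union> T = S" by auto
    show "\<forall>S\<in>samples (V - T) (m - card T). (S \<union> T) - T = S" by (auto simp: samples_def)
    show "(\<lambda>S. S - T) ` {S \<in> samples V m. T \<subseteq> S} \<subseteq> samples (V - T) (m - card T)"
      using finT by (auto simp: samples_def card_Diff_subset)
    show "(\<lambda>S. S \<union> T) ` samples (V - T) (m - card T) \<subseteq> {S \<in> samples V m. T \<subseteq> S}"
    proof (clarsimp simp: samples_def)
      fix S assume S: "S \<subseteq> V - T" "card S = m - card T"
      have "finite S" using S assms(1) finite_subset by blast
      then have "card (S \<union> T) = card S + card T"
        using S finT by (intro card_Un_disjoint) auto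
      then show "S \<subseteq> V \<and> T \<subseteq> V \<and> card (S \<union> T) = m" using S assms by auto
    qed
  qed
  then have "card {S \<in> samples V m. T \<subseteq> S} = card (samples (V - T) (m - card T))"
    by (rule bij_betw_same_card)
  also have "\<dots> = (card V - card T) choose (m - card T)"
    using assms finT by (simp add: card_samples card_Diff_subset)
  finally show ?thesis .
qed

lemma avg_of_bool: "finite A \<Longrightarrow> avg A (\<lambda>x. of_bool (P x)) = real (card {x \<in> A. P x}) / real (card A)"
  by (simp add: avg_def Int_def)

lemma avg_samples_mem:
  assumes "finite V" "v \<in> V" "1 \<le> m" "m \<le> card V"
  shows "avg (samples V m) (\<lambda>S. of_bool (v \<in> S)) = real m / real (card V)"
proof -
  define n' m' where "n' = card V - 1" and "m' = m - 1"
  then have nm: "card V = Suc n'" "m = Suc m'" using assms by auto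
  have "card {S \<in> samples V m. v \<in> S} = n' choose m'"
    using card_samples_superset[of V "{v}" m] assms nm by simp
  moreover have "real (Suc n') * real (n' choose m') = real (Suc n' choose Suc m') * real (Suc m')"
    using Suc_times_binomial_eq[of n' m'] by (metis of_nat_mult)
  moreover have "0 < real (Suc n' choose Suc m')"
    using assms nm by (simp add: zero_less_binomial_iff del: binomial_Suc_Suc)
  ultimately show ?thesis
    using assms(1) nm by (simp add: avg_of_bool finite_samples card_samples field_simps del: binomial_Suc_Suc)
qed

lemma avg_samples_mem2:
  assumes "finite V" "u \<in> V" "v \<in> V" "u \<noteq> v" "1 \<le> m" "m \<le> card V"
  shows "avg (samples V m) (\<lambda>S. of_bool (u \<in> S \<and> v \<in> S))
    = real m * (real m - 1) / (real (card V) * (real (card V) - 1))"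
\<comment> \<open>For \<open>m = 1\<close> the subtraction \<open>m - 2\<close> would be truncated.
  Otherwise two absorption identities for binomials remove one element each.\<close>
proof (cases "m = 1")
  case True
  have "{S \<in> samples V m. u \<in> S \<and> v \<in> S} = {}"
    using assms(4) True by (auto simp: samples_def card_1_singleton_iff)
  then show ?thesis using assms(1) True by (simp add: avg_of_bool finite_samples)
next
  case False
  then have "2 \<le> m" using assms by simp
  define n' m' where "n' = card V - 2" and "m' = m - 2"
  then have nm: "card V = Suc (Suc n')" "m = Suc (Suc m')" using \<open>2 \<le> m\<close> assms(6) by auto
  have "card {S \<in> samples V m. u \<in> S \<and> v \<in> S} = n' choose m'"
    using card_samples_superset[of V "{u, v}" m] assms nm by simp
  moreover have "real (Suc n') * real (n' choose m') = real (Suc n' choose Suc m') * real (Suc m')"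
    using Suc_times_binomial_eq[of n' m'] by (metis of_nat_mult)
  moreover have "real (Suc (Suc n')) * real (Suc n' choose Suc m')
      = real (Suc (Suc n') choose Suc (Suc m')) * real (Suc (Suc m'))"
    using Suc_times_binomial_eq[of "Suc n'" "Suc m'"] by (metis of_nat_mult)
  moreover have "0 < real (Suc (Suc n') choose Suc (Suc m'))"
    using assms nm by (simp add: zero_less_binomial_iff del: binomial_Suc_Suc)
  moreover have "c / b = M * M' / (N * N')"
    if "N' * c = a * M'" "N * a = b * M" "0 < b" "0 < N" "0 < N'" for a b c M M' N N' :: real
  proof -
    have "c * (N * N') = N * (N' * c)" by (simp only: mult_ac)
    also have "\<dots> = N * a * M'" unfolding that(1) by (simp only: mult_ac)
    also have "\<dots> = M * M' * b" unfolding that(2) by (simp only: mult_ac)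
    finally show ?thesis using that(3-5) frac_eq_eq[of b "N * N'" c "M * M'"] by simp
  qed
  ultimately have "real (n' choose m') / real (Suc (Suc n') choose Suc (Suc m'))
      = real (Suc (Suc m')) * real (Suc m') / (real (Suc (Suc n')) * real (Suc n'))"
    by (metis of_nat_0_less_iff zero_less_Suc)
  then show ?thesis
    using assms(1) nm \<open>card {S \<in> samples V m. u \<in> S \<and> v \<in> S} = n' choose m'\<close>
    by (simp add: avg_of_bool finite_samples card_samples del: binomial_Suc_Suc)
qed

lemma avg_Times: "avg (A \<times> B) (\<lambda>(x, y). f x y) = avg A (\<lambda>x. avg B (f x))"
  by (simp add: avg_def sum.cartesian_product[symmetric] card_cartesian_product sum_divide_distrib mult.commute)

lemma avg_Times_mult: "avg (A \<times> B) (\<lambda>x. f (fst x) * g (snd x)) = avg A f * avg B g"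
proof -
  have "avg (A \<times> B) (\<lambda>x. f (fst x) * g (snd x)) = avg A (\<lambda>x. f x * avg B g)"
    using avg_Times[of A B "\<lambda>x y. f x * g y"] by (simp only: case_prod_beta' avg_cmult)
  also have "\<dots> = avg A f * avg B g"
    unfolding avg_def[of A] sum_distrib_right[symmetric] by simp
  finally show ?thesis .
qed

text \<open>Sample and hash function are independent, so every pair contributes its inclusion
  probability times \<open>P u v\<close>. Diagonal pairs have inclusion probability
  \<open>m / card V\<close>, the others that of sampling without replacement.\<close>

lemma sampled_moments:
  fixes X :: "'v \<Rightarrow> 'h \<Rightarrow> bool" and H :: "'h set"
  assumes V: "finite V" and m: "1 \<le> m" "m \<le> card V"
  defines "W \<equiv> \<lambda>(S, h). real (card {v \<in> S. X v h})"
    and "P \<equiv> \<lambda>u v. avg H (\<lambda>h. of_bool (X u h \<and> X v h))"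
  shows "avg (samples V m \<times> H) W = real m / real (card V) * (\<Sum>v\<in>V. P v v)"
    and "avg (samples V m \<times> H) (\<lambda>x. (W x)\<^sup>2) = real m / real (card V) * (\<Sum>v\<in>V. P v v)
      + real m * (real m - 1) / (real (card V) * (real (card V) - 1)) * (\<Sum>u\<in>V. \<Sum>v\<in>V - {u}. P u v)"
proof -
  have W: "W (S, h) = (\<Sum>v\<in>V. of_bool (v \<in> S) * of_bool (X v h))" if "S \<in> samples V m" for S h
  proof -
    have "S \<subseteq> V" using that by (simp add: samples_def)
    then have "{v \<in> S. X v h} = V \<inter> {v. v \<in> S \<and> X v h}" by auto
    then show ?thesis using V by (simp add: W_def of_bool_conj[symmetric])
  qed
  have "avg (samples V m \<times> H) W = avg (samples V m \<times> H) (\<lambda>x. \<Sum>v\<in>V. of_bool (v \<in> fst x) * of_bool (X v (snd x)))"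
    by (rule avg_cong) (auto simp: W)
  also have "\<dots> = (\<Sum>v\<in>V. avg (samples V m) (\<lambda>S. of_bool (v \<in> S)) * P v v)"
    unfolding avg_sum P_def avg_Times_mult[symmetric] by simp
  also have "\<dots> = (\<Sum>v\<in>V. real m / real (card V) * P v v)"
    using assms by (intro sum.cong) (auto simp: avg_samples_mem)
  finally show "avg (samples V m \<times> H) W = real m / real (card V) * (\<Sum>v\<in>V. P v v)"
    by (simp add: sum_distrib_left)
  let ?\<kappa> = "real m * (real m - 1) / (real (card V) * (real (card V) - 1))"
  have "avg (samples V m \<times> H) (\<lambda>x. (W x)\<^sup>2)
      = avg (samples V m \<times> H) (\<lambda>x. \<Sum>u\<in>V. \<Sum>v\<in>V. of_bool (u \<in> fst x \<and> v \<in> fst x) * of_bool (X u (snd x) \<and> X v (snd x)))"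
    by (rule avg_cong) (auto simp: W power2_eq_square sum_product of_bool_conj mult_ac)
  also have "\<dots> = (\<Sum>u\<in>V. \<Sum>v\<in>V. avg (samples V m) (\<lambda>S. of_bool (u \<in> S \<and> v \<in> S)) * P u v)"
    unfolding avg_sum P_def avg_Times_mult[symmetric] by simp
  also have "\<dots> = (\<Sum>u\<in>V. real m / real (card V) * P u u + ?\<kappa> * (\<Sum>v\<in>V - {u}. P u v))"
  proof (rule sum.cong)
    fix u assume u: "u \<in> V"
    have "(\<Sum>v\<in>V. avg (samples V m) (\<lambda>S. of_bool (u \<in> S \<and> v \<in> S)) * P u v)
        = avg (samples V m) (\<lambda>S. of_bool (u \<in> S)) * P u u
        + (\<Sum>v\<in>V - {u}. avg (samples V m) (\<lambda>S. of_bool (u \<in> S \<and> v \<in> S)) * P u v)"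
      using V u by (subst sum.remove[of V u]) auto
    also have "(\<Sum>v\<in>V - {u}. avg (samples V m) (\<lambda>S. of_bool (u \<in> S \<and> v \<in> S)) * P u v) = (\<Sum>v\<in>V - {u}. ?\<kappa> * P u v)"
      using assms u by (intro sum.cong arg_cong2[where f = "(*)"] avg_samples_mem2) auto
    finally show "(\<Sum>v\<in>V. avg (samples V m) (\<lambda>S. of_bool (u \<in> S \<and> v \<in> S)) * P u v)
        = real m / real (card V) * P u u + ?\<kappa> * (\<Sum>v\<in>V - {u}. P u v)"
      using assms u by (simp add: avg_samples_mem sum_distrib_left)
  qed simp
  finally show "avg (samples V m \<times> H) (\<lambda>x. (W x)\<^sup>2) = real m / real (card V) * (\<Sum>v\<in>V. P v v)
      + ?\<kappa> * (\<Sum>u\<in>V. \<Sum>v\<in>V - {u}. P u v)"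
    by (simp add: sum.distrib sum_distrib_left)
qed

lemma pair_pmf_of_set:
  assumes "finite A" "A \<noteq> {}" "finite B" "B \<noteq> {}"
  shows "pair_pmf (pmf_of_set A) (pmf_of_set B) = pmf_of_set (A \<times> B)"
proof (rule pmf_eqI)
  fix x
  show "pmf (pair_pmf (pmf_of_set A) (pmf_of_set B)) x = pmf (pmf_of_set (A \<times> B)) x"
    using assms by (cases x) (auto simp: pmf_pair card_cartesian_product indicator_def)
qed

text \<open>Chebyshev's argument around an arbitrary \<open>a\<close> in place of the mean, so that
  bias and variance are handled together.\<close>

lemma second_moment_bound:
  assumes "finite A" "A \<noteq> {}" "0 < t"
    and "avg A (\<lambda>x. (f x - a)\<^sup>2) \<le> \<eta> * t\<^sup>2"
  shows "1 - \<eta> \<le> measure_pmf.prob (pmf_of_set A) {x. \<bar>f x - a\<bar> \<le> t}"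
proof -
  have "1 - \<eta> \<le> avg A (\<lambda>x. 1 - (f x - a)\<^sup>2 / t\<^sup>2)"
  proof -
    have "avg A (\<lambda>x. 1 - (f x - a)\<^sup>2 / t\<^sup>2) = avg A (\<lambda>x. 1 + (- 1 / t\<^sup>2) * (f x - a)\<^sup>2)" by simp
    also have "\<dots> = 1 + (- 1 / t\<^sup>2) * avg A (\<lambda>x. (f x - a)\<^sup>2)"
      using assms by (simp only: avg_add avg_cmult avg_const[OF assms(1,2)])
    finally have "avg A (\<lambda>x. 1 - (f x - a)\<^sup>2 / t\<^sup>2) = 1 - avg A (\<lambda>x. (f x - a)\<^sup>2) / t\<^sup>2" by simp
    moreover have "avg A (\<lambda>x. (f x - a)\<^sup>2) / t\<^sup>2 \<le> \<eta>" using assms by (simp add: divide_le_eq)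
    ultimately show ?thesis by linarith
  qed
  also have "\<dots> \<le> avg A (\<lambda>x. of_bool (\<bar>f x - a\<bar> \<le> t))"
  proof (rule avg_mono)
    fix x
    show "1 - (f x - a)\<^sup>2 / t\<^sup>2 \<le> of_bool (\<bar>f x - a\<bar> \<le> t)"
    proof (cases "\<bar>f x - a\<bar> \<le> t")
      case False
      then have "t\<^sup>2 \<le> \<bar>f x - a\<bar>\<^sup>2" using assms(3) by (intro power_mono) auto
      then show ?thesis using False assms(3) by (simp add: field_simps)
    qed simp
  qed
  also have "\<dots> = measure_pmf.prob (pmf_of_set A) {x. \<bar>f x - a\<bar> \<le> t}"
    using assms by (simp add: avg_of_bool measure_pmf_of_set Int_def)
  finally show ?thesis .
qed

section \<open>Counting memory contents\<close>

lemma ex_bit_encoding: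
  assumes "finite R" "card R \<le> 2 ^ b"
  shows "\<exists>enc :: 's \<Rightarrow> bool list. inj_on enc R \<and> (\<forall>s\<in>R. length (enc s) = b)"
proof -
  let ?L = "{xs :: bool list. set xs \<subseteq> UNIV \<and> length xs = b}"
  have "finite ?L" "card ?L = 2 ^ b"
    using card_lists_length_eq[of "UNIV :: bool set" b] finite_lists_length_eq[of "UNIV :: bool set" b]
    by simp_all
  then obtain enc where "enc ` R \<subseteq> ?L" "inj_on enc R" using card_le_inj[of R ?L] assms by auto
  then show ?thesis by blast
qed

text \<open>Sets are listed and padded with the dummy element 0 to length exactly
  \<open>m\<close>.\<close>

lemma card_small_subsets_le: "card {S. S \<subseteq> {1..n} \<and> card S \<le> m} \<le> (n + 1) ^ m"
proof -
  let ?L = "{xs. set xs \<subseteq> {0..n} \<and> length xs = m}"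
  have fin: "finite ?L" by (rule finite_lists_length_eq) simp
  have "{S. S \<subseteq> {1..n} \<and> card S \<le> m} \<subseteq> (\<lambda>xs. set xs - {0}) ` ?L"
  proof
    fix S assume "S \<in> {S. S \<subseteq> {1..n} \<and> card S \<le> m}"
    then have S: "S \<subseteq> {1..n}" "card S \<le> m" by auto
    then have "finite S" using finite_subset by blast
    let ?xs = "sorted_list_of_set S @ replicate (m - card S) 0"
    have "?xs \<in> ?L" using S \<open>finite S\<close> by auto
    moreover have "S = set ?xs - {0}" using S \<open>finite S\<close> by auto
    ultimately show "S \<in> (\<lambda>xs. set xs - {0}) ` ?L" by blast
  qed
  then have "card {S. S \<subseteq> {1..n} \<and> card S \<le> m} \<le> card ((\<lambda>xs. set xs - {0}) ` ?L)"
    using fin by (intro card_mono) auto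
  also have "\<dots> \<le> card ?L" by (rule card_image_le[OF fin])
  also have "\<dots> = (n + 1) ^ m" by (simp add: card_lists_length_eq)
  finally show ?thesis .
qed

section \<open>Neighbourhoods and the effect of the stream\<close>

definition nbrs :: "nat set set \<Rightarrow> nat \<Rightarrow> nat set" where
  "nbrs E v = {w. {v, w} \<in> E}"

lemma nbrs_sym: "w \<in> nbrs E v \<longleftrightarrow> v \<in> nbrs E w"
  by (simp add: nbrs_def insert_commute)

lemma
  assumes "simple_graph n E"
  shows nbrs_subset: "nbrs E v \<subseteq> {1..n}" and not_mem_nbrs: "v \<notin> nbrs E v"
    and degree_eq_card_nbrs: "degree E v = card (nbrs E v)"
proof -
  have E: "e \<subseteq> {1..n}" "card e = 2" if "e \<in> E" for e using that assms by (auto simp: simple_graph_def)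
  show "nbrs E v \<subseteq> {1..n}" using E(1) by (auto simp: nbrs_def)
  show "v \<notin> nbrs E v" using E(2)[of "{v}"] by (auto simp: nbrs_def)
  have "bij_betw (\<lambda>w. {v, w}) (nbrs E v) {e \<in> E. v \<in> e}"
  proof (rule bij_betw_imageI)
    show "inj_on (\<lambda>w. {v, w}) (nbrs E v)" by (auto simp: inj_on_def doubleton_eq_iff)
    show "(\<lambda>w. {v, w}) ` nbrs E v = {e \<in> E. v \<in> e}"
    proof (intro equalityI subsetI)
      fix e assume e: "e \<in> {e \<in> E. v \<in> e}"
      then obtain x y where "e = {x, y}" using E(2)[of e] by (auto simp: card_2_iff)
      with e have "e = {v, if x = v then y else x}" by auto
      with e show "e \<in> (\<lambda>w. {v, w}) ` nbrs E v" by (force simp: nbrs_def)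
    qed (auto simp: nbrs_def)
  qed
  then show "degree E v = card (nbrs E v)"
    unfolding degree_def by (rule bij_betw_same_card[symmetric])
qed

text \<open>Whether an edge removes a vertex depends on \<open>h\<close> alone and not on the rest
  of \<open>S\<close>, so the order of the edges is immaterial. Arbitrary streams are covered, as
  the space bound requires.\<close>

lemma fold_cwei_step:
  "fold cwei_step es (S, h)
    = ({x \<in> S. \<forall>(u, v)\<in>set es. (x = u \<longrightarrow> h u < h v) \<and> (x = v \<longrightarrow> h v < h u)}, h)"
proof (induction es arbitrary: S)
  case (Cons e es)
  obtain u v where e: "e = (u, v)" by (cases e)
  have "cwei_step e (S, h) = ({x \<in> S. (x = u \<longrightarrow> h u < h v) \<and> (x = v \<longrightarrow> h v < h u)}, h)"
    by (auto simp: cwei_step_def e Let_def not_le)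
  then show ?case using Cons by (auto simp: e)
qed simp

lemma fold_cwei_step_nbrs:
  assumes "edge_stream_of es E"
  shows "fold cwei_step es (S, h) = ({x \<in> S. \<forall>w\<in>nbrs E x. h x < h w}, h)"
proof -
  have E: "E = (\<lambda>(u, v). {u, v}) ` set es" using assms by (simp add: edge_stream_of_def)
  have "(\<forall>(u, v)\<in>set es. (x = u \<longrightarrow> h u < h v) \<and> (x = v \<longrightarrow> h v < h u)) \<longleftrightarrow> (\<forall>w\<in>nbrs E x. h x < h w)" for x
  proof
    assume *: "\<forall>(u, v)\<in>set es. (x = u \<longrightarrow> h u < h v) \<and> (x = v \<longrightarrow> h v < h u)"
    show "\<forall>w\<in>nbrs E x. h x < h w"
    proof
      fix w assume "w \<in> nbrs E x"
      then obtain u v where "(u, v) \<in> set es" "{x, w} = {u, v}" by (auto simp: nbrs_def E)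
      then show "h x < h w" using * by (fastforce simp: doubleton_eq_iff)
    qed
  next
    assume *: "\<forall>w\<in>nbrs E x. h x < h w"
    show "\<forall>(u, v)\<in>set es. (x = u \<longrightarrow> h u < h v) \<and> (x = v \<longrightarrow> h v < h u)"
    proof (clarify)
      fix u v assume "(u, v) \<in> set es"
      then have "{u, v} \<in> E" unfolding E by force
      then have "v \<in> nbrs E u" "u \<in> nbrs E v" by (simp_all add: nbrs_def insert_commute)
      then show "(x = u \<longrightarrow> h u < h v) \<and> (x = v \<longrightarrow> h v < h u)" using * by auto
    qed
  qed
  then show ?thesis unfolding fold_cwei_step by simp
qed

section \<open>The mean square error\<close>

text \<open>Here \<open>e = \<epsilon>\<^sup>2\<close> and \<open>y = 1 / D\<close>, where \<open>D\<close> is the average degree plus 1. The sampling variance and the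
  rounding of the sample size together cost \<open>1/4 - 3y/16\<close> in units of \<open>T = (\<epsilon> \<lambda>)\<^sup>2\<close>. The term \<open>3y/16\<close>
  pays for the loss \<open>(\<Delta> + 1) / n\<^sup>3\<close> caused by ties among hash values, which is not negligible for
  small \<open>n\<close>. Common neighbours cost \<open>1/24\<close>.\<close>

lemma mean_square_error_numeric:
  fixes n D e lam \<Delta> \<delta> m p EY Off :: real
  assumes n: "4 \<le> n" and D: "1 \<le> D" and e2: "0 < e" "e \<le> 1"
    and lam: "n / D \<le> lam" "lam \<le> n"
    and \<Delta>: "1 \<le> \<Delta>" "\<Delta> \<le> e * n / (3 * D ^ 3)"
    and p: "p = min 1 (4 * D / (e * n))" and m: "p * n \<le> m" "m \<le> p * n + 1" "m \<le> n" "1 \<le> m"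
    and \<delta>: "0 \<le> \<delta>" "\<delta> \<le> e / 1000"
    and EY: "EY \<le> (1 + \<delta>) * lam" "(1 - \<delta> - (\<Delta> + 1) / n ^ 3) * lam \<le> EY"
    and Off: "Off \<le> (1 + \<delta>) * (lam\<^sup>2 - lam\<^sup>2 / n) + n * \<Delta> * (D - 1) / 8"
  shows "(m / n * EY + m * (m - 1) / (n * (n - 1)) * Off) / p\<^sup>2 - 2 * lam * (m / n * EY / p) + lam\<^sup>2
    \<le> 1 / 3 * (e * lam\<^sup>2)"
proof -
  define y where "y = 1 / D"
  have y: "0 < y" "y \<le> 1" "y * D = 1" using D by (auto simp: y_def)
  have p0: "0 < p" "p \<le> 1" using p D n e2 by auto
  \<comment> \<open>\<open>r\<close> is the inclusion probability divided by the nominal rate; it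
    exceeds 1 only by the rounding of the sample size.\<close>
  define P r where "P = 1 / p" and "r = m / (n * p)"
  have P0: "0 < P" using p0 by (simp add: P_def)
  have r1: "1 \<le> r" using m(1) p0 n by (simp add: r_def field_simps)
  have ny: "n * y \<le> lam" using lam by (simp add: y_def)
  have lam0: "0 < lam" using ny n y by (meson less_le_trans mult_pos_pos zero_less_numeral)
  have \<Delta>y: "\<Delta> \<le> e * n * y ^ 3 / 3" using \<Delta>(2) by (simp add: y_def power_divide)
  have y3: "y ^ 3 \<le> y\<^sup>2" "y\<^sup>2 \<le> y" "y ^ 3 \<le> y"
    using y power_decreasing[of 2 3 y] power_decreasing[of 1 2 y] power_decreasing[of 1 3 y] by auto
  \<comment> \<open>Since \<open>\<Delta> \<ge> 1\<close>, the degree hypothesis makes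
    \<open>n\<close> large. Its form \<open>elam\<close> below lets terms linear in
    \<open>lam\<close> be charged to \<open>e * lam\<^sup>2\<close>.\<close>
  have eny3: "3 \<le> e * n * y ^ 3" using \<Delta>y \<Delta>(1) by linarith
  have "e * n * y ^ 3 = (e * (n * y)) * y\<^sup>2" by (simp add: power2_eq_square power3_eq_cube)
  also have "\<dots> \<le> (e * lam) * y\<^sup>2" using ny e2 by (intro mult_right_mono mult_left_mono) auto
  finally have elam: "3 \<le> e * lam * y\<^sup>2" using eny3 by linarith
  \<comment> \<open>Either the rate is capped, so that all vertices are sampled and nothing is
    rounded, or it is \<open>4 * D / (e * n)\<close>.\<close>
  have pcase: "p = 1 \<and> P = 1 \<and> r = 1 \<or> P = e * n * y / 4 \<and> r \<le> 1 + e * y / 4"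
  proof (cases "1 \<le> 4 * D / (e * n)")
    case True
    then have "p = 1" using p by simp
    then show ?thesis using m n by (simp add: P_def r_def)
  next
    case False
    then have pe: "p = 4 * D / (e * n)" using p by simp
    then have "P = e * n * y / 4" by (simp add: P_def y_def)
    moreover have "r \<le> (p * n + 1) / (n * p)" unfolding r_def using m p0 n by (intro divide_right_mono) auto
    moreover have "(p * n + 1) / (n * p) = 1 + e * y / 4"
    proof -
      have "(p * n + 1) / (n * p) = 1 + 1 / (p * n)" using p0 n by (simp add: field_simps)
      moreover have "p * n = 4 * D / e" using pe n by simp
      ultimately show ?thesis by (simp add: y_def)
    qed
    ultimately show ?thesis by simp
  qed
  have r2: "r \<le> 1 + e * y / 4" using pcase mult_nonneg_nonneg[of e y] e2 y by linarith
  have ey: "e * y \<le> y" using mult_right_mono[OF e2(2), of y] y by simp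
  then have r3: "r \<le> 1 + y / 4" and r4: "r \<le> 5 / 4" using r2 y by linarith+
  have rr: "r\<^sup>2 \<le> (1 + y / 4)\<^sup>2" using r3 r1 by (intro power_mono) auto
  have rr2: "r\<^sup>2 \<le> 25 / 16" using power_mono[OF r4, of 2] r1 by (simp add: power2_eq_square)
  have Plam: "P \<le> e * lam / 3"
    using pcase
  proof
    assume "p = 1 \<and> P = 1 \<and> r = 1"
    moreover have "e * lam * y\<^sup>2 \<le> e * lam * 1"
      using y3 y lam0 e2 by (intro mult_left_mono) auto
    ultimately show ?thesis using elam by simp
  next
    assume "P = e * n * y / 4 \<and> r \<le> 1 + e * y / 4"
    moreover have "e * (n * y) \<le> e * lam" using ny e2 by (intro mult_left_mono) auto
    moreover have "0 < e * lam" using e2 lam0 by simp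
    ultimately show ?thesis by (simp add: mult.assoc)
  qed
  define \<eta> where "\<eta> = (\<Delta> + 1) / n ^ 3"
  define C where "C = n * \<Delta> * (D - 1) / 8"
  define T where "T = e * lam\<^sup>2"
  have T0: "0 < T" using e2 lam0 by (simp add: T_def)
  have C0: "0 \<le> C" using n \<Delta> D by (simp add: C_def)

  \<comment> \<open>The first term is the squared rounding bias, the second the variance apart from
    common neighbours and hashing errors.\<close>
  have main: "(r - 1)\<^sup>2 * lam\<^sup>2 + r * P * lam * (1 - lam / n) \<le> (1 / 4 - 3 * y / 16) * T"
    using pcase
  proof
    assume *: "p = 1 \<and> P = 1 \<and> r = 1"
    have "lam * (1 - lam / n) \<le> lam * (1 - y)"
      using ny n lam0 by (intro mult_left_mono) (auto simp: field_simps)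
    also have "\<dots> \<le> lam * (1 - y) * (e * lam * y\<^sup>2 / 3)"
      using elam lam0 y mult_left_mono[of 1 "e * lam * y\<^sup>2 / 3" "lam * (1 - y)"] by simp
    also have "\<dots> = ((1 - y) * y\<^sup>2 / 3) * T" by (simp add: T_def power2_eq_square)
    also have "\<dots> \<le> (1 / 4 - 3 * y / 16) * T"
    proof (rule mult_right_mono)
      have "(1 - y) * y\<^sup>2 \<le> (1 - y) * y" using y y3 by (intro mult_left_mono) auto
      also have "(1 - y) * y = y - y\<^sup>2" by (simp add: power2_eq_square algebra_simps)
      finally have "(1 - y) * y\<^sup>2 \<le> y - y\<^sup>2" .
      \<comment> \<open>The claim reduces to \<open>y\<^sup>2 - 25 / 16 * y + 3 / 4 \<ge> 0\<close>,
        and completing the square leaves 625/1024 < 3/4.\<close>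
      moreover have "0 \<le> (y - 25 / 32)\<^sup>2" by simp
      moreover have "(y - 25 / 32)\<^sup>2 = y\<^sup>2 - 25 / 16 * y + 625 / 1024"
        by (simp add: power2_eq_square algebra_simps)
      ultimately show "(1 - y) * y\<^sup>2 / 3 \<le> 1 / 4 - 3 * y / 16" by linarith
    qed (use T0 in simp)
    finally show ?thesis using * by simp
  next
    assume *: "P = e * n * y / 4 \<and> r \<le> 1 + e * y / 4"
    have "r - 1 \<le> e * y / 4" using r2 by simp
    then have "(r - 1)\<^sup>2 \<le> (e * y / 4)\<^sup>2" using r1 by (intro power_mono) auto
    also have "\<dots> = e * (e * (y\<^sup>2 / 16))" by (simp add: power2_eq_square)
    also have "\<dots> \<le> 1 * (e * (y\<^sup>2 / 16))" using e2 by (intro mult_right_mono) auto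
    finally have "(r - 1)\<^sup>2 * lam\<^sup>2 \<le> e * (y\<^sup>2 / 16) * lam\<^sup>2" by (intro mult_right_mono) auto
    then have a: "(r - 1)\<^sup>2 * lam\<^sup>2 \<le> (y\<^sup>2 / 16) * T" by (simp add: T_def mult_ac)
    have "y * (n * lam - lam\<^sup>2) \<le> (1 - y) * lam\<^sup>2"
      using mult_right_mono[OF ny, of lam] lam0 by (simp add: power2_eq_square algebra_simps)
    then have "r * e / 4 * (y * (n * lam - lam\<^sup>2)) \<le> r * e / 4 * ((1 - y) * lam\<^sup>2)"
      using r1 e2 by (intro mult_left_mono) auto
    moreover have "r * P * lam * (1 - lam / n) = r * e / 4 * (y * (n * lam - lam\<^sup>2))"
    proof -
      have nl: "n * (1 - lam / n) = n - lam" using n by (simp add: field_simps)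
      have P: "P = e * n * y / 4" using * by blast
      have "r * P * lam * (1 - lam / n) = r * e / 4 * (y * (lam * (n * (1 - lam / n))))"
        by (simp only: P times_divide_eq_left times_divide_eq_right mult_ac)
      then show ?thesis unfolding nl by (simp add: power2_eq_square algebra_simps)
    qed
    moreover have "r * e / 4 * ((1 - y) * lam\<^sup>2) = r * ((1 - y) / 4 * T)" by (simp add: T_def)
    ultimately have "r * P * lam * (1 - lam / n) \<le> r * ((1 - y) / 4 * T)" by linarith
    also have "\<dots> \<le> (1 + y / 4) * ((1 - y) / 4 * T)"
      using r3 y T0 by (intro mult_right_mono) auto
    finally have "(r - 1)\<^sup>2 * lam\<^sup>2 + r * P * lam * (1 - lam / n)
        \<le> (y\<^sup>2 / 16) * T + (1 + y / 4) * ((1 - y) / 4 * T)" using a by linarith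
    \<comment> \<open>The terms \<open>y\<^sup>2 / 16\<close> cancel exactly.\<close>
    also have "\<dots> = (1 / 4 - 3 * y / 16) * T" by (simp add: power2_eq_square field_simps)
    finally show ?thesis .
  qed

  \<comment> \<open>\<open>y * D = 1\<close> turns the factor \<open>D - 1\<close> into
    \<open>1 - y\<close>, which pays for the rounding factor
    \<open>(1 + y / 4)\<^sup>2\<close>.\<close>
  have covar: "r\<^sup>2 * C \<le> 1 / 24 * T"
  proof -
    have "C \<le> n * (e * n * y ^ 3 / 3) * (D - 1) / 8"
      unfolding C_def using \<Delta>y n D by (intro divide_right_mono mult_right_mono mult_left_mono) auto
    also have "\<dots> = e * (n * y)\<^sup>2 * (y * D - y) / 24"
      by (simp add: power2_eq_square power3_eq_cube algebra_simps)
    also have "\<dots> \<le> e * lam\<^sup>2 * (1 - y) / 24"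
      unfolding y(3) using ny n y e2 by (intro divide_right_mono mult_right_mono mult_left_mono power_mono) auto
    finally have "C \<le> (1 - y) / 24 * T" by (simp add: T_def mult_ac)
    then have "r\<^sup>2 * C \<le> (1 + y / 4)\<^sup>2 * ((1 - y) / 24 * T)"
      using rr y C0 T0 by (intro mult_mono) auto
    also have "\<dots> = ((1 + y / 4)\<^sup>2 * (1 - y)) * (T / 24)" by simp
    also have "\<dots> \<le> 1 * (T / 24)"
    proof (rule mult_right_mono)
      have "(1 + y / 4)\<^sup>2 * (1 - y) = 1 - y / 2 - 7 / 16 * y\<^sup>2 - y ^ 3 / 16"
        by (simp add: power2_eq_square power3_eq_cube field_simps)
      moreover have "0 \<le> y\<^sup>2" "0 \<le> y ^ 3" using y by auto
      ultimately show "(1 + y / 4)\<^sup>2 * (1 - y) \<le> 1" using y by linarith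
    qed (use T0 in simp)
    finally show ?thesis by simp
  qed

  have tie: "2 * r * \<eta> * lam\<^sup>2 \<le> 3 * y / 16 * T"
  proof -
    have "\<eta> \<le> 2 * \<Delta> / n ^ 3" unfolding \<eta>_def using \<Delta> n by (intro divide_right_mono) auto
    also have "\<dots> \<le> 2 * (e * n * y ^ 3 / 3) / n ^ 3"
      using \<Delta>y n by (intro divide_right_mono mult_left_mono) auto
    also have "\<dots> = 2 / 3 * (e * y ^ 3) / n\<^sup>2" using n by (simp add: power2_eq_square power3_eq_cube)
    also have "\<dots> \<le> 2 / 3 * (e * y ^ 3) / 16"
      using power_mono[OF n, of 2] y e2 by (intro divide_left_mono) auto
    also have "\<dots> \<le> 2 / 3 * (e * y) / 16"
      using y3 e2 by (intro divide_right_mono mult_left_mono) auto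
    finally have h: "\<eta> \<le> 1 / 24 * (e * y)" by simp
    have "r * \<eta> \<le> 5 / 4 * (1 / 24 * (e * y))"
      using r4 h r1 \<Delta> n by (intro mult_mono) (auto simp: \<eta>_def)
    also have "\<dots> \<le> 3 * y / 32 * e" using y e2 by simp
    finally have "2 * (r * \<eta>) * lam\<^sup>2 \<le> 2 * (3 * y / 32 * e) * lam\<^sup>2"
      by (intro mult_right_mono mult_left_mono) auto
    then show ?thesis by (simp add: T_def mult_ac)
  qed

  have "r * P * lam \<le> 5 / 4 * (e * lam / 3) * lam"
    using r4 Plam r1 P0 lam0 by (intro mult_mono) auto
  also have "\<dots> = 5 / 12 * T" by (simp add: T_def power2_eq_square)
  finally have rPl: "r * P * lam \<le> 5 / 12 * T" .
  have "\<delta> * (r * P * lam) \<le> (1 / 1000) * (5 / 12 * T)"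
    by (rule mult_mono) (use rPl \<delta> e2 r1 P0 lam0 T0 in auto)
  then have d1: "\<delta> * (r * P * lam) \<le> 1 / 2000 * T" using T0 by simp
  have d2: "\<delta> * (r\<^sup>2 * lam\<^sup>2) \<le> 1 / 600 * T"
  proof -
    have "\<delta> * (r\<^sup>2 * lam\<^sup>2) \<le> (e / 1000) * (25 / 16 * lam\<^sup>2)"
      using \<delta> rr2 by (intro mult_mono mult_right_mono) auto
    also have "\<dots> \<le> 1 / 600 * T" using T0 by (simp add: T_def)
    finally show ?thesis .
  qed
  have d3: "2 * r * \<delta> * lam\<^sup>2 \<le> 1 / 400 * T"
  proof -
    have "r * \<delta> \<le> 5 / 4 * (e / 1000)" using r4 \<delta> r1 by (intro mult_mono) auto
    then have "2 * (r * \<delta>) * lam\<^sup>2 \<le> 2 * (5 / 4 * (e / 1000)) * lam\<^sup>2"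
      by (intro mult_right_mono mult_left_mono) auto
    then show ?thesis by (simp add: T_def mult_ac)
  qed

  define \<kappa> where "\<kappa> = m * (m - 1) / (n * (n - 1)) / p\<^sup>2"
  have \<kappa>0: "0 \<le> \<kappa>" using m n by (simp add: \<kappa>_def)
  \<comment> \<open>The factor \<open>1 - 1 / n\<close> supplied by the bound on \<open>Off\<close>
    cancels \<open>n - 1\<close>, so the negative correlation of sampling without replacement is
    kept exactly.\<close>
  have \<kappa>1: "\<kappa> * (1 - 1 / n) = r\<^sup>2 - r * P / n"
  proof -
    have "\<kappa> * (1 - 1 / n) = m * (m - 1) / (n * n) / p\<^sup>2"
    proof -
      have "1 - 1 / n = (n - 1) / n" using n by (simp add: field_simps)
      then show ?thesis using n by (simp add: \<kappa>_def)
    qed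
    also have "\<dots> = r\<^sup>2 - r * P / n" using n p0 by (simp add: r_def P_def power2_eq_square field_simps)
    finally show ?thesis .
  qed
  have \<kappa>2: "\<kappa> \<le> r\<^sup>2"
  proof -
    have "(m - 1) / (n - 1) \<le> m / n" using m n by (simp add: field_simps)
    then have "(m / n) * ((m - 1) / (n - 1)) / p\<^sup>2 \<le> (m / n) * (m / n) / p\<^sup>2"
      using m n by (intro divide_right_mono mult_left_mono) auto
    then show ?thesis by (simp add: \<kappa>_def r_def power2_eq_square mult_ac)
  qed
  have "\<kappa> * Off \<le> \<kappa> * ((1 + \<delta>) * (lam\<^sup>2 - lam\<^sup>2 / n) + C)"
    using Off \<kappa>0 unfolding C_def by (rule mult_left_mono)
  also have "\<dots> = (1 + \<delta>) * (\<kappa> * (1 - 1 / n)) * lam\<^sup>2 + \<kappa> * C" by (simp add: algebra_simps)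
  also have "\<dots> \<le> (1 + \<delta>) * (r\<^sup>2 - r * P / n) * lam\<^sup>2 + r\<^sup>2 * C"
    unfolding \<kappa>1 using \<kappa>2 C0 by (intro add_left_mono mult_right_mono) auto
  finally have K: "\<kappa> * Off \<le> (1 + \<delta>) * (r\<^sup>2 - r * P / n) * lam\<^sup>2 + r\<^sup>2 * C" .
  have "(m / n * EY + m * (m - 1) / (n * (n - 1)) * Off) / p\<^sup>2 - 2 * lam * (m / n * EY / p) + lam\<^sup>2
      = r * P * EY + \<kappa> * Off - 2 * lam * r * EY + lam\<^sup>2"
  proof -
    have "m / n * EY / p\<^sup>2 = r * P * EY" "m / n * EY / p = r * EY"
      using p0 n by (simp_all add: r_def P_def power2_eq_square)
    then show ?thesis by (simp add: add_divide_distrib \<kappa>_def)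
  qed
  also have "\<dots> \<le> r * P * ((1 + \<delta>) * lam) + ((1 + \<delta>) * (r\<^sup>2 - r * P / n) * lam\<^sup>2 + r\<^sup>2 * C)
      - 2 * lam * r * ((1 - \<delta> - \<eta>) * lam) + lam\<^sup>2"
    using EY K r1 P0 lam0 unfolding \<eta>_def
    by (intro add_mono diff_mono mult_left_mono order_refl) auto
  also have "\<dots> = ((r - 1)\<^sup>2 * lam\<^sup>2 + r * P * lam * (1 - lam / n)) + r\<^sup>2 * C + \<delta> * (r * P * lam)
      + \<delta> * (r\<^sup>2 * lam\<^sup>2) + 2 * r * \<delta> * lam\<^sup>2 + 2 * r * \<eta> * lam\<^sup>2 - \<delta> * (r * P / n * lam\<^sup>2)"
    by (simp add: power2_eq_square algebra_simps add_divide_distrib)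
  \<comment> \<open>The terms \<open>3 * y / 16\<close> cancel, and the remaining constants add up
    to less than 0.297.\<close>
  also have "\<dots> \<le> (1 / 4 - 3 * y / 16) * T + 1 / 24 * T + 1 / 2000 * T + 1 / 600 * T + 1 / 400 * T + 3 * y / 16 * T - 0"
    using \<delta> r1 P0 n by (intro add_mono diff_mono main covar d1 d2 d3 tie mult_nonneg_nonneg divide_nonneg_nonneg) auto
  also have "\<dots> \<le> 1 / 3 * T" using T0 by (simp add: algebra_simps)
  finally show ?thesis by (simp add: T_def)
qed

section \<open>Size of the hashing error\<close>

lemma square_le_power2: "100 \<le> l \<Longrightarrow> 6800000 * l\<^sup>2 \<le> (2::nat) ^ l"
proof (induction l rule: nat_induct_at_least)
  case (Suc l)
  have "2 * l + 1 \<le> l * l" using mult_right_mono[OF Suc.hyps, of l] Suc.hyps by linarith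
  then have "(Suc l)\<^sup>2 \<le> 2 * l\<^sup>2" by (simp add: power2_eq_square)
  then show ?case using Suc.IH by simp
qed simp

text \<open>Of the \<open>2 * l\<close> factors 1/2, one half beats the polynomial by
  \<open>square_le_power2\<close>, where 6800000 = 1700 * 4 * 1000. The other half is at most
  \<open>eps\<^sup>2\<close>, because \<open>(1 / eps) ^ 4 = exp (4 * ln (1 / eps))\<close> is at
  most \<open>exp l \<le> 4 ^ l\<close>.\<close>

lemma hash_error_le:
  assumes "0 < eps" "eps < 1" and l: "100 * (1 + ln (1 / eps)) \<le> real l"
  shows "hash_error (2 * l) \<le> eps\<^sup>2 / 1000"
proof -
  have ln: "0 \<le> ln (1 / eps)" using assms by simp
  then have "100 \<le> real l" using l by argo
  then have "6800000 * l\<^sup>2 \<le> 2 ^ l" by (intro square_le_power2) linarith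
  then have "real (6800000 * l\<^sup>2) \<le> real (2 ^ l)" by (rule of_nat_mono)
  then have a: "6800000 * (real l)\<^sup>2 * (1 / 2) ^ l \<le> 1" by (simp add: power_divide field_simps)
  have "(1 / eps\<^sup>2)\<^sup>2 = exp (4 * ln (1 / eps))"
  proof -
    have "exp (4 * ln (1 / eps)) = exp (ln (1 / eps)) ^ 4" using exp_of_nat_mult[of 4 "ln (1 / eps)"] by simp
    also have "\<dots> = (1 / eps) ^ 4" using assms by simp
    finally show ?thesis by (simp add: power_divide flip: power_mult)
  qed
  also have "\<dots> \<le> exp (real l)" using l ln by (simp only: exp_le_cancel_iff) argo
  also have "\<dots> = exp 1 ^ l" using exp_of_nat_mult[of l 1] by simp
  also have "\<dots> \<le> 4 ^ l" using exp_le by (intro power_mono) auto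
  also have "(4 :: real) ^ l = (2 ^ l)\<^sup>2"
    by (simp add: power2_eq_square flip: power_mult_distrib)
  finally have "1 / eps\<^sup>2 \<le> 2 ^ l" by (rule power2_le_imp_le) simp
  then have b: "(1 / 2) ^ l \<le> eps\<^sup>2" using assms by (simp add: power_divide field_simps)
  have "hash_error (2 * l) = 6800000 * (real l)\<^sup>2 * (1 / 2) ^ l * ((1 / 2) ^ l / 1000)"
  proof -
    have "(1 / 2 :: real) ^ (2 * l) = (1 / 2) ^ l * (1 / 2) ^ l" by (simp only: mult_2 power_add)
    then show ?thesis by (simp add: hash_error_def power_mult_distrib del: power_mult)
  qed
  also have "\<dots> \<le> 1 * (eps\<^sup>2 / 1000)" using a b by (intro mult_mono) auto
  finally show ?thesis by simp
qed

text \<open>Jensen's inequality for \<open>1 / x\<close>, by the tangent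
  \<open>2 / D - x / D\<^sup>2\<close> at the mean \<open>D\<close>.\<close>

lemma caro_wei_ge:
  assumes "1 \<le> n"
  shows "real n / (avg_degree n E + 1) \<le> caro_wei n E"
proof -
  define D where "D = avg_degree n E + 1"
  have sum: "(\<Sum>v\<in>{1..n}. real (degree E v)) = real n * (D - 1)"
    using assms by (simp add: D_def avg_degree_def)
  have D: "1 \<le> D" by (simp add: D_def avg_degree_def sum_nonneg)
  have "real n / D = 2 * real n / D - (real n * (D - 1) + real n) / D\<^sup>2"
    using D by (simp add: power2_eq_square field_simps)
  also have "\<dots> = (\<Sum>v\<in>{1..n}. 2 / D - (real (degree E v) + 1) / D\<^sup>2)"
    unfolding sum[symmetric] by (simp add: sum_subtractf sum.distrib add_divide_distrib sum_divide_distrib)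
  also have "\<dots> \<le> caro_wei n E"
    unfolding caro_wei_def
  proof (rule sum_mono)
    fix v
    have tangent: "2 / D - x / D\<^sup>2 \<le> 1 / x" if "0 < x" for x
    proof -
      have "1 / x - (2 / D - x / D\<^sup>2) = (D - x)\<^sup>2 / (x * D\<^sup>2)"
        using that D by (simp add: power2_eq_square field_simps)
      also have "\<dots> \<ge> 0" using that by simp
      finally show ?thesis by simp
    qed
    show "2 / D - (real (degree E v) + 1) / D\<^sup>2 \<le> 1 / (real (degree E v) + 1)"
      by (rule tangent) simp
  qed
  finally show ?thesis by (simp add: D_def)
qed

text \<open>Counts walks of length two by their middle vertex \<open>w\<close>, which gives the sum
  of the squared degrees.\<close>

lemma sum_common_nbrs_le:
  assumes "simple_graph n E"
  shows "(\<Sum>u\<in>{1..n}. \<Sum>v\<in>{1..n}. real (card (nbrs E u \<inter> nbrs E v))) \<le> real (max_degree n E) * (\<Sum>v\<in>{1..n}. real (degree E v))"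
proof -
  have sub: "nbrs E v \<subseteq> {1..n}" for v using assms by (rule nbrs_subset)
  have card: "real (card (nbrs E u \<inter> nbrs E v)) = (\<Sum>w\<in>{1..n}. of_bool (w \<in> nbrs E u) * of_bool (w \<in> nbrs E v))" for u v
  proof -
    have "nbrs E u \<inter> nbrs E v = {1..n} \<inter> {w. w \<in> nbrs E u \<and> w \<in> nbrs E v}" using sub by auto
    then show ?thesis by (simp add: of_bool_conj[symmetric])
  qed
  have deg: "(\<Sum>u\<in>{1..n}. of_bool (w \<in> nbrs E u)) = real (degree E w)" for w
  proof -
    have "nbrs E w = {1..n} \<inter> {u. w \<in> nbrs E u}" using sub[of w] nbrs_sym by blast
    then show ?thesis by (simp add: degree_eq_card_nbrs[OF assms])
  qed
  have "(\<Sum>u\<in>{1..n}. \<Sum>v\<in>{1..n}. real (card (nbrs E u \<inter> nbrs E v)))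
      = (\<Sum>u\<in>{1..n}. \<Sum>w\<in>{1..n}. \<Sum>v\<in>{1..n}. of_bool (w \<in> nbrs E u) * of_bool (w \<in> nbrs E v))"
    unfolding card by (intro sum.cong refl sum.swap)
  also have "\<dots> = (\<Sum>w\<in>{1..n}. \<Sum>u\<in>{1..n}. \<Sum>v\<in>{1..n}. of_bool (w \<in> nbrs E u) * of_bool (w \<in> nbrs E v))"
    by (rule sum.swap)
  also have "\<dots> = (\<Sum>w\<in>{1..n}. real (degree E w) * real (degree E w))"
    unfolding sum_product[symmetric] deg ..
  also have "\<dots> \<le> (\<Sum>w\<in>{1..n}. real (max_degree n E) * real (degree E w))"
    by (intro sum_mono mult_right_mono) (auto simp: max_degree_def)
  finally show ?thesis by (simp add: sum_distrib_left)
qed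

section \<open>The algorithm CWEI\<close>

lemma cwei_sample_size_bounds:
  assumes "1 \<le> n" "0 \<le> dbar" "0 < eps"
  shows "0 < cwei_rate n dbar eps" "cwei_rate n dbar eps \<le> 1"
    "cwei_rate n dbar eps * real n \<le> real (cwei_sample_size n dbar eps)"
    "real (cwei_sample_size n dbar eps) \<le> cwei_rate n dbar eps * real n + 1"
    "1 \<le> cwei_sample_size n dbar eps" "cwei_sample_size n dbar eps \<le> n"
proof -
  let ?p = "cwei_rate n dbar eps"
  show p: "0 < ?p" "?p \<le> 1" using assms by (auto simp: cwei_rate_def)
  have pn: "0 < ?p * real n" using p(1) assms(1) by (intro mult_pos_pos) auto
  have c: "real (cwei_sample_size n dbar eps) = real_of_int \<lceil>?p * real n\<rceil>"
    using pn by (simp add: cwei_sample_size_def)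
  show "?p * real n \<le> real (cwei_sample_size n dbar eps)" "real (cwei_sample_size n dbar eps) \<le> ?p * real n + 1"
    unfolding c by linarith+
  then show "1 \<le> cwei_sample_size n dbar eps" using pn by (simp add: Suc_le_eq)
  have "?p * real n \<le> real_of_int (int n)" using p by (simp add: mult_left_le_one_le)
  then have "\<lceil>?p * real n\<rceil> \<le> int n" by (rule ceiling_le)
  then show "cwei_sample_size n dbar eps \<le> n" by (simp only: cwei_sample_size_def nat_le_iff)
qed

lemma cwei_mean_square_error:
  assumes n: "1 \<le> n" and eps: "0 < eps" "eps < 1" and E: "simple_graph n E"
    and \<Delta>: "real (max_degree n E) \<le> eps\<^sup>2 * real n / (3 * (avg_degree n E + 1) ^ 3)"
    and H: "hash_family n H" "k_wise_independent (nat \<lceil>20200 * (1 + ln (1 / eps))\<rceil>) n H"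
  shows "avg (samples {1..n} (cwei_sample_size n (avg_degree n E) eps) \<times> H)
      (\<lambda>(S, h). (real (card {v \<in> S. \<forall>w\<in>nbrs E v. h v < h w}) / cwei_rate n (avg_degree n E) eps - caro_wei n E)\<^sup>2)
    \<le> 1 / 3 * (eps * caro_wei n E)\<^sup>2"
proof -
  define m where "m = cwei_sample_size n (avg_degree n E) eps"
  define p where "p = cwei_rate n (avg_degree n E) eps"
  define lam where "lam = caro_wei n E"
  define D where "D = avg_degree n E + 1"
  define S where "S = samples {1..n} m"
  define W where "W = (\<lambda>(S, h :: nat \<Rightarrow> nat). real (card {v \<in> S. \<forall>w\<in>nbrs E v. h v < h w}))"
  define \<Delta> where "\<Delta> = max_degree n E"
  have D: "1 \<le> D" by (simp add: D_def avg_degree_def sum_nonneg)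
  have m: "1 \<le> m" "m \<le> n" and p: "0 < p" "p \<le> 1" and pm: "p * real n \<le> real m" "real m \<le> p * real n + 1"
    using cwei_sample_size_bounds[of n "avg_degree n E" eps] n eps D unfolding m_def p_def D_def by auto
  have e2: "0 < eps\<^sup>2" "eps\<^sup>2 \<le> 1" using eps by (auto simp: power_le_one)
  have p_eq: "p = min 1 (4 * D / (eps\<^sup>2 * real n))" by (simp add: p_def cwei_rate_def D_def)
  have finH: "finite H" and neH: "H \<noteq> {}"
  proof -
    have "H \<subseteq> {1..n} \<rightarrow>\<^sub>E {1..n ^ 3}" using H by (auto simp: hash_family_def)
    then show "finite H" by (rule finite_subset) (intro finite_PiE; simp)
    show "H \<noteq> {}" using H by (auto simp: hash_family_def)
  qed
  have finS: "finite S" and neS: "S \<noteq> {}"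
    using m by (auto simp: S_def finite_samples samples_nonempty)
  have deg_le: "degree E v \<le> \<Delta>" if "v \<in> {1..n}" for v using that by (simp add: \<Delta>_def max_degree_def)
  have "avg (S \<times> H) (\<lambda>x. (W x / p - lam)\<^sup>2) \<le> 1 / 3 * (eps * lam)\<^sup>2"
  \<comment> \<open>Without edges all sampled vertices survive and only the rounding of the sample
    size matters. Otherwise \<open>\<Delta> \<ge> 1\<close> and the degree hypothesis force
    \<open>n \<ge> 4\<close>.\<close>
  proof (cases "\<Delta> = 0")
    case True
    then have deg0: "degree E v = 0" if "v \<in> {1..n}" for v using deg_le[OF that] by simp
    then have lam: "lam = real n" by (simp add: lam_def caro_wei_def)
    have "finite (nbrs E v)" for v using nbrs_subset[OF E] finite_subset by blast
    then have nb: "nbrs E v = {}" if "v \<in> {1..n}" for v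
      using deg0[OF that] degree_eq_card_nbrs[OF E, of v] by simp
    have W: "W x = real m" if "x \<in> S \<times> H" for x
    proof -
      have "fst x \<subseteq> {1..n}" "card (fst x) = m" using that by (auto simp: S_def samples_def)
      then have "{v \<in> fst x. \<forall>w\<in>nbrs E v. snd x v < snd x w} = fst x" using nb by auto
      then show ?thesis using \<open>card (fst x) = m\<close> by (simp add: W_def case_prod_beta)
    qed
    have "\<bar>real m / p - real n\<bar> \<le> eps * real n / 4"
    proof (cases "p = 1")
      case True
      then show ?thesis using pm m eps by simp
    next
      case False
      then have p1: "p = 4 * D / (eps\<^sup>2 * real n)" unfolding p_eq by (auto simp: min_def split: if_splits)
      have "real n \<le> real m / p" "real m / p \<le> real n + 1 / p"
        using pm p by (simp_all add: field_simps)
      moreover have "1 / p \<le> eps * real n / 4"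
      proof -
        have "1 / p = eps\<^sup>2 * real n / (4 * D)" using p1 by simp
        also have "\<dots> \<le> eps\<^sup>2 * real n / (4 * 1)" using D by (intro divide_left_mono mult_left_mono) auto
        also have "\<dots> \<le> eps * real n / (4 * 1)"
          using eps by (intro divide_right_mono mult_right_mono) (auto simp: power2_eq_square)
        finally show ?thesis by simp
      qed
      ultimately show ?thesis unfolding abs_le_iff by linarith
    qed
    then have "\<bar>real m / p - real n\<bar>\<^sup>2 \<le> (eps * real n / 4)\<^sup>2" by (intro power_mono) auto
    then have sq: "(real m / p - real n)\<^sup>2 \<le> 1 / 3 * (eps * lam)\<^sup>2"
      unfolding lam power2_abs by (rule order_trans) (simp add: power_divide)
    have "avg (S \<times> H) (\<lambda>x. (W x / p - lam)\<^sup>2) = avg (S \<times> H) (\<lambda>x. (real m / p - lam)\<^sup>2)"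
      by (rule avg_cong) (simp only: W)
    also have "\<dots> = (real m / p - real n)\<^sup>2"
      using finS finH neS neH by (simp add: avg_const lam)
    finally show ?thesis using sq by simp
  next
    case False
    define l where "l = nat \<lceil>100 * (1 + ln (1 / eps))\<rceil>"
    define L where "L = 2 * l"
    define \<delta> where "\<delta> = hash_error L"
    have ln: "0 \<le> ln (1 / eps)" using eps by simp
    have l: "100 * (1 + ln (1 / eps)) \<le> real l" "real l \<le> 100 * (1 + ln (1 / eps)) + 1"
    proof -
      have "real l = real_of_int \<lceil>100 * (1 + ln (1 / eps))\<rceil>" using ln by (simp add: l_def)
      then show "100 * (1 + ln (1 / eps)) \<le> real l" "real l \<le> 100 * (1 + ln (1 / eps)) + 1"
        by linarith+
    qed
    have \<delta>: "0 \<le> \<delta>" "\<delta> \<le> eps\<^sup>2 / 1000"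
      using hash_error_le[OF eps l(1)] by (auto simp: \<delta>_def L_def hash_error_def)
    \<comment> \<open>\<open>100 * L\<close> is \<open>200 * l\<close>, and \<open>l\<close> is at
      most \<open>101 * (1 + ln (1 / eps))\<close> after rounding, which gives 20200.\<close>
    have L: "2 \<le> L" "100 * L \<le> nat \<lceil>20200 * (1 + ln (1 / eps))\<rceil>"
    proof -
      have "1 \<le> real l" using l(1) ln by argo
      then show "2 \<le> L" by (simp add: L_def)
      have "real (100 * L) \<le> 20200 * (1 + ln (1 / eps))" using l(2) ln unfolding L_def by simp
      then show "100 * L \<le> nat \<lceil>20200 * (1 + ln (1 / eps))\<rceil>" by linarith
    qed
    interpret kwise_family "{1..n}" "n ^ 3" "nat \<lceil>20200 * (1 + ln (1 / eps))\<rceil>" H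
      by (rule kwise_family_k_wise_independent[OF H n])
    have \<Delta>1: "1 \<le> real \<Delta>" using False by simp
    have \<Delta>2: "real \<Delta> \<le> eps\<^sup>2 * real n / (3 * D ^ 3)" using \<Delta> by (simp add: \<Delta>_def D_def)
    have n4: "4 \<le> n"
    proof -
      have "3 * D ^ 3 \<ge> 3" using one_le_power[OF D, of 3] by simp
      then have "eps\<^sup>2 * real n / (3 * D ^ 3) \<le> eps\<^sup>2 * real n / 3"
        using e2 D by (intro divide_left_mono) auto
      then have "3 \<le> eps\<^sup>2 * real n" using \<Delta>1 \<Delta>2 by linarith
      also have "eps\<^sup>2 * real n < 1 * real n"
        using eps n power_strict_mono[of eps 1 2] by (intro mult_strict_right_mono) auto
      finally show ?thesis by simp
    qed
    have N27: "27 \<le> n ^ 3" using power_mono[of 3 n 3] n4 by simp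
    have sub: "nbrs E v \<subseteq> {1..n}" for v by (rule nbrs_subset[OF E])
    have cardN: "card (nbrs E v) \<le> n ^ 3" for v
    proof -
      have "card (nbrs E v) \<le> n" using card_mono[OF _ sub] by simp
      also have "\<dots> \<le> n ^ 3" using n by (intro self_le_power) auto
      finally show ?thesis .
    qed
    define P where "P = (\<lambda>u v. avg H (\<lambda>h. of_bool ((\<forall>w\<in>nbrs E u. h u < h w) \<and> (\<forall>w\<in>nbrs E v. h v < h w))))"
    define w where "w = (\<lambda>v. 1 / (real (degree E v) + 1))"
    have lam_w: "lam = (\<Sum>v\<in>{1..n}. w v)" by (simp add: lam_def caro_wei_def w_def)
    have P1: "P v v = min_prob v (nbrs E v)" for v by (simp add: P_def min_prob_def)
    have P2: "P u v = min_prob2 u (nbrs E u) v (nbrs E v)" for u v by (simp add: P_def min_prob2_def)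
    have EY1: "(\<Sum>v\<in>{1..n}. P v v) \<le> (1 + \<delta>) * lam"
      unfolding lam_w sum_distrib_left
    proof (rule sum_mono)
      fix v assume "v \<in> {1..n}"
      then show "P v v \<le> (1 + \<delta>) * w v"
        using min_prob_bounds(1)[OF L sub _ cardN, of v v] not_mem_nbrs[OF E]
        by (simp add: P1 w_def \<delta>_def degree_eq_card_nbrs[OF E])
    qed
    have EY2: "(1 - \<delta> - (real \<Delta> + 1) / real n ^ 3) * lam \<le> (\<Sum>v\<in>{1..n}. P v v)"
      unfolding lam_w sum_distrib_left
    proof (rule sum_mono)
      fix v assume v: "v \<in> {1..n}"
      have "(1 - \<delta> - (real \<Delta> + 1) / real n ^ 3) * w v
          \<le> (1 - \<delta> - (real (degree E v) + 1) / real n ^ 3) * w v"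
        using deg_le[OF v] by (intro mult_right_mono diff_left_mono divide_right_mono) (auto simp: w_def)
      also have "\<dots> \<le> P v v"
        using min_prob_bounds(2)[OF L sub _ cardN, of v v] v not_mem_nbrs[OF E]
        by (simp add: P1 w_def \<delta>_def degree_eq_card_nbrs[OF E])
      finally show "(1 - \<delta> - (real \<Delta> + 1) / real n ^ 3) * w v \<le> P v v" .
    qed
    have pair: "P u v \<le> (1 + \<delta>) * (w u * w v) + real (card (nbrs E u \<inter> nbrs E v)) / 8"
      if uv: "u \<in> {1..n}" "v \<in> {1..n}" "u \<noteq> v" for u v
    \<comment> \<open>Adjacent vertices cannot each have the smaller hash value, so their joint
      probability is 0; otherwise \<open>min_prob2_le\<close> applies.\<close>
    proof (cases "v \<in> nbrs E u")
      case True
      then have "u \<in> nbrs E v" by (simp add: nbrs_sym)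
      then have "\<not> ((\<forall>w\<in>nbrs E u. h u < h w) \<and> (\<forall>w\<in>nbrs E v. h v < h w))" for h :: "nat \<Rightarrow> nat"
        using True by (meson less_asym)
      then have "P u v = avg H (\<lambda>h. 0)"
        unfolding P_def by (intro avg_cong) simp
      also have "\<dots> = 0" by (simp add: avg_def)
      finally have "P u v = 0" .
      moreover have "0 \<le> w u" "0 \<le> w v" by (auto simp: w_def)
      ultimately show ?thesis using \<delta>(1) by simp
    next
      case False
      then have "u \<notin> nbrs E v" by (simp add: nbrs_sym)
      then have "P u v \<le> (1 + hash_error L) / ((real (card (nbrs E u)) + 1) * (real (card (nbrs E v)) + 1))
          + real (card (nbrs E u \<inter> nbrs E v)) / 8"
        unfolding P2 using False uv sub not_mem_nbrs[OF E] cardN N27 L by (intro min_prob2_le) auto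
      then show ?thesis by (simp add: w_def \<delta>_def degree_eq_card_nbrs[OF E])
    qed
    \<comment> \<open>Cauchy-Schwarz bounds the removed diagonal from below; the resulting factor
      \<open>1 - 1 / n\<close> matches sampling without replacement.\<close>
    have ww: "(\<Sum>u\<in>{1..n}. \<Sum>v\<in>{1..n} - {u}. w u * w v) \<le> lam\<^sup>2 - lam\<^sup>2 / real n"
    proof -
      have "(\<Sum>u\<in>{1..n}. \<Sum>v\<in>{1..n} - {u}. w u * w v) = (\<Sum>u\<in>{1..n}. (\<Sum>v\<in>{1..n}. w u * w v) - (w u)\<^sup>2)"
        by (intro sum.cong refl) (simp add: sum_diff1 power2_eq_square)
      also have "\<dots> = lam\<^sup>2 - (\<Sum>u\<in>{1..n}. (w u)\<^sup>2)"
        by (simp add: sum_subtractf lam_w power2_eq_square sum_product)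
      finally show ?thesis
        using sum_squared_le_sum_of_squares[of w "{1..n}"] n by (simp add: lam_w divide_le_eq)
    qed
    have Off: "(\<Sum>u\<in>{1..n}. \<Sum>v\<in>{1..n} - {u}. P u v)
        \<le> (1 + \<delta>) * (lam\<^sup>2 - lam\<^sup>2 / real n) + real n * real \<Delta> * (D - 1) / 8"
    proof -
      have "(\<Sum>u\<in>{1..n}. \<Sum>v\<in>{1..n} - {u}. P u v)
          \<le> (\<Sum>u\<in>{1..n}. \<Sum>v\<in>{1..n} - {u}. (1 + \<delta>) * (w u * w v) + real (card (nbrs E u \<inter> nbrs E v)) / 8)"
        by (intro sum_mono pair) auto
      also have "\<dots> = (1 + \<delta>) * (\<Sum>u\<in>{1..n}. \<Sum>v\<in>{1..n} - {u}. w u * w v)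
          + (\<Sum>u\<in>{1..n}. \<Sum>v\<in>{1..n} - {u}. real (card (nbrs E u \<inter> nbrs E v))) / 8"
        by (simp only: sum.distrib sum_distrib_left sum_divide_distrib)
      also have "\<dots> \<le> (1 + \<delta>) * (lam\<^sup>2 - lam\<^sup>2 / real n)
          + (\<Sum>u\<in>{1..n}. \<Sum>v\<in>{1..n}. real (card (nbrs E u \<inter> nbrs E v))) / 8"
        using \<delta> ww by (intro add_mono mult_left_mono divide_right_mono sum_mono sum_mono2) auto
      also have "(\<Sum>u\<in>{1..n}. \<Sum>v\<in>{1..n}. real (card (nbrs E u \<inter> nbrs E v)))
          \<le> real \<Delta> * (\<Sum>v\<in>{1..n}. real (degree E v))"
        unfolding \<Delta>_def by (rule sum_common_nbrs_le[OF E])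
      also have "(\<Sum>v\<in>{1..n}. real (degree E v)) = real n * (D - 1)"
        using n by (simp add: D_def avg_degree_def)
      finally show ?thesis by (simp add: mult_ac)
    qed
    have lam_bounds: "real n / D \<le> lam" "lam \<le> real n"
    proof -
      show "real n / D \<le> lam" unfolding lam_def D_def by (rule caro_wei_ge[OF n])
      have "lam \<le> (\<Sum>v\<in>{1..n}. 1)" unfolding lam_w by (intro sum_mono) (simp add: w_def)
      then show "lam \<le> real n" by simp
    qed
    have EW: "avg (S \<times> H) W = real m / real n * (\<Sum>v\<in>{1..n}. P v v)"
      and EW2: "avg (S \<times> H) (\<lambda>x. (W x)\<^sup>2) = real m / real n * (\<Sum>v\<in>{1..n}. P v v)
        + real m * (real m - 1) / (real n * (real n - 1)) * (\<Sum>u\<in>{1..n}. \<Sum>v\<in>{1..n} - {u}. P u v)"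
      using sampled_moments[of "{1..n}" m H "\<lambda>v h. \<forall>w\<in>nbrs E v. h v < h w"] m
      unfolding S_def W_def P_def by simp_all
    have "avg (S \<times> H) (\<lambda>x. (W x / p - lam)\<^sup>2)
        = avg (S \<times> H) (\<lambda>x. (1 / p\<^sup>2) * (W x)\<^sup>2 + ((- 2 * lam / p) * W x + lam\<^sup>2))"
      by (rule avg_cong) (simp add: power2_eq_square algebra_simps)
    also have "\<dots> = (1 / p\<^sup>2) * avg (S \<times> H) (\<lambda>x. (W x)\<^sup>2) + ((- 2 * lam / p) * avg (S \<times> H) W + lam\<^sup>2)"
      using finS finH neS neH by (simp only: avg_add avg_cmult) (simp add: avg_const)
    also have "\<dots> = (real m / real n * (\<Sum>v\<in>{1..n}. P v v)
        + real m * (real m - 1) / (real n * (real n - 1)) * (\<Sum>u\<in>{1..n}. \<Sum>v\<in>{1..n} - {u}. P u v)) / p\<^sup>2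
        - 2 * lam * (real m / real n * (\<Sum>v\<in>{1..n}. P v v) / p) + lam\<^sup>2"
      unfolding EW EW2 by simp
    also have "\<dots> \<le> 1 / 3 * (eps\<^sup>2 * lam\<^sup>2)"
      by (rule mean_square_error_numeric[OF _ D e2 lam_bounds \<Delta>1 \<Delta>2 p_eq pm _ _ \<delta> EY1 EY2 Off])
        (use n4 m in simp_all)
    finally show ?thesis by (simp add: power_mult_distrib)
  qed
  then show ?thesis by (simp add: S_def W_def m_def p_def lam_def case_prod_unfold)
qed

lemma cwei_success:
  assumes n: "1 \<le> n" and eps: "0 < eps" "eps < 1" and E: "simple_graph n E" and es: "edge_stream_of es E"
    and \<Delta>: "real (max_degree n E) \<le> eps\<^sup>2 * real n / (3 * (avg_degree n E + 1) ^ 3)"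
    and H: "hash_family n H" "k_wise_independent (nat \<lceil>20200 * (1 + ln (1 / eps))\<rceil>) n H"
  shows "2 / 3 \<le> measure_pmf.prob (output_dist (cwei n (avg_degree n E) eps H) es)
    {x. (1 - eps) * caro_wei n E \<le> x \<and> x \<le> (1 + eps) * caro_wei n E}"
proof -
  let ?d = "avg_degree n E" and ?lam = "caro_wei n E"
  define p where "p = cwei_rate n ?d eps"
  define S where "S = samples {1..n} (cwei_sample_size n ?d eps)"
  define f where "f = (\<lambda>(S, h :: nat \<Rightarrow> nat). real (card {v \<in> S. \<forall>w\<in>nbrs E v. h v < h w}) / p)"
  have d0: "0 \<le> ?d" by (simp add: avg_degree_def sum_nonneg)
  have "H \<subseteq> {1..n} \<rightarrow>\<^sub>E {1..n ^ 3}" using H by (auto simp: hash_family_def)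
  then have finH: "finite H" by (rule finite_subset) (intro finite_PiE; simp)
  have neH: "H \<noteq> {}" using H by (auto simp: hash_family_def)
  have finS: "finite S" and neS: "S \<noteq> {}"
    using cwei_sample_size_bounds(6)[OF n d0 eps(1)] by (auto simp: S_def finite_samples samples_nonempty)
  have "0 < real n / (?d + 1)" using n d0 by simp
  then have lam: "0 < ?lam" using caro_wei_ge[OF n, of E] by linarith
  have "output_dist (cwei n ?d eps H) es = map_pmf f (pmf_of_set (S \<times> H))"
    unfolding output_dist_def cwei_def f_def p_def S_def samples_def[symmetric]
    using finS neS finH neH unfolding S_def
    by (simp add: pair_pmf_of_set) (intro map_pmf_cong refl, clarsimp simp: fold_cwei_step_nbrs[OF es])
  then have "measure_pmf.prob (output_dist (cwei n ?d eps H) es) {x. (1 - eps) * ?lam \<le> x \<and> x \<le> (1 + eps) * ?lam}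
      = measure_pmf.prob (pmf_of_set (S \<times> H)) {x. \<bar>f x - ?lam\<bar> \<le> eps * ?lam}"
    by (simp add: vimage_def abs_le_iff algebra_simps conj_commute)
  moreover have "1 - 1 / 3 \<le> measure_pmf.prob (pmf_of_set (S \<times> H)) {x. \<bar>f x - ?lam\<bar> \<le> eps * ?lam}"
  proof (rule second_moment_bound)
    show "avg (S \<times> H) (\<lambda>x. (f x - ?lam)\<^sup>2) \<le> 1 / 3 * (eps * ?lam)\<^sup>2"
      using cwei_mean_square_error[OF n eps E \<Delta> H] by (simp add: S_def f_def p_def case_prod_unfold)
  qed (use finS neS finH neH eps lam in auto)
  ultimately show ?thesis by simp
qed

section \<open>Working space\<close>

lemma reachable_states_cwei:
  assumes "1 \<le> n" "0 \<le> dbar" "0 < eps" "finite H" "H \<noteq> {}"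
  shows "reachable_states (cwei n dbar eps H) X
    \<subseteq> {S. S \<subseteq> {1..n} \<and> card S \<le> cwei_sample_size n dbar eps} \<times> H"
proof
  let ?m = "cwei_sample_size n dbar eps"
  fix s assume "s \<in> reachable_states (cwei n dbar eps H) X"
  then obtain es s0 where s: "s = fold (update (cwei n dbar eps H)) es s0" "s0 \<in> set_pmf (start (cwei n dbar eps H))"
    by (auto simp: reachable_states_def)
  have "finite (samples {1..n} ?m)" "samples {1..n} ?m \<noteq> {}"
    using cwei_sample_size_bounds(6)[of n dbar eps] assms by (auto simp: finite_samples samples_nonempty)
  then have "set_pmf (start (cwei n dbar eps H)) = samples {1..n} ?m \<times> H"
    using assms by (simp add: cwei_def samples_def[symmetric] set_pmf_of_set)
  with s(2) obtain S h where sh: "s0 = (S, h)" "S \<subseteq> {1..n}" "card S = ?m" "h \<in> H"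
    by (auto simp: samples_def)
  have "finite S" using sh finite_subset by blast
  have s_eq: "s = ({x \<in> S. \<forall>(u, v)\<in>set es. (x = u \<longrightarrow> h u < h v) \<and> (x = v \<longrightarrow> h v < h u)}, h)"
    unfolding s sh(1) by (simp add: cwei_def fold_cwei_step)
  have "card {x \<in> S. \<forall>(u, v)\<in>set es. (x = u \<longrightarrow> h u < h v) \<and> (x = v \<longrightarrow> h v < h u)} \<le> card S"
    using \<open>finite S\<close> by (intro card_mono) auto
  then show "s \<in> {S. S \<subseteq> {1..n} \<and> card S \<le> ?m} \<times> H"
    unfolding s_eq using sh by auto
qed

text \<open>Here \<open>log 2 (real n) = 0\<close>, so zero bits are available and the state must be
  constant: there are no edges, the sample is \<open>{1}\<close>, and only one hash function
  exists.\<close>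

lemma reachable_states_cwei_1:
  assumes "hash_family 1 H" "0 \<le> dbar" "0 < eps" "eps < 1"
  shows "reachable_states (cwei 1 dbar eps H) (all_edges 1) \<subseteq> {({1}, \<lambda>x\<in>{1}. 1)}"
proof
  fix s assume "s \<in> reachable_states (cwei 1 dbar eps H) (all_edges 1)"
  moreover have "all_edges 1 = {}" by (auto simp: all_edges_def)
  ultimately have s: "s \<in> set_pmf (start (cwei 1 dbar eps H))" by (auto simp: reachable_states_def)
  have H: "H \<subseteq> {1..1} \<rightarrow>\<^sub>E {1..1 ^ 3}" "H \<noteq> {}" using assms by (auto simp: hash_family_def)
  then have finH: "finite H" by (intro finite_subset[OF H(1)] finite_PiE) auto
  have "4 * (dbar + 1) / eps\<^sup>2 \<ge> 1"
  proof -
    have "eps\<^sup>2 \<le> 1" using assms by (simp add: power_le_one)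
    then show ?thesis using assms by (simp add: le_divide_eq)
  qed
  then have m: "cwei_sample_size 1 dbar eps = 1" by (simp add: cwei_sample_size_def cwei_rate_def)
  have "samples {1..1 :: nat} 1 = {{1}}"
    by (auto simp: samples_def card_1_singleton_iff)
  then have "set_pmf (start (cwei 1 dbar eps H)) = {{1}} \<times> H"
    using finH H(2) by (simp add: cwei_def m samples_def[symmetric] set_pmf_of_set del: One_nat_def)
  then obtain h where h: "s = ({1}, h)" "h \<in> H" using s by auto
  then have hP: "h \<in> {1..1} \<rightarrow>\<^sub>E {1..1 ^ 3}" using H by auto
  have "h = (\<lambda>x\<in>{1}. 1)"
    by (rule ext) (use hP in \<open>auto simp: PiE_def Pi_def extensional_def restrict_def\<close>)
  then show "s \<in> {({1}, \<lambda>x\<in>{1}. 1)}" using h by simp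
qed

text \<open>A state is a set of at most \<open>m\<close> vertices together with \<open>h\<close>,
  hence \<open>m * log 2 (n + 1) + log 2 (card H)\<close> bits. The constant 21 is 10 * 2, from
  \<open>m \<le> 10 * M / eps\<^sup>2\<close> and \<open>log 2 (n + 1) \<le> 2 * log 2 n\<close>,
  plus 1 for rounding up, which \<open>Q \<ge> 1\<close> pays for.\<close>

lemma cwei_uses_bits:
  assumes n: "1 \<le> n" and d: "0 \<le> dbar" and eps: "0 < eps" "eps < 1" and H: "hash_family n H"
    and c: "log 2 (real (card H)) \<le> c * (1 + ln (1 / eps)) * log 2 (real n)"
  shows "uses_bits (cwei n dbar eps H) (all_edges n) ((21 + \<bar>c\<bar>) * max 1 dbar * log 2 (real n) / eps\<^sup>2)"
proof (cases "n = 1")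
  case True
  let ?R = "reachable_states (cwei n dbar eps H) (all_edges n)"
  have R: "?R \<subseteq> {({1}, \<lambda>x\<in>{1}. 1)}"
    using reachable_states_cwei_1 H d eps True by simp
  then have "finite ?R" "card ?R \<le> 2 ^ 0"
    using finite_subset[OF R] card_mono[OF _ R] by auto
  then obtain enc :: "_ \<Rightarrow> bool list" where "inj_on enc ?R" "\<forall>s\<in>?R. length (enc s) = 0"
    using ex_bit_encoding[of ?R 0] by blast
  then show ?thesis unfolding uses_bits_def using True by auto
next
  case False
  then have n2: "2 \<le> n" using n by simp
  let ?R = "reachable_states (cwei n dbar eps H) (all_edges n)"
  define m where "m = cwei_sample_size n dbar eps"
  define M where "M = max 1 dbar"
  define ll where "ll = log 2 (real n)"
  define Q where "Q = M * ll / eps\<^sup>2"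
  have finH: "finite H" and neH: "H \<noteq> {}"
  proof -
    have "H \<subseteq> {1..n} \<rightarrow>\<^sub>E {1..n ^ 3}" using H by (auto simp: hash_family_def)
    then show "finite H" by (rule finite_subset) (intro finite_PiE; simp)
    show "H \<noteq> {}" using H by (auto simp: hash_family_def)
  qed
  define b where "b = nat \<lceil>real m * log 2 (real (n + 1)) + log 2 (real (card H))\<rceil>"
  have cardH: "1 \<le> real (card H)" using finH neH by (simp add: Suc_le_eq card_gt_0_iff)
  have finP: "finite {S. S \<subseteq> {1..n} \<and> card S \<le> m}" by simp
  have R: "?R \<subseteq> {S. S \<subseteq> {1..n} \<and> card S \<le> m} \<times> H"
    unfolding m_def using n d eps finH neH by (intro reachable_states_cwei) auto
  have finR: "finite ?R" using finite_subset[OF R] finP finH by blast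
  have "card ?R \<le> card ({S. S \<subseteq> {1..n} \<and> card S \<le> m} \<times> H)"
    using R finP finH by (intro card_mono) auto
  also have "\<dots> \<le> (n + 1) ^ m * card H"
    unfolding card_cartesian_product by (intro mult_right_mono card_small_subsets_le) auto
  finally have cR: "card ?R \<le> (n + 1) ^ m * card H" .
  have "real ((n + 1) ^ m * card H) = 2 powr (real m * log 2 (real (n + 1)) + log 2 (real (card H)))"
  proof -
    have "2 powr (real m * log 2 (real (n + 1))) = real (n + 1) ^ m"
      by (simp add: powr_powr[symmetric] mult.commute[of "real m"] powr_realpow)
    then show ?thesis using cardH by (simp add: powr_add)
  qed
  also have "\<dots> \<le> 2 powr real b" unfolding b_def by (intro powr_mono real_nat_ceiling_ge) auto
  also have "\<dots> = real (2 ^ b)" by (simp add: powr_realpow)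
  finally have "(n + 1) ^ m * card H \<le> 2 ^ b" by (simp only: of_nat_le_iff)
  then have "card ?R \<le> 2 ^ b" using cR by simp
  then obtain enc :: "_ \<Rightarrow> bool list" where enc: "inj_on enc ?R" "\<forall>s\<in>?R. length (enc s) = b"
    using ex_bit_encoding[OF finR] by blast
  have e2: "0 < eps\<^sup>2" "eps\<^sup>2 \<le> 1" using eps by (auto simp: power_le_one)
  have ll1: "1 \<le> ll" using n2 by (simp add: ll_def le_log_iff)
  have M1: "1 \<le> M" "dbar \<le> M" by (auto simp: M_def)
  have MQ: "M * ll \<le> Q" using e2 M1 ll1 by (simp add: Q_def le_divide_eq mult_left_le)
  have Q1: "1 \<le> Q" using mult_mono[of 1 M 1 ll] M1 ll1 MQ by simp
  have m_le: "real m \<le> 10 * M / eps\<^sup>2"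
  proof -
    have "real m \<le> cwei_rate n dbar eps * real n + 1"
      unfolding m_def by (rule cwei_sample_size_bounds(4)[OF n d eps(1)])
    also have "\<dots> \<le> 4 * (dbar + 1) / eps\<^sup>2 + 1 / eps\<^sup>2"
    proof (rule add_mono)
      have "cwei_rate n dbar eps * real n \<le> 4 * (dbar + 1) / (eps\<^sup>2 * real n) * real n"
        by (intro mult_right_mono) (auto simp: cwei_rate_def)
      then show "cwei_rate n dbar eps * real n \<le> 4 * (dbar + 1) / eps\<^sup>2" using n by simp
    qed (use e2 in \<open>simp add: le_divide_eq\<close>)
    also have "\<dots> = (4 * dbar + 5) / eps\<^sup>2" by (simp add: add_divide_distrib)
    also have "\<dots> \<le> 10 * M / eps\<^sup>2" using M1 by (intro divide_right_mono) auto
    finally show ?thesis .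
  qed
  have "log 2 (real (n + 1)) \<le> 2 * ll"
  proof -
    have "2 * real n \<le> real n * real n" using n2 by (intro mult_right_mono) auto
    then have "real (n + 1) \<le> real n ^ 2" using n2 unfolding power2_eq_square by linarith
    then have "log 2 (real (n + 1)) \<le> log 2 (real n ^ 2)" by (intro log_mono) auto
    also have "\<dots> = 2 * ll" using n2 by (simp add: ll_def log_nat_power)
    finally show ?thesis .
  qed
  then have "real m * log 2 (real (n + 1)) \<le> (10 * M / eps\<^sup>2) * (2 * ll)"
    using m_le M1 by (intro mult_mono) auto
  also have "\<dots> = 20 * Q" by (simp add: Q_def)
  finally have t1: "real m * log 2 (real (n + 1)) \<le> 20 * Q" .
  have t2: "log 2 (real (card H)) \<le> \<bar>c\<bar> * Q"
  proof -
    have ln0: "0 \<le> ln (1 / eps)" using eps by simp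
    have "c * (1 + ln (1 / eps)) * ll \<le> \<bar>c\<bar> * (1 + ln (1 / eps)) * ll"
      using ll1 ln0 by (intro mult_right_mono) auto
    also have "\<dots> \<le> \<bar>c\<bar> * (M / eps\<^sup>2) * ll"
    proof (intro mult_right_mono mult_left_mono)
      have "1 + ln (1 / eps) \<le> 1 / eps" using ln_le_minus_one[of "1 / eps"] eps by simp
      also have "\<dots> \<le> 1 / eps\<^sup>2" using eps by (intro divide_left_mono) (auto simp: power2_eq_square mult_left_le)
      also have "\<dots> \<le> M / eps\<^sup>2" using M1 by (intro divide_right_mono) auto
      finally show "1 + ln (1 / eps) \<le> M / eps\<^sup>2" .
    qed (use ll1 in auto)
    also have "\<dots> = \<bar>c\<bar> * Q" by (simp add: Q_def)
    finally show ?thesis using c by (simp add: ll_def)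
  qed
  have "0 \<le> real m * log 2 (real (n + 1)) + log 2 (real (card H))"
    using cardH by (intro add_nonneg_nonneg mult_nonneg_nonneg) auto
  then have "real b \<le> real m * log 2 (real (n + 1)) + log 2 (real (card H)) + 1"
    unfolding b_def by linarith
  also have "\<dots> \<le> 20 * Q + \<bar>c\<bar> * Q + Q" using t1 t2 Q1 by linarith
  also have "\<dots> = (21 + \<bar>c\<bar>) * max 1 dbar * log 2 (real n) / eps\<^sup>2"
    by (simp add: Q_def M_def ll_def algebra_simps add_divide_distrib)
  finally show ?thesis unfolding uses_bits_def using enc by auto
qed

text \<open>\<open>K\<close> is fixed before \<open>c\<close>, so the order of independence does not
  depend on how compactly the family is stored; only the space constant \<open>C\<close> does. The
  maximum with 1 accounts for sparse graphs, whose sample can still have order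
  \<open>1 / \<epsilon>\<^sup>2\<close> elements.\<close>

theorem theorem6:
  shows "\<exists>K :: real. \<forall>c :: real. \<exists>C :: real.
    \<forall>(n :: nat) (\<epsilon> :: real) (E :: nat set set) (es :: (nat \<times> nat) list) (H :: (nat \<Rightarrow> nat) set).
      n \<ge> 1 \<and> 0 < \<epsilon> \<and> \<epsilon> < 1 \<and>
      simple_graph n E \<and> edge_stream_of es E \<and>
      real (max_degree n E) \<le> \<epsilon>\<^sup>2 * real n / (3 * (avg_degree n E + 1) ^ 3) \<and>
      hash_family n H \<and> min_wise \<epsilon> n H \<and>
      k_wise_independent (nat \<lceil>K * (1 + ln (1 / \<epsilon>))\<rceil>) n H \<and>
      log 2 (real (card H)) \<le> c * (1 + ln (1 / \<epsilon>)) * log 2 (real n)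
      \<longrightarrow>
      measure_pmf.prob (output_dist (cwei n (avg_degree n E) \<epsilon> H) es)
        {x. (1 - \<epsilon>) * caro_wei n E \<le> x \<and> x \<le> (1 + \<epsilon>) * caro_wei n E} \<ge> 2 / 3 \<and>
      uses_bits (cwei n (avg_degree n E) \<epsilon> H) (all_edges n)
        (C * max 1 (avg_degree n E) * log 2 (real n) / \<epsilon>\<^sup>2)"
proof (rule exI[of _ 20200], intro allI)
  fix c :: real
  show "\<exists>C :: real.
    \<forall>(n :: nat) (\<epsilon> :: real) (E :: nat set set) (es :: (nat \<times> nat) list) (H :: (nat \<Rightarrow> nat) set).
      n \<ge> 1 \<and> 0 < \<epsilon> \<and> \<epsilon> < 1 \<and>
      simple_graph n E \<and> edge_stream_of es E \<and>
      real (max_degree n E) \<le> \<epsilon>\<^sup>2 * real n / (3 * (avg_degree n E + 1) ^ 3) \<and>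
      hash_family n H \<and> min_wise \<epsilon> n H \<and>
      k_wise_independent (nat \<lceil>20200 * (1 + ln (1 / \<epsilon>))\<rceil>) n H \<and>
      log 2 (real (card H)) \<le> c * (1 + ln (1 / \<epsilon>)) * log 2 (real n)
      \<longrightarrow>
      measure_pmf.prob (output_dist (cwei n (avg_degree n E) \<epsilon> H) es)
        {x. (1 - \<epsilon>) * caro_wei n E \<le> x \<and> x \<le> (1 + \<epsilon>) * caro_wei n E} \<ge> 2 / 3 \<and>
      uses_bits (cwei n (avg_degree n E) \<epsilon> H) (all_edges n)
        (C * max 1 (avg_degree n E) * log 2 (real n) / \<epsilon>\<^sup>2)"
  proof (rule exI[of _ "21 + \<bar>c\<bar>"], intro allI impI, elim conjE, intro conjI)
    fix n :: nat and \<epsilon> :: real and E :: "nat set set" and es :: "(nat \<times> nat) list" and H :: "(nat \<Rightarrow> nat) set"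
    assume *: "n \<ge> 1" "0 < \<epsilon>" "\<epsilon> < 1" "simple_graph n E" "edge_stream_of es E"
      "real (max_degree n E) \<le> \<epsilon>\<^sup>2 * real n / (3 * (avg_degree n E + 1) ^ 3)" "hash_family n H"
      "k_wise_independent (nat \<lceil>20200 * (1 + ln (1 / \<epsilon>))\<rceil>) n H"
      "log 2 (real (card H)) \<le> c * (1 + ln (1 / \<epsilon>)) * log 2 (real n)"
    show "measure_pmf.prob (output_dist (cwei n (avg_degree n E) \<epsilon> H) es)
        {x. (1 - \<epsilon>) * caro_wei n E \<le> x \<and> x \<le> (1 + \<epsilon>) * caro_wei n E} \<ge> 2 / 3"
      by (rule cwei_success) (use * in auto)
    have "0 \<le> avg_degree n E" by (simp add: avg_degree_def sum_nonneg)
    then show "uses_bits (cwei n (avg_degree n E) \<epsilon> H) (all_edges n)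
        ((21 + \<bar>c\<bar>) * max 1 (avg_degree n E) * log 2 (real n) / \<epsilon>\<^sup>2)"
      by (intro cwei_uses_bits) (use * in auto)
  qed
qed

end
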